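(* Let $r \in \{1,2,\ldots,\infty\}$, let $M$ be a compact Riemannian $C^r$ manifold, and let $T : M \to M$ be a $C^r$ diffeomorphism. Let $X \subset M$ be a compact set and let $\mu$ be a Borel probability measure on $X$. Fix $k \in \mathbb{N}$ such that $\mathcal{H}^k(X) = 0$ and $k \geq \dim M$, and assume that $\mu\left(\bigcup_{p=1}^{k-1}\mathrm{Per}_p(T)\right) = 0$. Then the following holds for a prevalent $C^r$ observable $h : M \to \mathbb{R}$ (prevalence in $C^r(M,\mathbb{R})$): for $\mu$-a.e. $x \in X$ there exists $C = C(x,h)$ such that for all $\varepsilon > 0$ $$\sigma_{h,\varepsilon}(\phi_{h,k}(x)) \leq C\varepsilon.$$
   Context: Notation. $\mathbb{N} = \{1,2,\ldots\}$. Manifolds are finite-dimensional and Hausdorff. A Riemannian $C^r$ manifold is a $C^r$ manifold with a metric tensor depending continuously on the point; $\rho : M\times M \to [0,\infty)$ is the (finite-valued) metric induced by it and $\mathcal{H}^k$ is the $k$-dimensional Hausdorff measure with respect to $\rho$. $\mathrm{Per}_p(T) = \{x \in M : T^p x = x\}$. For $h : M \to \mathbb{R}$, $\phi_{h,k} : M \to \mathbb{R}^k$, $\phi_{h,k}(x) = (h(x),h(Tx),\ldots,h(T^{k-1}x))$. Prediction error. For $y$ in the support of the push-forward measure $\phi_{h,k}\mu$ and $\varepsilon > 0$, with $B(y,\varepsilon)$ the open Euclidean ball in $\mathbb{R}^k$, $$\chi_{h,\varepsilon}(y) = \frac{1}{\mu(\phi_{h,k}^{-1}(B(y,\varepsilon)))}\int_{\phi_{h,k}^{-1}(B(y,\varepsilon))}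 \phi_{h,k}\circ T \, d\mu,$$ $$\sigma_{h,\varepsilon}(y) = \left(\frac{1}{\mu(\phi_{h,k}^{-1}(B(y,\varepsilon)))}\int_{\phi_{h,k}^{-1}(B(y,\varepsilon))} \|\phi_{h,k}\circ T - \chi_{h,\varepsilon}(y)\|^2\, d\mu\right)^{1/2},$$ where $\|\cdot\|$ is the Euclidean norm. (For $\mu$-a.e. $x$, $\phi_{h,k}(x)$ lies in this support.) Prevalence. $C^r(M,\mathbb{R})$ carries the topology of uniform convergence of derivatives of orders up to $r$ (all orders if $r=\infty$); it is a complete metrizable linear space. In a complete linear metric space $W$, a Borel set $S \subset W$ is prevalent if there is a Borel measure $\nu$ on $W$, positive and finite on some compact set in $W$, such that for every $v \in W$ one has $v + e \in S$ for $\nu$-almost every $e \in W$. A non-Borel set is prevalent if it contains a prevalent Borel set. A property holds for a prevalent element if the set of elements having it is prevalent. *)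

theory Defs
  imports "HOL-Analysis.Analysis" "HOL-Probability.Probability" "HOL-Library.Extended_Nat"
    "HOL-Library.Function_Algebras"
begin

section \<open>Maps of class \<open>C\<^sup>r\<close> between normed spaces\<close>

text \<open>The iterated directional derivative of \<open>f\<close> along the list of directions \<open>vs\<close>.\<close>

fun dir_derivs :: "'e list \<Rightarrow> ('e::real_normed_vector \<Rightarrow> 'b::real_normed_vector) \<Rightarrow> 'e \<Rightarrow> 'b" where
  "dir_derivs [] f = f"
| "dir_derivs (v # vs) f = dir_derivs vs (\<lambda>x. frechet_derivative f (at x) v)"

text \<open>
  Only used for open \<open>S\<close> and finite-dimensional domains, where continuity of all iterated
  directional derivatives of order \<open>j\<close> is continuity of the \<open>j\<close>-th Frechet derivative.
  The case \<open>r = \<infinity>\<close> is smoothness.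
\<close>

definition Cr_on :: "enat \<Rightarrow> 'e set \<Rightarrow> ('e::real_normed_vector \<Rightarrow> 'b::real_normed_vector) \<Rightarrow> bool" where
  "Cr_on r S f \<longleftrightarrow>
     (\<forall>vs. enat (length vs) \<le> r \<longrightarrow> continuous_on S (dir_derivs vs f)) \<and>
     (\<forall>vs. enat (length vs) < r \<longrightarrow> (\<forall>x\<in>S. dir_derivs vs f differentiable (at x)))"

section \<open>Manifolds\<close>

text \<open>
  The manifold is the whole type \<open>'m\<close> with its (Hausdorff) topology, and its differentiable
  structure is given by an atlas \<open>A\<close>, not necessarily maximal.  A chart is a domain together with
  a coordinate map.  The model space is a finite-dimensional normed space \<open>'e\<close> rather than a
  type of class \<^class>\<open>euclidean_space\<close>, because the latter has positive dimension and would exclude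
  manifolds of dimension 0.  The dimension of the manifold is \<open>dim (UNIV :: 'e set)\<close>.
\<close>

type_synonym ('m, 'e) chart = "'m set \<times> ('m \<Rightarrow> 'e)"

definition is_chart :: "('m::topological_space, 'e::real_normed_vector) chart \<Rightarrow> bool" where
  "is_chart = (\<lambda>(U, \<phi>). open U \<and> open (\<phi> ` U) \<and> homeomorphism U (\<phi> ` U) \<phi> (inv_into U \<phi>))"

definition Cr_manifold :: "enat \<Rightarrow> ('m::t2_space, 'e::real_normed_vector) chart set \<Rightarrow> bool" where
  "Cr_manifold r A \<longleftrightarrow>
     (\<exists>B::'e set. finite B \<and> span B = UNIV) \<and>
     (\<forall>c\<in>A. is_chart c) \<and>
     (\<Union>(U, \<phi>)\<in>A. U) = UNIV \<and>
     (\<forall>(U, \<phi>)\<in>A. \<forall>(V, \<psi>)\<in>A. Cr_on r (\<phi> ` (U \<inter> V)) (\<psi> \<circ> inv_into U \<phi>))"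

definition Cr_map :: "enat \<Rightarrow> ('m::t2_space, 'e::real_normed_vector) chart set \<Rightarrow> ('m \<Rightarrow> 'm) \<Rightarrow> bool" where
  "Cr_map r A F \<longleftrightarrow> continuous_on UNIV F \<and>
     (\<forall>(U, \<phi>)\<in>A. \<forall>(V, \<psi>)\<in>A. Cr_on r (\<phi> ` (U \<inter> F -` V)) (\<psi> \<circ> F \<circ> inv_into U \<phi>))"

definition Cr_diffeomorphism ::
    "enat \<Rightarrow> ('m::t2_space, 'e::real_normed_vector) chart set \<Rightarrow> ('m \<Rightarrow> 'm) \<Rightarrow> bool" where
  "Cr_diffeomorphism r A F \<longleftrightarrow> bij F \<and> Cr_map r A F \<and> Cr_map r A (inv F)"

definition Cr_functions ::
    "enat \<Rightarrow> ('m::t2_space, 'e::real_normed_vector) chart set \<Rightarrow> ('m \<Rightarrow> real) set" where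
  "Cr_functions r A = {h. \<forall>(U, \<phi>)\<in>A. Cr_on r (\<phi> ` U) (h \<circ> inv_into U \<phi>)}"

text \<open>
  The topology of uniform convergence of derivatives of orders up to \<open>r\<close>, where convergence of
  derivatives is uniform on every compact subset \<open>K\<close> of the domain of every chart.  On a compact
  manifold finitely many such \<open>K\<close>, covering the manifold, yield the same topology.
\<close>

definition Cr_topology ::
    "enat \<Rightarrow> ('m::t2_space, 'e::real_normed_vector) chart set \<Rightarrow> ('m \<Rightarrow> real) topology" where
  "Cr_topology r A = topology_generated_by
     {{f \<in> Cr_functions r A. \<forall>x\<in>K.
         \<bar>dir_derivs vs (f \<circ> inv_into U \<phi>) (\<phi> x) - dir_derivs vs (h \<circ> inv_into U \<phi>) (\<phi> x)\<bar> < \<epsilon>}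
      | h U \<phi> K vs \<epsilon>. h \<in> Cr_functions r A \<and> (U, \<phi>) \<in> A \<and> compact K \<and> K \<subseteq> U \<and>
          enat (length vs) \<le> r \<and> 0 < \<epsilon>}"

section \<open>Riemannian metrics\<close>

text \<open>
  A metric tensor is given by its representations in the charts of the atlas: \<open>g c x\<close> is the inner
  product on the model space that represents the one on the tangent space at \<open>x\<close> in the chart \<open>c\<close>.
  The last condition is the transformation law for a change of charts.
\<close>

definition riemannian_metric ::
    "('m::t2_space, 'e::real_normed_vector) chart set \<Rightarrow>
     (('m, 'e) chart \<Rightarrow> 'm \<Rightarrow> 'e \<Rightarrow> 'e \<Rightarrow> real) \<Rightarrow> bool" where
  "riemannian_metric A g \<longleftrightarrow>
     (\<forall>(U, \<phi>)\<in>A.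
        (\<forall>x\<in>U. bilinear (g (U, \<phi>) x) \<and>
               (\<forall>v w. g (U, \<phi>) x v w = g (U, \<phi>) x w v) \<and>
               (\<forall>v. v \<noteq> 0 \<longrightarrow> 0 < g (U, \<phi>) x v v)) \<and>
        (\<forall>v w. continuous_on U (\<lambda>x. g (U, \<phi>) x v w))) \<and>
     (\<forall>(U, \<phi>)\<in>A. \<forall>(V, \<psi>)\<in>A. \<forall>x\<in>U \<inter> V. \<forall>v w.
        g (U, \<phi>) x v w =
        g (V, \<psi>) x (frechet_derivative (\<psi> \<circ> inv_into U \<phi>) (at (\<phi> x)) v)
                   (frechet_derivative (\<psi> \<circ> inv_into U \<phi>) (at (\<phi> x)) w))"

definition piecewise_C1_curve ::
    "('m::t2_space, 'e::real_normed_vector) chart set \<Rightarrow> (real \<Rightarrow> 'm) \<Rightarrow> bool" where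
  "piecewise_C1_curve A \<gamma> \<longleftrightarrow> continuous_on {0..1} \<gamma> \<and>
     (\<exists>S. finite S \<and>
        (\<forall>(U, \<phi>)\<in>A. (\<phi> \<circ> \<gamma>) C1_differentiable_on (({0<..<1} - S) \<inter> \<gamma> -` U)))"

text \<open>By the transformation law the speed does not depend on the choice of the chart.\<close>

definition curve_speed ::
    "('m::t2_space, 'e::real_normed_vector) chart set \<Rightarrow>
     (('m, 'e) chart \<Rightarrow> 'm \<Rightarrow> 'e \<Rightarrow> 'e \<Rightarrow> real) \<Rightarrow> (real \<Rightarrow> 'm) \<Rightarrow> real \<Rightarrow> real" where
  "curve_speed A g \<gamma> t =
     (let c = (SOME c. c \<in> A \<and> \<gamma> t \<in> fst c);
          v = vector_derivative (snd c \<circ> \<gamma>) (at t)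
      in sqrt (g c (\<gamma> t) v v))"

text \<open>
  The length takes the value \<open>\<infinity>\<close> on curves whose speed is not integrable (the speed may be unbounded
  near the finitely many exceptional points), so these do not contribute to infima.
\<close>

definition curve_length ::
    "('m::t2_space, 'e::real_normed_vector) chart set \<Rightarrow>
     (('m, 'e) chart \<Rightarrow> 'm \<Rightarrow> 'e \<Rightarrow> 'e \<Rightarrow> real) \<Rightarrow> (real \<Rightarrow> 'm) \<Rightarrow> ennreal" where
  "curve_length A g \<gamma> = (\<integral>\<^sup>+ t\<in>{0..1}. ennreal (curve_speed A g \<gamma> t) \<partial>lborel)"

definition length_dist ::
    "('m::t2_space, 'e::real_normed_vector) chart set \<Rightarrow>
     (('m, 'e) chart \<Rightarrow> 'm \<Rightarrow> 'e \<Rightarrow> 'e \<Rightarrow> real) \<Rightarrow> 'm \<Rightarrow> 'm \<Rightarrow> ennreal" where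
  "length_dist A g x y =
     (INF \<gamma>\<in>{\<gamma>. piecewise_C1_curve A \<gamma> \<and> \<gamma> 0 = x \<and> \<gamma> 1 = y}. curve_length A g \<gamma>)"

text \<open>
  The finite-valued metric induced by the metric tensor.  Within a connected component it is the
  infimum of the lengths of curves.  The second alternative only concerns points in different
  components of a disconnected manifold, where some convention is needed to keep the metric finite:
  their distance is one more than the largest diameter of a component.  (A compact manifold has
  finitely many components, so Hausdorff null sets do not depend on this convention.)
\<close>

definition riemannian_dist ::
    "('m::t2_space, 'e::real_normed_vector) chart set \<Rightarrow>
     (('m, 'e) chart \<Rightarrow> 'm \<Rightarrow> 'e \<Rightarrow> 'e \<Rightarrow> real) \<Rightarrow> 'm \<Rightarrow> 'm \<Rightarrow> real" where
  "riemannian_dist A g x y =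
     (if length_dist A g x y < \<infinity> then enn2real (length_dist A g x y)
      else 1 + enn2real (SUP (a, b)\<in>{(a, b). length_dist A g a b < \<infinity>}. length_dist A g a b))"

section \<open>Hausdorff measure\<close>

definition ediam :: "('a \<Rightarrow> 'a \<Rightarrow> real) \<Rightarrow> 'a set \<Rightarrow> ennreal" where
  "ediam d S = (SUP x\<in>S. SUP y\<in>S. ennreal (d x y))"

text \<open>The (outer) Hausdorff measure with respect to the metric \<open>d\<close>, without normalising constant.\<close>

definition hausdorff_measure :: "('a \<Rightarrow> 'a \<Rightarrow> real) \<Rightarrow> nat \<Rightarrow> 'a set \<Rightarrow> ennreal" where
  "hausdorff_measure d k S =
     (SUP \<delta>\<in>{0::real<..}.
        INF C\<in>{C :: nat \<Rightarrow> 'a set. S \<subseteq> (\<Union>i. C i) \<and> (\<forall>i. ediam d (C i) \<le> ennreal \<delta>)}.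
          (\<Sum>i. if C i = {} then 0 else ediam d (C i) ^ k))"

section \<open>Prevalence\<close>

text \<open>The linear space is the carrier of the topology \<open>W\<close>.\<close>

definition prevalent_borel :: "'w::ab_group_add topology \<Rightarrow> 'w set \<Rightarrow> bool" where
  "prevalent_borel W S \<longleftrightarrow>
     S \<in> sets (sigma (topspace W) {U. openin W U}) \<and>
     (\<exists>\<nu>. sets \<nu> = sets (sigma (topspace W) {U. openin W U}) \<and>
          (\<exists>K. compactin W K \<and> 0 < emeasure \<nu> K \<and> emeasure \<nu> K < \<infinity>) \<and>
          (\<forall>v\<in>topspace W. AE e in \<nu>. v + e \<in> S))"

definition prevalent :: "'w::ab_group_add topology \<Rightarrow> 'w set \<Rightarrow> bool" where
  "prevalent W S \<longleftrightarrow> S \<subseteq> topspace W \<and> (\<exists>S'\<subseteq>S. prevalent_borel W S')"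

section \<open>Prediction error of delay-coordinate maps\<close>

definition Per :: "nat \<Rightarrow> ('m \<Rightarrow> 'm) \<Rightarrow> 'm set" where
  "Per p T = {x. (T ^^ p) x = x}"

text \<open>
  The number \<open>k\<close> of measurements is \<open>CARD('k)\<close>.  The order on \<open>'k\<close> serves to number the coordinates:
  the coordinate with index \<open>i\<close> is preceded by \<open>card {j. j < i}\<close> others.
\<close>

definition delay_map :: "('m \<Rightarrow> 'm) \<Rightarrow> ('m \<Rightarrow> real) \<Rightarrow> 'm \<Rightarrow> real ^ ('k::{finite,linorder})" where
  "delay_map T h x = (\<chi> i. h ((T ^^ card {j. j < i}) x))"

definition delay_preimage ::
    "'m measure \<Rightarrow> ('m \<Rightarrow> 'm) \<Rightarrow> ('m \<Rightarrow> real) \<Rightarrow> real \<Rightarrow> real ^ ('k::{finite,linorder}) \<Rightarrow> 'm set" where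
  "delay_preimage \<mu> T h \<epsilon> y = delay_map T h -` ball y \<epsilon> \<inter> space \<mu>"

definition prediction_mean ::
    "'m measure \<Rightarrow> ('m \<Rightarrow> 'm) \<Rightarrow> ('m \<Rightarrow> real) \<Rightarrow> real \<Rightarrow> real ^ ('k::{finite,linorder}) \<Rightarrow> real ^ ('k::{finite,linorder})" where
  "prediction_mean \<mu> T h \<epsilon> y =
     (1 / measure \<mu> (delay_preimage \<mu> T h \<epsilon> y)) *\<^sub>R
     (LINT x:delay_preimage \<mu> T h \<epsilon> y|\<mu>. delay_map T h (T x))"

definition prediction_error ::
    "'m measure \<Rightarrow> ('m \<Rightarrow> 'm) \<Rightarrow> ('m \<Rightarrow> real) \<Rightarrow> real \<Rightarrow> real ^ ('k::{finite,linorder}) \<Rightarrow> real" where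
  "prediction_error \<mu> T h \<epsilon> y =
     sqrt ((1 / measure \<mu> (delay_preimage \<mu> T h \<epsilon> y)) *
       (LINT x:delay_preimage \<mu> T h \<epsilon> y|\<mu>. (norm (delay_map T h (T x) - prediction_mean \<mu> T h \<epsilon> y))\<^sup>2))"

end

(* By a variance estimate the prediction error at x is O(epsilon) as soon as
   |phi(T y) - phi(T x)| <= n |phi(y) - phi(x)| for all y in X and some n, where phi is the delay map
   of h. This holds when phi is injective at x on X and its derivative at x is injective, and the set of
   observables satisfying it for almost every x is a countable intersection of countable unions of
   closed sets, so that it is Borel.

   The probe is Lebesgue measure on a cube of combinations of finitely many functions of class C^r,
   namely the products of a fixed number of coordinate functions of an embedding of M, which
   interpolate values and derivatives at any 2k points. By Fubini it suffices to treat one point x whose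
   first k iterates are distinct, and by the translation invariance of Lebesgue measure one may shift
   the parameters in directions chosen according to x. For y with T^i x ~= T^j y for all i, j < k,
   shifting in k directions exhibits the parameters with phi(y) = phi(x) as a Lipschitz image of an
   H^k-null set, hence as a null set (functions of class C^1 are Lipschitz for the Riemannian
   distance); the finitely many other y ~= x are treated one at a time. A shift in one direction makes
   the derivative at x injective, except for the finitely many eigenvalues of a linear operator. *)

theory Submission
  imports Defs
begin

section \<open>Finite-dimensional normed spaces\<close>

text \<open>Fixing \<open>x\<close> is what lets k measurements suffice where embedding theorems ask
  for more than 2 dim M: the candidates for a collision with \<open>x\<close> form one copy of the
  null set \<open>X\<close> instead of a set of pairs, and only one derivative has to be injective.
  The price is that the null set of parameters depends on \<open>x\<close>, whence the joint
  measurability needed for Fubini. The number 2k counts k iterates of \<open>x\<close> and k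
  iterates of another point. The hypothesis on periodic points makes the former distinct, so that a
  perturbation can be prescribed independently at each of them; this breaks down exactly when an
  iterate of \<open>y\<close> meets one of \<open>x\<close>, hence the separate treatment of those
  points. Directions can be made to vanish along the orbit of one point \<open>y0\<close> only. For
  \<open>y\<close> near \<open>y0\<close> they are merely small, which a contraction with factor 1/2
  absorbs, and the Lindelof property leaves countably many such neighbourhoods. For the immersion,
  shifting by \<open>t\<close> adds \<open>t\<close> times the identity to a square block of the
  derivative, so that a kernel vector is an eigenvector to the eigenvalue -t of the unshifted block.
  This uses dim M \<le> k.\<close>

lemma compact_coordinate_cube: "compact {c :: 'a \<Rightarrow> real. \<forall>b. c b \<in> {-r..r}}"
proof -
  have "compactin (product_topology (\<lambda>b::'a. euclidean) UNIV) (PiE UNIV (\<lambda>b. {-r..r}))"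
    by (simp add: compactin_PiE)
  moreover have "PiE UNIV (\<lambda>b. {-r..r}) = {c :: 'a \<Rightarrow> real. \<forall>b. c b \<in> {-r..r}}"
    by (auto simp: PiE_def Pi_def)
  ultimately show ?thesis
    by (simp add: euclidean_product_topology)
qed

lemma continuous_on_linear_combination:
  fixes B :: "'e::real_normed_vector set"
  shows "continuous_on S (\<lambda>c::'e \<Rightarrow> real. \<Sum>b\<in>B. c b *\<^sub>R b)"
  by (intro continuous_intros continuous_on_product_coordinates[THEN continuous_on_subset]) auto

text \<open>The model space is a bare normed space, possibly of dimension 0; compactness of boxes
  and spheres and continuity of linear maps are derived from a finite basis.\<close>

locale finite_basis =
  fixes B :: "'e::real_normed_vector set"
  assumes finite_B: "finite B" and indep_B: "independent B" and span_B: "span B = UNIV"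
begin

abbreviation coord :: "'e \<Rightarrow> 'e \<Rightarrow> real" where
  "coord b z \<equiv> representation B z b"

lemma sum_coord: "(\<Sum>b\<in>B. coord b z *\<^sub>R b) = z"
  using real_vector.sum_representation_eq[OF indep_B, of z B] finite_B span_B by auto

lemma coord_eq_0: "b \<notin> B \<Longrightarrow> coord b z = 0"
  using real_vector.representation_ne_zero by blast

lemma coord_sum: "b \<in> B \<Longrightarrow> coord b (\<Sum>b\<in>B. c b *\<^sub>R b) = c b"
proof -
  assume b: "b \<in> B"
  have "coord b (\<Sum>b\<in>B. c b *\<^sub>R b) = (\<Sum>b'\<in>B. coord b (c b' *\<^sub>R b'))"
    using real_vector.representation_sum[OF indep_B, of B "\<lambda>b. c b *\<^sub>R b"] span_B by simp
  also have "\<dots> = (\<Sum>b'\<in>B. if b' = b then c b else 0)"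
    using real_vector.representation_scale[OF indep_B] real_vector.representation_basis[OF indep_B] span_B
    by (intro sum.cong) (auto)
  also have "\<dots> = c b" using b finite_B by simp
  finally show ?thesis .
qed

lemma linear_coord: "linear (coord b)"
  using span_B by (intro linearI) (simp_all add: real_vector.representation_add[OF indep_B]
      real_vector.representation_scale[OF indep_B])

text \<open>A multiple of every vector lies in the compact face of the coordinate cube on which its largest
  coordinate equals 1, and the norm is bounded below there.\<close>

lemma coord_bounded: "\<exists>K>0. \<forall>z. \<forall>b\<in>B. \<bar>coord b z\<bar> \<le> K * norm z"
proof -
  let ?g = "\<lambda>c::'e \<Rightarrow> real. \<Sum>b\<in>B. c b *\<^sub>R b"
  have "\<exists>d>0. \<forall>c. (\<forall>b. c b \<in> {-1..1}) \<longrightarrow> c b0 = 1 \<longrightarrow> d \<le> norm (?g c)" if b0: "b0 \<in> B" for b0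
  proof -
    let ?C = "{c :: 'e \<Rightarrow> real. \<forall>b. c b \<in> {-1..1}} \<inter> {c. c b0 = 1}"
    have "closed {c :: 'e \<Rightarrow> real. c b0 = 1}"
      by (intro closed_Collect_eq continuous_on_product_coordinates continuous_intros)
    then have C: "compact ?C" using compact_coordinate_cube by (intro compact_Int_closed)
    then have "compact (?g ` ?C)"
      by (rule compact_continuous_image[OF continuous_on_linear_combination])
    then have "closed (?g ` ?C)" by (rule compact_imp_closed)
    moreover have "0 \<notin> ?g ` ?C"
    proof
      assume "0 \<in> ?g ` ?C"
      then obtain c where c: "c b0 = 1" "?g c = 0" by force
      have "coord b0 (?g c) = c b0" by (rule coord_sum[OF b0])
      with c show False
        using linear_0[OF linear_coord[of b0]] by simp
    qed
    ultimately have "open (- (?g ` ?C))" "0 \<in> - (?g ` ?C)" by auto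
    then obtain d where d: "d > 0" "ball 0 d \<subseteq> - (?g ` ?C)"
      using open_contains_ball by blast
    have "d \<le> norm (?g c)" if "c \<in> ?C" for c
      using d(2) imageI[OF that, of ?g] by (meson ComplD linorder_not_le mem_ball_0 subsetD)
    with d(1) show ?thesis by (intro exI[of _ d]) auto
  qed
  then obtain d where d: "\<And>b. b \<in> B \<Longrightarrow> d b > 0"
     "\<And>b c. b \<in> B \<Longrightarrow> (\<forall>b. c b \<in> {-1..1}) \<Longrightarrow> c b = 1 \<Longrightarrow> d b \<le> norm (?g c)" by metis
  \<comment> \<open>The inserted 1 keeps \<open>K\<close> positive when \<open>B\<close> is empty,
    that is, in dimension 0.\<close>
  define K where "K = Max (insert 1 ((\<lambda>b. 1 / d b) ` B))"
  have fin: "finite (insert 1 ((\<lambda>b. 1 / d b) ` B))" using finite_B by simp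
  have K1: "1 \<le> K" unfolding K_def using fin by (intro Max_ge) auto
  have Kb: "1 / d b \<le> K" if "b \<in> B" for b unfolding K_def using fin that by (intro Max_ge) auto
  have "\<bar>coord b z\<bar> \<le> K * norm z" if b: "b \<in> B" for b z
  proof -
    obtain b1 where b1: "b1 \<in> B" and max: "\<And>b. b \<in> B \<Longrightarrow> \<bar>coord b z\<bar> \<le> \<bar>coord b1 z\<bar>"
    proof -
      have "Max ((\<lambda>b. \<bar>coord b z\<bar>) ` B) \<in> (\<lambda>b. \<bar>coord b z\<bar>) ` B"
        using finite_B b by (intro Max_in) auto
      then obtain b1 where "b1 \<in> B" "Max ((\<lambda>b. \<bar>coord b z\<bar>) ` B) = \<bar>coord b1 z\<bar>" by auto
      then show ?thesis using that[of b1] finite_B by (metis Max_ge finite_imageI imageI)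
    qed
    show ?thesis
    proof (cases "coord b1 z = 0")
      case True
      then have "coord b z = 0" using max[OF b] by simp
      then show ?thesis using K1 by simp
    next
      case False
      define c where "c = (\<lambda>b. coord b z / coord b1 z)"
      have "c b \<in> {-1..1}" for b
        using max[of b] False coord_eq_0[of b z] unfolding c_def
        by (cases "b \<in> B") (auto simp: divide_simps abs_if split: if_splits)
      moreover have "c b1 = 1" using False by (simp add: c_def)
      ultimately have "d b1 \<le> norm (?g c)" using d(2)[OF b1] by blast
      also have "?g c = (1 / coord b1 z) *\<^sub>R z"
        unfolding c_def by (subst (3) sum_coord[of z, symmetric]) (simp add: scaleR_right.sum)
      finally have "d b1 * \<bar>coord b1 z\<bar> \<le> norm z" using False by (simp add: field_simps)
      then have "\<bar>coord b1 z\<bar> \<le> (1 / d b1) * norm z" using d(1)[OF b1] by (simp add: field_simps)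
      also have "\<dots> \<le> K * norm z" using Kb[OF b1] by (intro mult_right_mono) auto
      finally show ?thesis using max[OF b] by simp
    qed
  qed
  with K1 show ?thesis by (intro exI[of _ K]) auto
qed

lemma bounded_linear_coord: "bounded_linear (coord b)"
proof (cases "b \<in> B")
  case True
  obtain K where "K > 0" "\<forall>z. \<forall>b\<in>B. \<bar>coord b z\<bar> \<le> K * norm z" using coord_bounded by blast
  then show ?thesis using True linear_coord[of b]
    by (intro bounded_linear_intro[of _ K]) (auto simp: linear_iff mult.commute)
next
  case False
  then have "coord b = (\<lambda>z. 0)" using coord_eq_0 by auto
  then show ?thesis by simp
qed

lemma linear_expand:
  fixes F :: "'e \<Rightarrow> 'b::real_normed_vector"
  assumes "linear F" shows "F u = (\<Sum>b\<in>B. coord b u *\<^sub>R F b)"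
proof -
  have "F u = F (\<Sum>b\<in>B. coord b u *\<^sub>R b)" by (simp add: sum_coord)
  also have "\<dots> = (\<Sum>b\<in>B. coord b u *\<^sub>R F b)"
    using assms by (simp add: linear_sum linear_scale)
  finally show ?thesis .
qed

lemma bounded_linear_if_linear:
  fixes F :: "'e \<Rightarrow> 'b::real_normed_vector"
  assumes "linear F" shows "bounded_linear F"
proof -
  have "bounded_linear (\<lambda>u. \<Sum>b\<in>B. coord b u *\<^sub>R F b)"
    by (rule bounded_linear_sum) (rule bounded_linear_compose[OF bounded_linear_scaleR_left bounded_linear_coord])
  moreover have "F = (\<lambda>u. \<Sum>b\<in>B. coord b u *\<^sub>R F b)" by (rule ext) (rule linear_expand[OF assms])
  ultimately show ?thesis by metis
qed

text \<open>The box is an affine image of a compact coordinate cube. For negative \<open>r\<close>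
  it is empty, or the single point \<open>z0\<close> if \<open>B\<close> is empty.\<close>

lemma compact_box:
  fixes z0 :: 'e
  shows "compact {z. \<forall>b\<in>B. \<bar>coord b (z - z0)\<bar> \<le> r}"
proof -
  let ?C = "{c :: 'e \<Rightarrow> real. \<forall>b. c b \<in> {-r..r}}"
  let ?g = "\<lambda>c::'e \<Rightarrow> real. z0 + (\<Sum>b\<in>B. c b *\<^sub>R b)"
  have "compact (?g ` ?C)"
    by (intro compact_continuous_image compact_coordinate_cube continuous_on_add continuous_on_const
          continuous_on_linear_combination)
  moreover have "?g ` ?C = {z. \<forall>b\<in>B. \<bar>coord b (z - z0)\<bar> \<le> r}" if "r \<ge> 0"
  proof safe
    fix c :: "'e \<Rightarrow> real" and b assume "\<forall>b. c b \<in> {-r..r}" "b \<in> B"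
    then show "\<bar>coord b (z0 + (\<Sum>b\<in>B. c b *\<^sub>R b) - z0)\<bar> \<le> r"
      by (simp add: coord_sum abs_le_iff minus_le_iff)
  next
    fix z assume "\<forall>b\<in>B. \<bar>coord b (z - z0)\<bar> \<le> r"
    then have "(\<lambda>b. coord b (z - z0)) \<in> ?C" using coord_eq_0[of _ "z - z0"] that
      by (smt (verit) abs_le_iff atLeastAtMost_iff mem_Collect_eq)
    moreover have "z = ?g (\<lambda>b. coord b (z - z0))" by (simp add: sum_coord)
    ultimately show "z \<in> ?g ` ?C" by blast
  qed
  moreover have "{z. \<forall>b\<in>B. \<bar>coord b (z - z0)\<bar> \<le> r} = (if B = {} then {z0} else {})" if "r < 0"
  proof -
    have "z = z0" if "B = {}" for z using sum_coord[of z] sum_coord[of z0] that by simp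
    then show ?thesis using that by force
  qed
  ultimately show ?thesis by (cases "r \<ge> 0") auto
qed

lemma norm_le_coords: "norm z \<le> (\<Sum>b\<in>B. \<bar>coord b z\<bar> * norm b)"
proof -
  have "norm z = norm (\<Sum>b\<in>B. coord b z *\<^sub>R b)" by (simp add: sum_coord)
  also have "\<dots> \<le> (\<Sum>b\<in>B. norm (coord b z *\<^sub>R b))" by (rule norm_sum)
  finally show ?thesis by simp
qed

lemma box_subset_open:
  assumes "open S" "z0 \<in> S"
  obtains r where "r > 0" "{z. \<forall>b\<in>B. \<bar>coord b (z - z0)\<bar> \<le> r} \<subseteq> S"
proof -
  obtain e where e: "e > 0" "ball z0 e \<subseteq> S" using assms open_contains_ball by blast
  define N where "N = (\<Sum>b\<in>B. norm b) + 1"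
  have N: "N > 0" unfolding N_def by (intro add_nonneg_pos sum_nonneg) auto
  define r where "r = e / (2 * N)"
  have r: "r > 0" using e N by (simp add: r_def)
  have "z \<in> S" if "\<forall>b\<in>B. \<bar>coord b (z - z0)\<bar> \<le> r" for z
  proof -
    have "norm (z - z0) \<le> (\<Sum>b\<in>B. r * norm b)"
      using norm_le_coords[of "z - z0"] that by (smt (verit, best) mult_right_mono norm_ge_zero sum_mono)
    also have "\<dots> = r * (N - 1)" by (simp add: sum_distrib_left N_def)
    also have "\<dots> < r * (2 * N)" using r N by (intro mult_strict_left_mono) auto
    also have "r * (2 * N) = e" using N by (simp add: r_def)
    finally show ?thesis using e by (auto simp: dist_norm norm_minus_commute)
  qed
  then show ?thesis using r that by blast
qed

lemma compact_unit_sphere: "compact {z::'e. norm z = 1}"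
proof -
  obtain K where K: "K > 0" "\<forall>z. \<forall>b\<in>B. \<bar>coord b z\<bar> \<le> K * norm z" using coord_bounded by blast
  have eq: "{z::'e. norm z = 1} = {z. \<forall>b\<in>B. \<bar>coord b (z - 0)\<bar> \<le> K} \<inter> {z. norm z = 1}"
  proof safe
    fix z b assume "norm (z::'e) = 1" "b \<in> B"
    then show "\<bar>coord b (z - 0)\<bar> \<le> K" using K(2) by (metis diff_zero mult.right_neutral)
  qed
  have "closed {z::'e. norm z = 1}" by (intro closed_Collect_eq continuous_intros)
  then show ?thesis by (subst eq) (rule compact_Int_closed[OF compact_box])
qed

text \<open>By homogeneity it suffices to consider the compact unit sphere, where the sum attains a
  positive minimum. This turns injectivity of the derivative of a delay map into a quantitative
  lower bound.\<close>

lemma family_bounded_below: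
  fixes D :: "'i \<Rightarrow> 'e \<Rightarrow> real"
  assumes I: "finite I" and lin: "\<And>i. i \<in> I \<Longrightarrow> linear (D i)"
    and inj: "\<And>u. (\<And>i. i \<in> I \<Longrightarrow> D i u = 0) \<Longrightarrow> u = 0"
  obtains c where "c > 0" "\<And>u. c * norm u \<le> (\<Sum>i\<in>I. \<bar>D i u\<bar>)"
proof -
  let ?N = "\<lambda>u. \<Sum>i\<in>I. \<bar>D i u\<bar>"
  have "\<exists>c>0. \<forall>u. norm u = 1 \<longrightarrow> c \<le> ?N u"
  proof (cases "{z::'e. norm z = 1} = {}")
    case False
    have "continuous_on {z::'e. norm z = 1} ?N"
      using bounded_linear_if_linear[OF lin] by (intro continuous_on_sum continuous_on_rabs linear_continuous_on)
    then obtain u0 where u0: "norm u0 = 1" "\<And>u. norm u = 1 \<Longrightarrow> ?N u0 \<le> ?N u"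
      using continuous_attains_inf[OF compact_unit_sphere False] by auto
    have "?N u0 \<noteq> 0"
    proof
      assume "?N u0 = 0"
      then have "D i u0 = 0" if "i \<in> I" for i using I that by (simp add: sum_nonneg_eq_0_iff)
      then have "u0 = 0" by (rule inj)
      then show False using u0(1) by simp
    qed
    then have "?N u0 > 0" by (simp add: less_le sum_nonneg)
    then show ?thesis using u0(2) by blast
  qed (auto intro: exI[of _ 1])
  then obtain c where c: "c > 0" "\<And>u. norm u = 1 \<Longrightarrow> c \<le> ?N u" by blast
  have "c * norm u \<le> ?N u" for u
  proof (cases "u = 0")
    case True
    then show ?thesis by (simp add: sum_nonneg)
  next
    case False
    then have "c \<le> ?N ((1 / norm u) *\<^sub>R u)" by (intro c(2)) simp
    also have "\<dots> = (\<Sum>i\<in>I. \<bar>D i u\<bar> / norm u)"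
      using lin by (intro sum.cong refl) (simp add: linear_scale abs_mult)
    also have "\<dots> = ?N u / norm u" by (simp add: sum_divide_distrib)
    finally show ?thesis using False by (simp add: field_simps)
  qed
  with c(1) that show ?thesis by blast
qed

text \<open>Eigenvectors to distinct eigenvalues are independent, so there are at most
  \<open>card B\<close> of them.\<close>

lemma finite_eigenvalues:
  assumes S: "linear (S :: 'e \<Rightarrow> 'e)"
  shows "finite {t::real. \<exists>u. u \<noteq> 0 \<and> S u = t *\<^sub>R u}"
proof (rule ccontr)
  let ?E = "{t::real. \<exists>u. u \<noteq> 0 \<and> S u = t *\<^sub>R u}"
  assume "infinite ?E"
  then obtain F where F: "finite F" "card F = Suc (card B)" "F \<subseteq> ?E"
    using infinite_arbitrarily_large by blast
  then have "\<forall>t\<in>F. \<exists>u. u \<noteq> 0 \<and> S u = t *\<^sub>R u" by auto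
  then obtain u where u: "\<And>t. t \<in> F \<Longrightarrow> u t \<noteq> 0" "\<And>t. t \<in> F \<Longrightarrow> S (u t) = t *\<^sub>R u t"
    using bchoice[of F "\<lambda>t u. u \<noteq> 0 \<and> S u = t *\<^sub>R u"] by blast
  have ind: "(\<forall>t\<in>G. c t = 0)" if "finite G" "G \<subseteq> F" "(\<Sum>t\<in>G. c t *\<^sub>R u t) = 0" for G c
    using that
  proof (induction G arbitrary: c rule: finite_induct)
    case (insert s G)
    have e1: "c s *\<^sub>R u s + (\<Sum>t\<in>G. c t *\<^sub>R u t) = 0" using insert by simp
    then have "S (c s *\<^sub>R u s + (\<Sum>t\<in>G. c t *\<^sub>R u t)) = 0" using S by (simp add: linear_0)
    then have e2: "(c s * s) *\<^sub>R u s + (\<Sum>t\<in>G. (c t * t) *\<^sub>R u t) = 0"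
      using insert.prems u(2) S by (simp add: linear_add linear_sum linear_scale subset_iff)
    \<comment> \<open>Subtracting \<open>s\<close> times a linear relation from its image under
      \<open>S\<close> eliminates the eigenvector of \<open>s\<close>.\<close>
    have "(\<Sum>t\<in>G. (c t * (t - s)) *\<^sub>R u t) = (\<Sum>t\<in>G. (c t * t) *\<^sub>R u t) - s *\<^sub>R (\<Sum>t\<in>G. c t *\<^sub>R u t)"
      by (simp add: algebra_simps sum_subtractf scaleR_right.sum)
    also have "\<dots> = 0"
    proof -
      have "(\<Sum>t\<in>G. c t *\<^sub>R u t) = - (c s *\<^sub>R u s)" "(\<Sum>t\<in>G. (c t * t) *\<^sub>R u t) = - ((c s * s) *\<^sub>R u s)"
        using e1 e2 by (simp_all add: eq_neg_iff_add_eq_0 add.commute)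
      then show ?thesis by simp
    qed
    finally have "\<forall>t\<in>G. c t * (t - s) = 0" using insert.IH[of "\<lambda>t. c t * (t - s)"] insert.prems by simp
    then have G0: "\<forall>t\<in>G. c t = 0" using insert.hyps(2) by auto
    then have "c s *\<^sub>R u s = 0" using e1 by simp
    then show ?case using G0 u(1)[of s] insert.prems by auto
  qed simp
  have inj: "inj_on u F"
  proof (rule inj_onI)
    fix s t assume st: "s \<in> F" "t \<in> F" "u s = u t"
    then have "s *\<^sub>R u s = t *\<^sub>R u s" using u(2) by metis
    then show "s = t" using u(1)[OF st(1)] by simp
  qed
  have "independent (u ` F)"
  proof (rule ccontr)
    assume "\<not> independent (u ` F)"
    then obtain c v where cv: "v \<in> u ` F" "c v \<noteq> 0" "(\<Sum>v\<in>u ` F. c v *\<^sub>R v) = 0"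
      using F(1) real_vector.dependent_finite[of "u ` F"] by auto
    then have "(\<Sum>t\<in>F. c (u t) *\<^sub>R u t) = 0" by (simp add: sum.reindex[OF inj])
    with ind[OF F(1) order_refl, of "\<lambda>t. c (u t)"] cv show False by auto
  qed
  moreover have "u ` F \<subseteq> span B" using span_B by simp
  ultimately have "card (u ` F) \<le> card B"
    using real_vector.independent_span_bound[OF finite_B] by blast
  then show False using card_image[OF inj] F by simp
qed

end

section \<open>Calculus of maps of class \<open>C\<^sup>r\<close>\<close>

text \<open>Both derivatives are choices from the same set of candidates. The equality therefore
  also holds where the functions are not differentiable, and iterating it requires no
  regularity.\<close>

lemma frechet_derivative_cong:
  assumes "open S" "x \<in> S" "\<And>y. y \<in> S \<Longrightarrow> f y = g y"
  shows "frechet_derivative f (at x) = frechet_derivative g (at x)"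
proof -
  have "(f has_derivative D) (at x) \<longleftrightarrow> (g has_derivative D) (at x)" for D
    using has_derivative_transform_within_open[OF _ assms(1,2)] assms(3) by metis
  then show ?thesis by (simp add: frechet_derivative_def)
qed

lemma differentiable_cong:
  assumes "open S" "x \<in> S" "\<And>y. y \<in> S \<Longrightarrow> f y = g y"
  shows "f differentiable (at x) \<longleftrightarrow> g differentiable (at x)"
  unfolding differentiable_def
  using has_derivative_transform_within_open[OF _ assms(1,2)] assms(3) by metis

lemma dir_derivs_cong:
  assumes "open S" "x \<in> S" "\<And>y. y \<in> S \<Longrightarrow> f y = g y"
  shows "dir_derivs vs f x = dir_derivs vs g x"
  using assms(3)
proof (induction vs arbitrary: f g)
  case Nil
  then show ?case using assms(2) by simp
next
  case (Cons v vs)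
  have "frechet_derivative f (at y) v = frechet_derivative g (at y) v" if "y \<in> S" for y
    using frechet_derivative_cong[OF assms(1) that Cons.prems] by simp
  from Cons.IH[OF this] show ?case by simp
qed

text \<open>Reduces every closure property, including the smooth case, to finite orders, where
  induction is available.\<close>

lemma Cr_on_iff_finite: "Cr_on r S f \<longleftrightarrow> (\<forall>n. enat n \<le> r \<longrightarrow> Cr_on (enat n) S f)"
proof
  assume "Cr_on r S f"
  then show "\<forall>n. enat n \<le> r \<longrightarrow> Cr_on (enat n) S f"
    unfolding Cr_on_def by (meson dual_order.strict_trans1 order_trans less_le_trans)
next
  assume A: "\<forall>n. enat n \<le> r \<longrightarrow> Cr_on (enat n) S f"
  show "Cr_on r S f" unfolding Cr_on_def
  proof (intro conjI allI impI ballI)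
    fix vs :: "'a list" assume "enat (length vs) \<le> r"
    then show "continuous_on S (dir_derivs vs f)" using A unfolding Cr_on_def by auto
  next
    fix vs :: "'a list" and x assume "enat (length vs) < r" "x \<in> S"
    then have "enat (Suc (length vs)) \<le> r" by (simp add: Suc_ile_eq)
    then show "dir_derivs vs f differentiable at x"
      using A \<open>x \<in> S\<close> unfolding Cr_on_def by auto
  qed
qed

lemma Cr_on_mono: "Cr_on r S f \<Longrightarrow> r' \<le> r \<Longrightarrow> S' \<subseteq> S \<Longrightarrow> Cr_on r' S' f"
  unfolding Cr_on_def by (meson continuous_on_subset dual_order.trans less_le_trans subsetD)

lemma Cr_on_0: "Cr_on 0 S f \<longleftrightarrow> continuous_on S f"
  unfolding Cr_on_def by (simp add: zero_enat_def)

text \<open>The induction step of the closure properties. The innermost direction is split off, as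
  in the recursion of \<open>dir_derivs\<close>, so the induction hypothesis applies to the
  functions occurring in a sum, product or chain rule.\<close>

lemma Cr_on_Suc:
  "Cr_on (enat (Suc n)) S f \<longleftrightarrow> continuous_on S f \<and> (\<forall>x\<in>S. f differentiable at x) \<and>
     (\<forall>v. Cr_on (enat n) S (\<lambda>x. frechet_derivative f (at x) v))"
proof
  assume A: "Cr_on (enat (Suc n)) S f"
  have "continuous_on S (dir_derivs [] f)" "\<forall>x\<in>S. dir_derivs [] f differentiable at x"
    using A unfolding Cr_on_def by (metis enat_ord_simps(1) le0 list.size(3), metis enat_ord_simps(2) list.size(3) zero_less_Suc)
  moreover have "Cr_on (enat n) S (\<lambda>x. frechet_derivative f (at x) v)" for v
    unfolding Cr_on_def
  proof (intro conjI allI impI)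
    fix vs :: "'a list" assume "enat (length vs) \<le> enat n"
    then have "enat (length (v # vs)) \<le> enat (Suc n)" by simp
    then have "continuous_on S (dir_derivs (v # vs) f)" using A unfolding Cr_on_def by blast
    then show "continuous_on S (dir_derivs vs (\<lambda>x. frechet_derivative f (at x) v))" by simp
  next
    fix vs :: "'a list" assume "enat (length vs) < enat n"
    then have "enat (length (v # vs)) < enat (Suc n)" by simp
    then have "\<forall>x\<in>S. dir_derivs (v # vs) f differentiable at x" using A unfolding Cr_on_def by blast
    then show "\<forall>x\<in>S. dir_derivs vs (\<lambda>x. frechet_derivative f (at x) v) differentiable at x" by simp
  qed
  ultimately show "continuous_on S f \<and> (\<forall>x\<in>S. f differentiable at x) \<and>
     (\<forall>v. Cr_on (enat n) S (\<lambda>x. frechet_derivative f (at x) v))" by simp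
next
  assume A: "continuous_on S f \<and> (\<forall>x\<in>S. f differentiable at x) \<and>
     (\<forall>v. Cr_on (enat n) S (\<lambda>x. frechet_derivative f (at x) v))"
  show "Cr_on (enat (Suc n)) S f" unfolding Cr_on_def
  proof (intro conjI allI impI)
    fix vs :: "'a list" assume "enat (length vs) \<le> enat (Suc n)"
    with A show "continuous_on S (dir_derivs vs f)" unfolding Cr_on_def by (cases vs) auto
  next
    fix vs :: "'a list" assume "enat (length vs) < enat (Suc n)"
    with A show "\<forall>x\<in>S. dir_derivs vs f differentiable at x" unfolding Cr_on_def by (cases vs) auto
  qed
qed

lemma Cr_on_cong:
  assumes "open S" "\<And>x. x \<in> S \<Longrightarrow> f x = g x"
  shows "Cr_on r S f \<longleftrightarrow> Cr_on r S g"
proof -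
  have "\<And>vs x. x \<in> S \<Longrightarrow> dir_derivs vs f x = dir_derivs vs g x"
    by (rule dir_derivs_cong[OF assms(1)]) (use assms(2) in auto)
  then have "continuous_on S (dir_derivs vs f) \<longleftrightarrow> continuous_on S (dir_derivs vs g)"
    "(\<forall>x\<in>S. dir_derivs vs f differentiable at x) \<longleftrightarrow> (\<forall>x\<in>S. dir_derivs vs g differentiable at x)" for vs
    using differentiable_cong[OF assms(1), of _ "dir_derivs vs f" "dir_derivs vs g"]
    by (auto cong: continuous_on_cong)
  then show ?thesis unfolding Cr_on_def by simp
qed

lemma Cr_on_local:
  assumes "\<And>x. x \<in> S \<Longrightarrow> \<exists>S'. open S' \<and> x \<in> S' \<and> Cr_on r S' f"
  shows "Cr_on r S f"
proof -
  define C where "C = {S'. open S' \<and> Cr_on r S' f}"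
  have "Cr_on r (\<Union>C) f" unfolding Cr_on_def
  proof (intro conjI allI impI ballI)
    fix vs :: "'a list" assume "enat (length vs) \<le> r"
    then show "continuous_on (\<Union>C) (dir_derivs vs f)"
      by (intro continuous_on_open_Union) (auto simp: C_def Cr_on_def)
  next
    fix vs :: "'a list" and x assume "enat (length vs) < r" "x \<in> \<Union>C"
    then show "dir_derivs vs f differentiable at x" by (auto simp: C_def Cr_on_def)
  qed
  moreover have "S \<subseteq> \<Union>C" using assms by (auto simp: C_def)
  ultimately show ?thesis using Cr_on_mono by blast
qed

lemma Cr_on_const: "Cr_on r S (\<lambda>x. c)"
proof -
  have "Cr_on (enat n) S (\<lambda>x. c)" for n
  proof (induction n arbitrary: c)
    case 0 show ?case by (simp add: Cr_on_0 flip: zero_enat_def)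
  next
    case (Suc n)
    then show ?case by (simp add: Cr_on_Suc frechet_derivative_const)
  qed
  then show ?thesis by (subst Cr_on_iff_finite) simp
qed

lemma Cr_on_linear_compose:
  assumes "open S" "bounded_linear L" "Cr_on r S f"
  shows "Cr_on r S (\<lambda>x. L (f x))"
proof -
  have "Cr_on (enat n) S f \<Longrightarrow> Cr_on (enat n) S (\<lambda>x. L (f x))" for n
  proof (induction n arbitrary: f)
    case 0
    then show ?case using bounded_linear.continuous_on[OF assms(2)]
      by (simp add: Cr_on_0 flip: zero_enat_def)
  next
    case (Suc n)
    have D: "((\<lambda>x. L (f x)) has_derivative (\<lambda>v. L (frechet_derivative f (at x) v))) (at x)"
      if "x \<in> S" for x
      using Suc.prems that
      by (intro bounded_linear.has_derivative[OF assms(2)]) (simp add: Cr_on_Suc iffD1[OF frechet_derivative_works])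
    have "Cr_on (enat n) S (\<lambda>x. frechet_derivative (\<lambda>x. L (f x)) (at x) v)" for v
    proof -
      have "Cr_on (enat n) S (\<lambda>x. L (frechet_derivative f (at x) v))"
        using Suc by (simp add: Cr_on_Suc)
      then show ?thesis
        using frechet_derivative_at[OF D] by (subst Cr_on_cong[OF assms(1)]) (auto simp: fun_eq_iff)
    qed
    then show ?case using Suc.prems D bounded_linear.continuous_on[OF assms(2)]
      by (auto simp: Cr_on_Suc differentiable_def)
  qed
  then show ?thesis using assms(3) by (subst Cr_on_iff_finite, subst (asm) Cr_on_iff_finite) auto
qed

lemma Cr_on_add:
  assumes "open S" "Cr_on r S f" "Cr_on r S g"
  shows "Cr_on r S (\<lambda>x. f x + g x)"
proof -
  have "Cr_on (enat n) S f \<Longrightarrow> Cr_on (enat n) S g \<Longrightarrow> Cr_on (enat n) S (\<lambda>x. f x + g x)" for n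
  proof (induction n arbitrary: f g)
    case 0
    then show ?case by (simp add: Cr_on_0 continuous_on_add flip: zero_enat_def)
  next
    case (Suc n)
    have D: "((\<lambda>x. f x + g x) has_derivative
        (\<lambda>v. frechet_derivative f (at x) v + frechet_derivative g (at x) v)) (at x)"
      if "x \<in> S" for x
      using Suc.prems that
      by (intro has_derivative_add) (simp_all add: Cr_on_Suc iffD1[OF frechet_derivative_works])
    have "Cr_on (enat n) S (\<lambda>x. frechet_derivative (\<lambda>x. f x + g x) (at x) v)" for v
    proof -
      have "Cr_on (enat n) S (\<lambda>x. frechet_derivative f (at x) v + frechet_derivative g (at x) v)"
        using Suc by (simp add: Cr_on_Suc)
      then show ?thesis
        using frechet_derivative_at[OF D] by (subst Cr_on_cong[OF assms(1)]) (auto simp: fun_eq_iff)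
    qed
    then show ?case using Suc.prems D continuous_on_add
      by (auto simp: Cr_on_Suc differentiable_def)
  qed
  then show ?thesis using assms(2,3)
    by (subst Cr_on_iff_finite, subst (asm) (1 2) Cr_on_iff_finite) auto
qed

lemma Cr_on_mult:
  fixes f g :: "'e::real_normed_vector \<Rightarrow> real"
  assumes "open S" "Cr_on r S f" "Cr_on r S g"
  shows "Cr_on r S (\<lambda>x. f x * g x)"
proof -
  have "Cr_on (enat n) S f \<Longrightarrow> Cr_on (enat n) S g \<Longrightarrow> Cr_on (enat n) S (\<lambda>x. f x * g x)" for n
  proof (induction n arbitrary: f g)
    case 0
    then show ?case by (simp add: Cr_on_0 continuous_on_mult flip: zero_enat_def)
  next
    case (Suc n)
    have D: "((\<lambda>x. f x * g x) has_derivative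
        (\<lambda>v. f x * frechet_derivative g (at x) v + frechet_derivative f (at x) v * g x)) (at x)"
      if "x \<in> S" for x
      using Suc.prems that
      by (intro has_derivative_mult) (simp_all add: Cr_on_Suc iffD1[OF frechet_derivative_works])
    have fg: "Cr_on (enat n) S f" "Cr_on (enat n) S g"
      using Suc.prems by (auto elim!: Cr_on_mono)
    have "Cr_on (enat n) S (\<lambda>x. frechet_derivative (\<lambda>x. f x * g x) (at x) v)" for v
    proof -
      have "Cr_on (enat n) S (\<lambda>x. f x * frechet_derivative g (at x) v)"
        "Cr_on (enat n) S (\<lambda>x. frechet_derivative f (at x) v * g x)"
        using Suc fg by (simp_all add: Cr_on_Suc)
      from Cr_on_add[OF assms(1) this] show ?thesis
        using frechet_derivative_at[OF D] by (subst Cr_on_cong[OF assms(1)]) (auto simp: fun_eq_iff)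
    qed
    then show ?case using Suc.prems D continuous_on_mult
      by (auto simp: Cr_on_Suc differentiable_def)
  qed
  then show ?thesis using assms(2,3)
    by (subst Cr_on_iff_finite, subst (asm) (1 2) Cr_on_iff_finite) auto
qed

lemma Cr_on_cmult:
  fixes f :: "'e::real_normed_vector \<Rightarrow> real"
  shows "open S \<Longrightarrow> Cr_on r S f \<Longrightarrow> Cr_on r S (\<lambda>x. c * f x)"
  by (intro Cr_on_mult Cr_on_const)

lemma Cr_on_diff:
  fixes f :: "'e::real_normed_vector \<Rightarrow> real"
  assumes "open S" "Cr_on r S f" "Cr_on r S g"
  shows "Cr_on r S (\<lambda>x. f x - g x)"
  using Cr_on_add[OF assms(1,2) Cr_on_cmult[OF assms(1,3), of "-1"]] by simp

lemma Cr_on_sum: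
  assumes "open S" "\<And>i. i \<in> I \<Longrightarrow> Cr_on r S (f i)"
  shows "Cr_on r S (\<lambda>x. \<Sum>i\<in>I. f i x)"
  using assms(2)
  by (induction I rule: infinite_finite_induct) (auto intro!: Cr_on_const Cr_on_add assms(1))

lemma Cr_on_prod:
  fixes f :: "'i \<Rightarrow> 'e::real_normed_vector \<Rightarrow> real"
  assumes "open S" "\<And>i. i \<in> I \<Longrightarrow> Cr_on r S (f i)"
  shows "Cr_on r S (\<lambda>x. \<Prod>i\<in>I. f i x)"
  using assms(2)
  by (induction I rule: infinite_finite_induct) (auto intro!: Cr_on_const Cr_on_mult assms(1))

text \<open>\<open>D\<close> lists the successive derivatives of one function of a real variable.
  The claim is made for every \<open>D j\<close> because differentiating \<open>D j\<close> along
  \<open>f\<close> produces \<open>D (Suc j)\<close>.\<close>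

lemma Cr_on_smooth_compose:
  fixes f :: "'e::real_normed_vector \<Rightarrow> real"
  assumes "open S" "\<And>n t. (D n has_real_derivative D (Suc n) t) (at t)" "Cr_on r S f"
  shows "Cr_on r S (\<lambda>x. D j (f x))"
proof -
  have Dc: "continuous_on UNIV (D n)" for n
    using assms(2) by (intro continuous_at_imp_continuous_on) (auto intro: DERIV_isCont)
  have Dfc: "continuous_on S (\<lambda>x. D n (f x))" if "continuous_on S f" for n f
    using continuous_on_compose2[OF Dc that] by auto
  have "Cr_on (enat n) S f \<Longrightarrow> Cr_on (enat n) S (\<lambda>x. D j (f x))" for n
  proof (induction n arbitrary: j)
    case 0
    then show ?case using Dfc by (simp add: Cr_on_0 flip: zero_enat_def)
  next
    case (Suc n)
    have D: "((\<lambda>x. D j (f x)) has_derivative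
        (\<lambda>v. D (Suc j) (f x) * frechet_derivative f (at x) v)) (at x)" if "x \<in> S" for x
    proof -
      have "(f has_derivative frechet_derivative f (at x)) (at x)"
        using Suc.prems that by (simp add: Cr_on_Suc iffD1[OF frechet_derivative_works])
      from has_derivative_compose[OF this assms(2)[of j "f x", THEN has_field_derivative_imp_has_derivative]]
      show ?thesis by simp
    qed
    have fn: "Cr_on (enat n) S f" using Suc.prems by (auto elim!: Cr_on_mono)
    have "Cr_on (enat n) S (\<lambda>x. frechet_derivative (\<lambda>x. D j (f x)) (at x) v)" for v
    proof -
      have "Cr_on (enat n) S (\<lambda>x. D (Suc j) (f x) * frechet_derivative f (at x) v)"
        using Suc fn by (intro Cr_on_mult assms(1)) (simp_all add: Cr_on_Suc)
      then show ?thesis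
        using frechet_derivative_at[OF D] by (subst Cr_on_cong[OF assms(1)]) (auto simp: fun_eq_iff)
    qed
    then show ?case using Suc.prems D Dfc
      by (auto simp: Cr_on_Suc differentiable_def)
  qed
  then show ?thesis using assms(3) by (subst Cr_on_iff_finite, subst (asm) Cr_on_iff_finite) auto
qed

lemma Cr_on_differentiable:
  assumes "Cr_on r S f" "1 \<le> r" "x \<in> S"
  shows "f differentiable (at x)"
proof -
  have "Cr_on (enat (Suc 0)) S f" using Cr_on_mono[OF assms(1), of 1 S] assms(2) by (simp add: one_enat_def)
  then show ?thesis using assms(3) unfolding Cr_on_Suc by blast
qed

lemma Cr_on_continuous: "Cr_on r S f \<Longrightarrow> continuous_on S f"
  using Cr_on_mono[of r S f 0 S] by (simp add: Cr_on_0)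

lemma Cr_on_1: "Cr_on 1 S f \<longleftrightarrow> (\<forall>x\<in>S. f differentiable at x) \<and>
   (\<forall>v. continuous_on S (\<lambda>x. frechet_derivative f (at x) v))"
proof -
  have "(\<forall>x\<in>S. f differentiable at x) \<Longrightarrow> continuous_on S f"
    by (intro continuous_at_imp_continuous_on ballI differentiable_imp_continuous_within) auto
  then show ?thesis
    using Cr_on_Suc[of 0 S f] by (auto simp: Cr_on_0 one_enat_def simp flip: zero_enat_def)
qed

text \<open>Expanded in the basis, the chain rule writes the derivative as a finite sum of products
  of continuous functions. Order 1 is what is required: composites of observables with
  \<open>T\<close> are differentiated only once.\<close>

lemma (in finite_basis) Cr_on_1_compose:
  fixes f :: "'e \<Rightarrow> 'b::real_normed_vector" and h :: "'d::real_normed_vector \<Rightarrow> 'e"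
  assumes "Cr_on 1 S h" "Cr_on 1 S' f" "h ` S \<subseteq> S'"
  shows "Cr_on 1 S (\<lambda>x. f (h x))"
proof -
  have dh: "(h has_derivative frechet_derivative h (at x)) (at x)"
    and df: "(f has_derivative frechet_derivative f (at (h x))) (at (h x))" if "x \<in> S" for x
    using assms that by (auto simp: Cr_on_1 intro!: iffD1[OF frechet_derivative_works])
  have D: "((\<lambda>x. f (h x)) has_derivative (\<lambda>v. frechet_derivative f (at (h x)) (frechet_derivative h (at x) v))) (at x)"
    if "x \<in> S" for x
    using has_derivative_compose[OF dh[OF that] df[OF that]] .
  have hc: "continuous_on S h" using Cr_on_continuous[OF assms(1)] .
  have "continuous_on S (\<lambda>x. frechet_derivative (\<lambda>x. f (h x)) (at x) v)" for v
  proof -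
    have "continuous_on S (\<lambda>x. \<Sum>b\<in>B. coord b (frechet_derivative h (at x) v) *\<^sub>R frechet_derivative f (at (h x)) b)"
      using assms
      by (intro continuous_on_sum continuous_on_scaleR bounded_linear.continuous_on[OF bounded_linear_coord]
            continuous_on_compose2[of S' "\<lambda>y. frechet_derivative f (at y) _" S h] hc) (auto simp: Cr_on_1)
    moreover have "frechet_derivative (\<lambda>x. f (h x)) (at x) v =
      (\<Sum>b\<in>B. coord b (frechet_derivative h (at x) v) *\<^sub>R frechet_derivative f (at (h x)) b)" if "x \<in> S" for x
      unfolding frechet_derivative_at[OF D[OF that], symmetric]
      by (rule linear_expand[OF has_derivative_linear[OF df[OF that]]])
    ultimately show ?thesis by (subst continuous_on_cong[OF refl]) auto
  qed
  then show ?thesis using D unfolding Cr_on_1 differentiable_def by blast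
qed

text \<open>The function exp(-1/t), extended by 0 to \<open>t\<close> \<le> 0. Its derivatives on
  the positive axis are polynomials in 1/t times exp(-1/t), and they all tend to 0 faster than any
  power of \<open>t\<close>.\<close>

lemma smooth_bump_exists:
  obtains D :: "nat \<Rightarrow> real \<Rightarrow> real"
  where "\<And>n t. (D n has_real_derivative D (Suc n) t) (at t)"
    and "\<And>t. t \<le> 0 \<Longrightarrow> D 0 t = 0" and "\<And>t. t > 0 \<Longrightarrow> D 0 t > 0"
proof -
  \<comment> \<open>With s = 1/t, the derivative of p(s) exp(-s) with respect to \<open>t\<close> is
    s^2 (p(s) - p'(s)) exp(-s).\<close>
  define p :: "nat \<Rightarrow> real poly" where "p = rec_nat [:1:] (\<lambda>_ q. [:0, 0, 1:] * (q - pderiv q))"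
  have p0: "p 0 = [:1:]" and pS: "p (Suc n) = [:0, 0, 1:] * (p n - pderiv (p n))" for n
    by (simp_all add: p_def)
  define D :: "nat \<Rightarrow> real \<Rightarrow> real" where
    "D n t = (if t \<le> 0 then 0 else poly (p n) (1 / t) * exp (- (1 / t)))" for n t
  have lim: "((\<lambda>s. poly q s * exp (- s)) \<longlongrightarrow> 0) at_top" for q :: "real poly"
  proof -
    have "((\<lambda>s::real. \<Sum>i\<le>degree q. coeff q i * (s ^ i / exp s)) \<longlongrightarrow> (\<Sum>i\<le>degree q. coeff q i * 0)) at_top"
      by (intro tendsto_sum tendsto_mult tendsto_const tendsto_power_div_exp_0)
    moreover have "poly q s * exp (- s) = (\<Sum>i\<le>degree q. coeff q i * (s ^ i / exp s))" for s
      by (simp add: poly_altdef sum_distrib_right exp_minus divide_inverse mult.assoc)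
    ultimately show ?thesis by simp
  qed
  have "(D n has_real_derivative D (Suc n) t) (at t)" for n t
  proof -
    consider "t < 0" | "t = 0" | "t > 0" by linarith
    then show ?thesis
    proof cases
      case 1
      have "((\<lambda>t::real. 0::real) has_real_derivative 0) (at t)" by simp
      then have "(D n has_real_derivative 0) (at t)"
        by (rule has_field_derivative_transform_within_open[of _ _ _ "{..<0}"]) (use 1 in \<open>auto simp: D_def\<close>)
      then show ?thesis using 1 by (simp add: D_def)
    next
      case 3
      have "((\<lambda>t. poly (p n) (1 / t) * exp (- (1 / t))) has_real_derivative
          poly (p (Suc n)) (1 / t) * exp (- (1 / t))) (at t)"
      proof -
        have "((\<lambda>t. poly (p n) (1 / t)) has_real_derivative (poly (pderiv (p n)) (1 / t) * (- 1 / t\<^sup>2))) (at t)"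
          using 3 by (intro DERIV_chain2[OF poly_DERIV]) (auto intro!: derivative_eq_intros simp: power2_eq_square)
        then show ?thesis using 3
          by (auto intro!: derivative_eq_intros simp: pS power2_eq_square field_simps)
      qed
      then have "(D n has_real_derivative poly (p (Suc n)) (1 / t) * exp (- (1 / t))) (at t)"
        by (rule has_field_derivative_transform_within_open[of _ _ _ "{0<..}"]) (use 3 in \<open>auto simp: D_def\<close>)
      then show ?thesis using 3 by (simp add: D_def)
    next
      case 2
      have "((\<lambda>h. D n h / h) \<longlongrightarrow> 0) (at 0)"
      proof (rule filterlim_split_at)
        have "eventually (\<lambda>h. D n h / h = 0) (at_left (0::real))"
          by (auto simp: eventually_at_filter D_def)
        then show "((\<lambda>h. D n h / h) \<longlongrightarrow> 0) (at_left 0)"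
          by (rule tendsto_eventually)
        \<comment> \<open>From the right, the difference quotient at 0 is s p(s) exp(-s) with s =
          1/h tending to infinity.\<close>
        have "((\<lambda>h. poly ([:0, 1:] * p n) (inverse h) * exp (- inverse h)) \<longlongrightarrow> 0) (at_right (0::real))"
          by (rule filterlim_compose[OF lim filterlim_inverse_at_top_right])
        then show "((\<lambda>h. D n h / h) \<longlongrightarrow> 0) (at_right 0)"
          by (rule Lim_transform_eventually)
            (auto simp: eventually_at_filter D_def field_simps intro!: always_eventually)
      qed
      then show ?thesis using 2 by (simp add: DERIV_def D_def)
    qed
  qed
  then show ?thesis by (rule that) (simp_all add: D_def p0)
qed

section \<open>Functions on compact manifolds\<close>

lemma Cr_functions_mono: "r' \<le> r \<Longrightarrow> Cr_functions r A \<subseteq> Cr_functions r' A"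
  unfolding Cr_functions_def by (auto intro: Cr_on_mono)

locale compact_Cr_manifold = finite_basis B for B :: "'e::real_normed_vector set" +
  fixes r :: enat and A :: "('m::t2_space, 'e) chart set"
  assumes r_ge_1: "1 \<le> r" and compact_M: "compact (UNIV :: 'm set)" and manifold: "Cr_manifold r A"
begin

lemma chart_homeomorphism: "(U, \<phi>) \<in> A \<Longrightarrow> homeomorphism U (\<phi> ` U) \<phi> (inv_into U \<phi>)"
  and open_chart: "(U, \<phi>) \<in> A \<Longrightarrow> open U"
  and open_chart_image: "(U, \<phi>) \<in> A \<Longrightarrow> open (\<phi> ` U)"
  using manifold unfolding Cr_manifold_def is_chart_def by auto

lemma continuous_on_chart: "(U, \<phi>) \<in> A \<Longrightarrow> continuous_on U \<phi>"
  and continuous_on_inv_chart: "(U, \<phi>) \<in> A \<Longrightarrow> continuous_on (\<phi> ` U) (inv_into U \<phi>)"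
  using chart_homeomorphism unfolding homeomorphism_def by blast+

lemma inv_chart: "(U, \<phi>) \<in> A \<Longrightarrow> x \<in> U \<Longrightarrow> inv_into U \<phi> (\<phi> x) = x"
  using chart_homeomorphism homeomorphism_apply1 by blast

lemma open_chart_image_Int:
  assumes "(U, \<phi>) \<in> A" "open W" shows "open (\<phi> ` (U \<inter> W))"
proof -
  have "openin (top_of_set (\<phi> ` U)) (\<phi> ` (U \<inter> W))"
    using homeomorphism_imp_open_map[OF chart_homeomorphism[OF assms(1)]] assms(2) by auto
  then show ?thesis using openin_open_eq[OF open_chart_image[OF assms(1)]] by blast
qed

lemma chart_exists: obtains U \<phi> where "(U, \<phi>) \<in> A" "x \<in> U"
proof -
  have "x \<in> (\<Union>(U, \<phi>)\<in>A. U)" using manifold unfolding Cr_manifold_def by auto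
  then show ?thesis using that by auto
qed

lemma Cr_on_transition:
  "(U, \<phi>) \<in> A \<Longrightarrow> (V, \<psi>) \<in> A \<Longrightarrow> Cr_on r (\<phi> ` (U \<inter> V)) (\<psi> \<circ> inv_into U \<phi>)"
  using manifold unfolding Cr_manifold_def by blast

lemma Cr_functions_iff:
  "f \<in> Cr_functions r' A \<longleftrightarrow> (\<forall>U \<phi>. (U, \<phi>) \<in> A \<longrightarrow> Cr_on r' (\<phi> ` U) (\<lambda>z. f (inv_into U \<phi> z)))"
  unfolding Cr_functions_def comp_def by auto

lemma Cr_functions_const: "(\<lambda>x. c) \<in> Cr_functions r' A"
  by (simp add: Cr_functions_iff Cr_on_const)

lemma Cr_functions_add:
  "f \<in> Cr_functions r' A \<Longrightarrow> g \<in> Cr_functions r' A \<Longrightarrow> (\<lambda>x. f x + g x) \<in> Cr_functions r' A"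
  by (simp add: Cr_functions_iff Cr_on_add open_chart_image)

lemma Cr_functions_diff:
  "f \<in> Cr_functions r' A \<Longrightarrow> g \<in> Cr_functions r' A \<Longrightarrow> (\<lambda>x. f x - g x) \<in> Cr_functions r' A"
  by (simp add: Cr_functions_iff Cr_on_diff open_chart_image)

lemma Cr_functions_mult:
  "f \<in> Cr_functions r' A \<Longrightarrow> g \<in> Cr_functions r' A \<Longrightarrow> (\<lambda>x. f x * g x) \<in> Cr_functions r' A"
  by (simp add: Cr_functions_iff Cr_on_mult open_chart_image)

lemma Cr_functions_cmult: "f \<in> Cr_functions r' A \<Longrightarrow> (\<lambda>x. c * f x) \<in> Cr_functions r' A"
  by (simp add: Cr_functions_iff Cr_on_cmult open_chart_image)

lemma Cr_functions_sum:
  "(\<And>i. i \<in> I \<Longrightarrow> f i \<in> Cr_functions r' A) \<Longrightarrow> (\<lambda>x. \<Sum>i\<in>I. f i x) \<in> Cr_functions r' A"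
  by (simp add: Cr_functions_iff Cr_on_sum open_chart_image)

lemma Cr_functions_prod:
  "(\<And>i. i \<in> I \<Longrightarrow> f i \<in> Cr_functions r' A) \<Longrightarrow> (\<lambda>x. \<Prod>i\<in>I. f i x) \<in> Cr_functions r' A"
  by (simp add: Cr_functions_iff Cr_on_prod open_chart_image)

lemma Cr_functions_1: "f \<in> Cr_functions r A \<Longrightarrow> f \<in> Cr_functions 1 A"
  using Cr_functions_mono[OF r_ge_1] by blast

lemma Cr_functions_continuous:
  assumes "f \<in> Cr_functions r' A" shows "continuous_on UNIV f"
proof -
  have "continuous_on U f" if "(U, \<phi>) \<in> A" for U \<phi>
  proof -
    have "continuous_on U (\<lambda>x. f (inv_into U \<phi> (\<phi> x)))"
      using assms that
      by (intro continuous_on_compose2[OF Cr_on_continuous[of r' "\<phi> ` U" "\<lambda>z. f (inv_into U \<phi> z)"]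
            continuous_on_chart[OF that]]) (auto simp: Cr_functions_iff)
    then show ?thesis by (rule continuous_on_eq) (simp add: inv_chart[OF that])
  qed
  then have "continuous_on (\<Union>(fst ` A)) f"
    using open_chart by (intro continuous_on_open_Union) auto
  moreover have "x \<in> \<Union>(fst ` A)" for x
  proof -
    obtain U \<phi> where "(U, \<phi>) \<in> A" "x \<in> U" by (rule chart_exists)
    then show ?thesis by force
  qed
  then have "\<Union>(fst ` A) = UNIV" by blast
  ultimately show ?thesis by simp
qed

lemma Cr_functions_differentiable:
  assumes "f \<in> Cr_functions 1 A" "(U, \<phi>) \<in> A" "x \<in> U"
  shows "(f \<circ> inv_into U \<phi>) differentiable (at (\<phi> x))"
proof (rule Cr_on_differentiable[of 1 "\<phi> ` U"])
  show "Cr_on 1 (\<phi> ` U) (f \<circ> inv_into U \<phi>)" using assms by (simp add: Cr_functions_iff comp_def)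
qed (use assms in auto)

lemma Cr_functions_bounded:
  assumes "f \<in> Cr_functions r' A" obtains K where "\<And>x. \<bar>f x\<bar> \<le> K"
proof -
  have "bounded (range f)"
    using compact_continuous_image[OF Cr_functions_continuous[OF assms] compact_M] compact_imp_bounded by blast
  then show ?thesis using that by (auto simp: bounded_iff)
qed

text \<open>Extension by zero: \<open>U\<close> and the complement of \<open>K\<close>, which is
  open because compact sets are closed in a Hausdorff space, cover M, and \<open>f\<close> is of
  class C^r on either of them.\<close>

lemma Cr_functions_if_compact_support:
  assumes "compact K" "K \<subseteq> U" "open U" "\<And>x. x \<notin> K \<Longrightarrow> f x = 0"
    and "\<And>V \<theta>. (V, \<theta>) \<in> A \<Longrightarrow> Cr_on r' (\<theta> ` (V \<inter> U)) (\<lambda>z. f (inv_into V \<theta> z))"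
  shows "f \<in> Cr_functions r' A"
  unfolding Cr_functions_iff
proof (intro allI impI)
  fix V \<theta> assume V: "(V, \<theta>) \<in> A"
  have oK: "open (- K)" using assms(1) compact_imp_closed by blast
  have "Cr_on r' (\<theta> ` (V \<inter> - K)) (\<lambda>z. f (inv_into V \<theta> z))"
  proof (subst Cr_on_cong[OF open_chart_image_Int[OF V oK]])
    show "Cr_on r' (\<theta> ` (V \<inter> - K)) (\<lambda>z. 0)" by (rule Cr_on_const)
  qed (use assms(4) inv_chart[OF V] in auto)
  moreover have "z \<in> \<theta> ` (V \<inter> U) \<or> z \<in> \<theta> ` (V \<inter> - K)" if "z \<in> \<theta> ` V" for z
    using that assms(2) by blast
  ultimately show "Cr_on r' (\<theta> ` V) (\<lambda>z. f (inv_into V \<theta> z))"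
    using open_chart_image_Int[OF V oK] open_chart_image_Int[OF V assms(3)] assms(5)[OF V]
    by (intro Cr_on_local) blast
qed

subsection \<open>Derivatives in charts\<close>

text \<open>The chain rule through the transition map, which is differentiable because
  \<open>r\<close> is at least 1.\<close>

lemma chart_change:
  assumes "(U, \<phi>) \<in> A" "(V, \<psi>) \<in> A" "x \<in> U" "x \<in> V"
    and "((f \<circ> inv_into U \<phi>) has_derivative D) (at (\<phi> x))"
  shows "((f \<circ> inv_into V \<psi>) has_derivative
           (\<lambda>v. D (frechet_derivative (\<phi> \<circ> inv_into V \<psi>) (at (\<psi> x)) v))) (at (\<psi> x))"
proof -
  let ?S = "\<psi> ` (V \<inter> U)"
  have S: "open ?S" using open_chart_image_Int[OF assms(2) open_chart[OF assms(1)]] .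
  have "(\<phi> \<circ> inv_into V \<psi>) differentiable (at (\<psi> x))"
    using Cr_on_differentiable[OF Cr_on_transition[OF assms(2,1)] r_ge_1] assms(3,4) by auto
  then have D: "((\<phi> \<circ> inv_into V \<psi>) has_derivative frechet_derivative (\<phi> \<circ> inv_into V \<psi>) (at (\<psi> x))) (at (\<psi> x))"
    by (rule iffD1[OF frechet_derivative_works])
  have "(\<phi> \<circ> inv_into V \<psi>) (\<psi> x) = \<phi> x" using inv_chart[OF assms(2,4)] by simp
  with has_derivative_compose[OF D, of "f \<circ> inv_into U \<phi>" D] assms(5)
  have "((\<lambda>z. (f \<circ> inv_into U \<phi>) ((\<phi> \<circ> inv_into V \<psi>) z)) has_derivative
     (\<lambda>v. D (frechet_derivative (\<phi> \<circ> inv_into V \<psi>) (at (\<psi> x)) v))) (at (\<psi> x))" by simp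
  then show ?thesis
    by (rule has_derivative_transform_within_open[OF _ S])
      (use assms(3,4) inv_chart[OF assms(1)] inv_chart[OF assms(2)] in auto)
qed

text \<open>Vanishing of the differential. Two functions have the same differential at a point iff
  their difference satisfies this, so tangent spaces need not be introduced. One chart suffices by
  \<open>zero_deriv_if_chart\<close>.\<close>

definition zero_deriv :: "('m \<Rightarrow> real) \<Rightarrow> 'm \<Rightarrow> bool" where
  "zero_deriv f x \<longleftrightarrow> (\<forall>U \<phi>. (U, \<phi>) \<in> A \<longrightarrow> x \<in> U \<longrightarrow>
     ((f \<circ> inv_into U \<phi>) has_derivative (\<lambda>_. 0)) (at (\<phi> x)))"

lemma zero_deriv_if_chart:
  assumes "(U, \<phi>) \<in> A" "x \<in> U" "((f \<circ> inv_into U \<phi>) has_derivative (\<lambda>_. 0)) (at (\<phi> x))"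
  shows "zero_deriv f x"
  unfolding zero_deriv_def using chart_change[OF assms(1) _ assms(2) _ assms(3)] by blast

lemma zero_deriv_compose:
  assumes T: "Cr_map r A T" and z: "zero_deriv f (T x)"
  shows "zero_deriv (\<lambda>x. f (T x)) x"
  unfolding zero_deriv_def
proof (intro allI impI)
  fix U \<phi> assume U: "(U, \<phi>) \<in> A" "x \<in> U"
  obtain V \<psi> where V: "(V, \<psi>) \<in> A" "T x \<in> V" by (rule chart_exists)
  let ?S = "\<phi> ` (U \<inter> T -` V)"
  have "open (T -` V)"
    using T open_chart[OF V(1)] unfolding Cr_map_def by (simp add: continuous_on_open_vimage)
  then have S: "open ?S" by (rule open_chart_image_Int[OF U(1)])
  have "Cr_on r ?S (\<psi> \<circ> T \<circ> inv_into U \<phi>)" using T U(1) V(1) unfolding Cr_map_def by blast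
  then have "(\<psi> \<circ> T \<circ> inv_into U \<phi>) differentiable (at (\<phi> x))"
    by (rule Cr_on_differentiable[OF _ r_ge_1]) (use U V in auto)
  then have D: "((\<psi> \<circ> T \<circ> inv_into U \<phi>) has_derivative
     frechet_derivative (\<psi> \<circ> T \<circ> inv_into U \<phi>) (at (\<phi> x))) (at (\<phi> x))"
    by (rule iffD1[OF frechet_derivative_works])
  have "((f \<circ> inv_into V \<psi>) has_derivative (\<lambda>_. 0)) (at ((\<psi> \<circ> T \<circ> inv_into U \<phi>) (\<phi> x)))"
    using z V inv_chart[OF U] unfolding zero_deriv_def by auto
  from has_derivative_compose[OF D this]
  show "((\<lambda>x. f (T x)) \<circ> inv_into U \<phi> has_derivative (\<lambda>_. 0)) (at (\<phi> x))"
    by (rule has_derivative_transform_within_open[OF _ S])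
      (use U(2) V(2) inv_chart[OF U(1)] inv_chart[OF V(1)] in auto)
qed

lemma zero_deriv_mult:
  assumes "f \<in> Cr_functions 1 A" "g \<in> Cr_functions 1 A" "f x = 0" "g x = 0"
  shows "zero_deriv (\<lambda>x. f x * g x) x"
  unfolding zero_deriv_def
proof (intro allI impI)
  fix U \<phi> assume U: "(U, \<phi>) \<in> A" "x \<in> U"
  show "((\<lambda>x. f x * g x) \<circ> inv_into U \<phi> has_derivative (\<lambda>_. 0)) (at (\<phi> x))"
    using has_derivative_mult[OF iffD1[OF frechet_derivative_works, OF Cr_functions_differentiable[OF assms(1) U]]
        iffD1[OF frechet_derivative_works, OF Cr_functions_differentiable[OF assms(2) U]]]
      inv_chart[OF U] assms(3,4) by (simp add: comp_def)
qed

lemma zero_deriv_add: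
  "zero_deriv f x \<Longrightarrow> zero_deriv g x \<Longrightarrow> zero_deriv (\<lambda>x. f x + g x) x"
  unfolding zero_deriv_def comp_def
proof (intro allI impI)
  fix U \<phi> assume U: "(U, \<phi>) \<in> A" "x \<in> U"
    and f: "\<forall>U \<phi>. (U, \<phi>) \<in> A \<longrightarrow> x \<in> U \<longrightarrow> ((\<lambda>x. f (inv_into U \<phi> x)) has_derivative (\<lambda>_. 0)) (at (\<phi> x))"
    and g: "\<forall>U \<phi>. (U, \<phi>) \<in> A \<longrightarrow> x \<in> U \<longrightarrow> ((\<lambda>x. g (inv_into U \<phi> x)) has_derivative (\<lambda>_. 0)) (at (\<phi> x))"
  from has_derivative_add[OF f[rule_format, OF U] g[rule_format, OF U]]
  show "((\<lambda>x. f (inv_into U \<phi> x) + g (inv_into U \<phi> x)) has_derivative (\<lambda>_. 0)) (at (\<phi> x))" by simp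
qed

lemma Cr_functions_1_compose:
  assumes T: "Cr_map r A T" and f: "f \<in> Cr_functions 1 A"
  shows "(\<lambda>x. f (T x)) \<in> Cr_functions 1 A"
  unfolding Cr_functions_iff
proof (intro allI impI)
  fix U \<phi> assume U: "(U, \<phi>) \<in> A"
  show "Cr_on 1 (\<phi> ` U) (\<lambda>z. f (T (inv_into U \<phi> z)))"
  proof (rule Cr_on_local)
    fix z assume "z \<in> \<phi> ` U"
    then obtain x where x: "x \<in> U" "z = \<phi> x" by blast
    obtain V \<psi> where V: "(V, \<psi>) \<in> A" "T x \<in> V" by (rule chart_exists)
    let ?S = "\<phi> ` (U \<inter> T -` V)"
    have "open (T -` V)"
      using T open_chart[OF V(1)] unfolding Cr_map_def by (simp add: continuous_on_open_vimage)
    then have S: "open ?S" by (rule open_chart_image_Int[OF U(1)])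
    have "Cr_on r ?S (\<psi> \<circ> T \<circ> inv_into U \<phi>)" using T U(1) V(1) unfolding Cr_map_def by blast
    then have "Cr_on 1 ?S (\<psi> \<circ> T \<circ> inv_into U \<phi>)" using r_ge_1 by (auto intro: Cr_on_mono)
    moreover have "Cr_on 1 (\<psi> ` V) (\<lambda>z. f (inv_into V \<psi> z))" using f V by (simp add: Cr_functions_iff)
    moreover have "(\<psi> \<circ> T \<circ> inv_into U \<phi>) ` ?S \<subseteq> \<psi> ` V" using inv_chart[OF U] by auto
    ultimately have "Cr_on 1 ?S (\<lambda>z. f (inv_into V \<psi> ((\<psi> \<circ> T \<circ> inv_into U \<phi>) z)))"
      by (rule Cr_on_1_compose)
    then have "Cr_on 1 ?S (\<lambda>z. f (T (inv_into U \<phi> z)))"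
      by (subst (asm) Cr_on_cong[OF S]) (use inv_chart[OF U] inv_chart[OF V(1)] in auto)
    then show "\<exists>S'. open S' \<and> z \<in> S' \<and> Cr_on 1 S' (\<lambda>z. f (T (inv_into U \<phi> z)))"
      using S x V by blast
  qed
qed

subsection \<open>A finite family of coordinate functions\<close>

text \<open>A bump function living in a single chart around \<open>x0\<close>. Multiplied by it, the
  coordinates of that chart extend by zero to functions of class C^r on all of M.\<close>

lemma chart_bump:
  obtains U \<psi> w where "(U, \<psi>) \<in> A" "w \<in> Cr_functions r A" "w x0 > 0" "\<And>y. w y \<noteq> 0 \<Longrightarrow> y \<in> U"
    "\<And>b. (\<lambda>y. if y \<in> U then w y * coord b (\<psi> y) else 0) \<in> Cr_functions r A"
proof -
  obtain D :: "nat \<Rightarrow> real \<Rightarrow> real" where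
    D: "\<And>n t. (D n has_real_derivative D (Suc n) t) (at t)"
      "\<And>t. t \<le> 0 \<Longrightarrow> D 0 t = 0" "\<And>t. t > 0 \<Longrightarrow> D 0 t > 0" using smooth_bump_exists by blast
  obtain U \<psi> where U: "(U, \<psi>) \<in> A" "x0 \<in> U" by (rule chart_exists)
  define z0 where "z0 = \<psi> x0"
  obtain \<rho> where \<rho>: "\<rho> > 0" "{z. \<forall>b\<in>B. \<bar>coord b (z - z0)\<bar> \<le> \<rho>} \<subseteq> \<psi> ` U"
    using box_subset_open[OF open_chart_image[OF U(1)], of z0] U(2) z0_def by blast
  \<comment> \<open>Positive in the interior of the box and zero outside of it; the squares replace
    absolute values, which would destroy smoothness.\<close>
  define g where "g z = (\<Prod>b\<in>B. D 0 (\<rho>\<^sup>2 - (coord b (z - z0))\<^sup>2))" for z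
  define K where "K = inv_into U \<psi> ` {z. \<forall>b\<in>B. \<bar>coord b (z - z0)\<bar> \<le> \<rho>}"
  have K: "compact K" unfolding K_def
    using continuous_on_subset[OF continuous_on_inv_chart[OF U(1)] \<rho>(2)] compact_box compact_continuous_image by blast
  have KU: "K \<subseteq> U" unfolding K_def using \<rho>(2) inv_chart[OF U(1)] by fastforce
  have supp: "y \<in> K" if "y \<in> U" "g (\<psi> y) \<noteq> 0" for y
  proof -
    have "\<bar>coord b (\<psi> y - z0)\<bar> \<le> \<rho>" if "b \<in> B" for b
    proof (rule ccontr)
      assume "\<not> \<bar>coord b (\<psi> y - z0)\<bar> \<le> \<rho>"
      then have "\<rho>\<^sup>2 - (coord b (\<psi> y - z0))\<^sup>2 \<le> 0"
        using \<rho>(1) by (simp add: abs_le_square_iff[symmetric])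
      then have "D 0 (\<rho>\<^sup>2 - (coord b (\<psi> y - z0))\<^sup>2) = 0" by (rule D(2))
      then have "g (\<psi> y) = 0" unfolding g_def using \<open>b \<in> B\<close> finite_B by (auto intro!: prod_zero)
      with \<open>g (\<psi> y) \<noteq> 0\<close> show False by simp
    qed
    then show ?thesis unfolding K_def
      by (intro image_eqI[of _ _ "\<psi> y"]) (simp_all add: inv_chart[OF U(1) \<open>y \<in> U\<close>])
  qed
  have coord_Cr: "Cr_on r S (\<lambda>z. coord b (\<tau> z))" if "open S" "Cr_on r S \<tau>" for S b and \<tau> :: "'e \<Rightarrow> 'e"
    using Cr_on_linear_compose[OF that(1) bounded_linear_coord that(2)] .
  have g_Cr: "Cr_on r S (\<lambda>z. g (\<tau> z))" if "open S" "Cr_on r S \<tau>" for S and \<tau> :: "'e \<Rightarrow> 'e"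
  proof -
    have "Cr_on r S (\<lambda>z. coord b (\<tau> z) - coord b z0)" for b
      using that by (intro Cr_on_diff coord_Cr Cr_on_const)
    then have "Cr_on r S (\<lambda>z. coord b (\<tau> z - z0))" for b
      by (simp add: linear_diff[OF linear_coord])
    then have "Cr_on r S (\<lambda>z. \<rho>\<^sup>2 - (coord b (\<tau> z - z0))\<^sup>2)" for b
      unfolding power2_eq_square using that(1) by (intro Cr_on_diff Cr_on_mult Cr_on_const)
    then have "Cr_on r S (\<lambda>z. D 0 (\<rho>\<^sup>2 - (coord b (\<tau> z - z0))\<^sup>2))" for b
      by (rule Cr_on_smooth_compose[where D=D, OF that(1) D(1)])
    then show ?thesis unfolding g_def using that(1) by (intro Cr_on_prod)
  qed
  \<comment> \<open>Another chart sees \<open>h\<close> through a transition map, hence the demand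
    that \<open>h\<close> be of class C^r after every substitution of class C^r.\<close>
  have ext: "(\<lambda>y. if y \<in> U then h (\<psi> y) else 0) \<in> Cr_functions r A"
    if "\<And>S (\<tau> :: 'e \<Rightarrow> 'e). open S \<Longrightarrow> Cr_on r S \<tau> \<Longrightarrow> Cr_on r S (\<lambda>z. h (\<tau> z))" "\<And>y. g y = 0 \<Longrightarrow> h y = 0" for h
  proof (rule Cr_functions_if_compact_support[OF K KU open_chart[OF U(1)]])
    fix V \<theta> assume V: "(V, \<theta>) \<in> A"
    have S: "open (\<theta> ` (V \<inter> U))" using open_chart_image_Int[OF V open_chart[OF U(1)]] .
    have "Cr_on r (\<theta> ` (V \<inter> U)) (\<lambda>z. h ((\<psi> \<circ> inv_into V \<theta>) z))"
      using that(1)[OF S Cr_on_transition[OF V U(1)]] .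
    then show "Cr_on r (\<theta> ` (V \<inter> U)) (\<lambda>z. if inv_into V \<theta> z \<in> U then h (\<psi> (inv_into V \<theta> z)) else 0)"
      by (subst Cr_on_cong[OF S]) (use inv_chart[OF V] in auto)
  next
    fix x assume "x \<notin> K"
    then show "(if x \<in> U then h (\<psi> x) else 0) = 0" using supp[of x] that(2)[of "\<psi> x"] by auto
  qed
  define w where "w y = (if y \<in> U then g (\<psi> y) else 0)" for y
  have "w \<in> Cr_functions r A" unfolding w_def[abs_def] by (rule ext[OF g_Cr]) auto
  moreover have "(\<lambda>y. if y \<in> U then w y * coord b (\<psi> y) else 0) \<in> Cr_functions r A" for b
  proof -
    have "(\<lambda>y. if y \<in> U then g (\<psi> y) * coord b (\<psi> y) else 0) \<in> Cr_functions r A"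
      by (rule ext[of "\<lambda>z. g z * coord b z"]) (auto intro!: Cr_on_mult g_Cr coord_Cr)
    moreover have "(\<lambda>y. if y \<in> U then w y * coord b (\<psi> y) else 0) =
      (\<lambda>y. if y \<in> U then g (\<psi> y) * coord b (\<psi> y) else 0)" by (auto simp: w_def)
    ultimately show ?thesis by simp
  qed
  moreover have "w x0 > 0"
  proof -
    have "coord b (\<psi> x0 - z0) = 0" for b unfolding z0_def by (simp add: linear_0[OF linear_coord])
    then have "g (\<psi> x0) > 0" unfolding g_def using \<rho>(1) by (intro prod_pos D(3)) simp
    then show ?thesis using U(2) by (simp add: w_def)
  qed
  moreover have "y \<in> U" if "w y \<noteq> 0" for y using that by (metis w_def)
  ultimately show ?thesis using that[OF U(1)] by blast
qed

text \<open>By compactness finitely many bumps from \<open>chart_bump\<close> have no common zero;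
  \<open>Q\<close> consists of these, their products with the coordinates, and 1. If all of
  \<open>Q\<close> agrees at \<open>x\<close> and \<open>y\<close>, a bump that is nonzero at
  \<open>x\<close> is nonzero at \<open>y\<close> too, so both points lie in its chart, and dividing
  the products by the bump shows that their coordinates agree.\<close>

lemma coordinate_functions:
  "\<exists>Q. finite Q \<and> Q \<subseteq> Cr_functions r A \<and> (\<lambda>_. 1) \<in> Q \<and>
    (\<forall>x y. x \<noteq> y \<longrightarrow> (\<exists>q\<in>Q. q x \<noteq> q y)) \<and>
    (\<forall>x. \<exists>V \<psi>. (V, \<psi>) \<in> A \<and> x \<in> V \<and> (\<forall>b\<in>B. \<exists>c.
      (((\<lambda>y. \<Sum>q\<in>Q. c q * q y) \<circ> inv_into V \<psi>) has_derivative coord b) (at (\<psi> x))))"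
proof -
  define good where "good = (\<lambda>x0 (U, \<psi>, w). (U, \<psi>) \<in> A \<and> w \<in> Cr_functions r A \<and> w x0 > 0 \<and>
     (\<forall>y. w y \<noteq> 0 \<longrightarrow> y \<in> U) \<and> (\<forall>b. (\<lambda>y. if y \<in> U then w y * coord b (\<psi> y) else 0) \<in> Cr_functions r A))"
  have "\<exists>p. good x0 p" for x0
  proof -
    obtain U \<psi> w where "(U, \<psi>) \<in> A" "w \<in> Cr_functions r A" "w x0 > 0" "\<And>y. w y \<noteq> 0 \<Longrightarrow> y \<in> U"
      "\<And>b. (\<lambda>y. if y \<in> U then w y * coord b (\<psi> y) else 0) \<in> Cr_functions r A"
      using chart_bump[of x0] by blast
    then have "good x0 (U, \<psi>, w)" unfolding good_def by simp
    then show ?thesis ..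
  qed
  then obtain P where P: "\<And>x0. good x0 (P x0)" by metis
  define U \<psi> w where "U x0 = fst (P x0)" and "\<psi> x0 = fst (snd (P x0))" and "w x0 = snd (snd (P x0))" for x0
  have P1: "(U a, \<psi> a) \<in> A" and P2: "w a \<in> Cr_functions r A" and P3: "w a a > 0"
    and P4: "\<And>y. w a y \<noteq> 0 \<Longrightarrow> y \<in> U a"
    and P5: "\<And>b. (\<lambda>y. if y \<in> U a then w a y * coord b (\<psi> a y) else 0) \<in> Cr_functions r A" for a
  proof -
    have "good a (U a, \<psi> a, w a)" using P[of a] by (simp add: U_def \<psi>_def w_def)
    then show "(U a, \<psi> a) \<in> A" "w a \<in> Cr_functions r A" "w a a > 0" "\<And>y. w a y \<noteq> 0 \<Longrightarrow> y \<in> U a"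
      "\<And>b. (\<lambda>y. if y \<in> U a then w a y * coord b (\<psi> a y) else 0) \<in> Cr_functions r A"
      unfolding good_def by simp_all
  qed
  define f where "f a b y = (if y \<in> U a then w a y * coord b (\<psi> a y) else 0)" for a b y
  have op: "open {y. w a y \<noteq> 0}" for a
    using Cr_functions_continuous[OF P2] by (intro open_Collect_neq continuous_on_const)
  have cov: "UNIV \<subseteq> (\<Union>a\<in>UNIV. {y. w a y \<noteq> 0})"
  proof
    fix y show "y \<in> (\<Union>a\<in>UNIV. {y. w a y \<noteq> 0})" using P3[of y] by (intro UN_I[of y]) auto
  qed
  obtain J where J: "finite J" "UNIV \<subseteq> (\<Union>a\<in>J. {y. w a y \<noteq> 0})"
    using compactE_image[OF compact_M op cov] by metis
  define Q where "Q = insert (\<lambda>_. 1) (w ` J \<union> (\<lambda>(a, b). f a b) ` (J \<times> B))"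
  have fQ: "finite Q" unfolding Q_def using J(1) finite_B by simp
  have QC: "Q \<subseteq> Cr_functions r A"
    unfolding Q_def using P2 P5 Cr_functions_const by (auto simp: f_def[abs_def])
  \<comment> \<open>Adding the two indicators also covers the case that \<open>p\<close> and
    \<open>p'\<close> are the same element of \<open>Q\<close>.\<close>
  have lin: "\<exists>c. \<forall>y. (\<Sum>q\<in>Q. c q * q y) = s * p y + t * p' y" if "p \<in> Q" "p' \<in> Q" for p p' s t
  proof (intro exI[of _ "\<lambda>q. (if q = p then s else 0) + (if q = p' then t else 0)"] allI)
    fix y
    have "(\<Sum>q\<in>Q. ((if q = p then s else 0) + (if q = p' then t else 0)) * q y) =
      (\<Sum>q\<in>Q. (if q = p then s * p y else 0)) + (\<Sum>q\<in>Q. (if q = p' then t * p' y else 0))"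
      unfolding sum.distrib[symmetric] by (intro sum.cong) (auto simp: algebra_simps)
    then show "(\<Sum>q\<in>Q. ((if q = p then s else 0) + (if q = p' then t else 0)) * q y) = s * p y + t * p' y"
      using that fQ by simp
  qed
  have sep: "\<exists>q\<in>Q. q x \<noteq> q y" if "x \<noteq> y" for x y
  proof (rule ccontr)
    assume "\<not> (\<exists>q\<in>Q. q x \<noteq> q y)"
    then have eq: "q x = q y" if "q \<in> Q" for q using that by blast
    obtain a where a: "a \<in> J" "w a x \<noteq> 0" using J(2) by blast
    then have wy: "w a y = w a x" using eq[of "w a"] by (simp add: Q_def)
    have U: "x \<in> U a" "y \<in> U a" using P4 a wy by auto
    have "coord b (\<psi> a x) = coord b (\<psi> a y)" if "b \<in> B" for b
    proof -
      have "f a b \<in> Q" using a that by (force simp: Q_def)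
      then show ?thesis using eq[of "f a b"] U wy a(2) by (simp add: f_def)
    qed
    then have "\<psi> a x = \<psi> a y" by (metis (no_types, lifting) sum.cong sum_coord)
    then show False using inv_chart[OF P1] U that by metis
  qed
  have loc: "\<exists>V \<psi>. (V, \<psi>) \<in> A \<and> x \<in> V \<and> (\<forall>b\<in>B. \<exists>c.
      (((\<lambda>y. \<Sum>q\<in>Q. c q * q y) \<circ> inv_into V \<psi>) has_derivative coord b) (at (\<psi> x)))" for x
  proof -
    obtain a where a: "a \<in> J" "w a x \<noteq> 0" using J(2) by blast
    have x: "x \<in> U a" using P4 a by auto
    have "\<exists>c. (((\<lambda>y. \<Sum>q\<in>Q. c q * q y) \<circ> inv_into (U a) (\<psi> a)) has_derivative coord b) (at (\<psi> a x))" if b: "b \<in> B" for b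
    proof -
      let ?W = "w a \<circ> inv_into (U a) (\<psi> a)" and ?z = "\<psi> a x"
      have Qm: "f a b \<in> Q" "w a \<in> Q" using a b by (force simp: Q_def)+
      \<comment> \<open>The combination is w (coord b - coord b z) / w(x). Its second factor
        vanishes at \<open>x\<close>, so the derivative of the bump drops out and
        \<open>coord b\<close> remains.\<close>
      then obtain c where c: "\<And>y. (\<Sum>q\<in>Q. c q * q y) = (1 / w a x) * f a b y + (- coord b ?z / w a x) * w a y"
        using lin[OF Qm, of "1 / w a x" "- coord b ?z / w a x"] by blast
      have W: "(?W has_derivative frechet_derivative ?W (at ?z)) (at ?z)"
        using Cr_functions_differentiable[OF Cr_functions_1[OF P2] P1 x] by (rule iffD1[OF frechet_derivative_works])
      have "((\<lambda>z. coord b z - coord b ?z) has_derivative coord b) (at ?z)"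
        using has_derivative_diff[OF bounded_linear_imp_has_derivative[OF bounded_linear_coord] has_derivative_const]
        by simp
      from has_derivative_mult_right[OF has_derivative_mult[OF W this], of "1 / w a x"]
      have "((\<lambda>z. (1 / w a x) * (?W z * (coord b z - coord b ?z))) has_derivative coord b) (at ?z)"
        using a(2) inv_chart[OF P1 x] by simp
      then have "(((\<lambda>y. \<Sum>q\<in>Q. c q * q y) \<circ> inv_into (U a) (\<psi> a)) has_derivative coord b) (at ?z)"
      proof (rule has_derivative_transform_within_open[OF _ open_chart_image[OF P1[of a]]])
        show "?z \<in> \<psi> a ` U a" using x by blast
        fix z assume "z \<in> \<psi> a ` U a"
        then obtain y where y: "y \<in> U a" "z = \<psi> a y" by blast
        show "(1 / w a x) * (?W z * (coord b z - coord b ?z)) = ((\<lambda>y. \<Sum>q\<in>Q. c q * q y) \<circ> inv_into (U a) (\<psi> a)) z"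
          using y inv_chart[OF P1 y(1)] by (simp add: c f_def diff_divide_distrib right_diff_distrib)
      qed
      then show ?thesis by blast
    qed
    then show ?thesis using P1 x by blast
  qed
  have "(\<lambda>_. 1) \<in> Q" by (simp add: Q_def)
  then show ?thesis using fQ QC sep loc by (intro exI[of _ Q] conjI allI impI)
qed

end

section \<open>A finite-dimensional probe space\<close>

text \<open>Coefficients with index \<open>N\<close> or larger are ignored. One can therefore pass
  freely between points of the product space over \<open>{..<N}\<close> and total sequences.\<close>

definition lincomb :: "nat \<Rightarrow> (nat \<Rightarrow> 'm \<Rightarrow> real) \<Rightarrow> (nat \<Rightarrow> real) \<Rightarrow> 'm \<Rightarrow> real" where
  "lincomb N hs c x = (\<Sum>n<N. c n * hs n x)"

lemma lincomb_add: "lincomb N hs (\<lambda>n. c n + d n) x = lincomb N hs c x + lincomb N hs d x"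
  by (simp add: lincomb_def sum.distrib algebra_simps)

lemma lincomb_cmult: "lincomb N hs (\<lambda>n. s * c n) x = s * lincomb N hs c x"
  by (simp add: lincomb_def sum_distrib_left algebra_simps)

lemma lincomb_sum: "lincomb N hs (\<lambda>n. \<Sum>i\<in>I. c i n) x = (\<Sum>i\<in>I. lincomb N hs (c i) x)"
  unfolding lincomb_def sum_distrib_right by (rule sum.swap)

lemma lincomb_restrict: "lincomb N hs (\<lambda>n\<in>{..<N}. c n) = lincomb N hs c"
  by (auto simp: lincomb_def)

context compact_Cr_manifold
begin

lemma lincomb_Cr_functions:
  "(\<And>n. hs n \<in> Cr_functions r' A) \<Longrightarrow> lincomb N hs c \<in> Cr_functions r' A"
  unfolding lincomb_def[abs_def] by (intro Cr_functions_sum Cr_functions_cmult)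

text \<open>The probe functions are the products of a fixed number of coordinate functions.\<close>

lemma probe_functions:
  fixes L :: nat
  obtains N :: nat and hs :: "nat \<Rightarrow> 'm \<Rightarrow> real" where
    "\<And>n. hs n \<in> Cr_functions r A"
    "\<And>z Z. finite Z \<Longrightarrow> card Z \<le> L \<Longrightarrow> z \<notin> Z \<Longrightarrow>
       \<exists>c. lincomb N hs c z = 1 \<and> (\<forall>w\<in>Z. lincomb N hs c w = 0)"
    "\<And>z Z f. finite Z \<Longrightarrow> card Z \<le> L \<Longrightarrow> z \<notin> Z \<Longrightarrow> f \<in> Cr_functions 1 A \<Longrightarrow>
       \<exists>c. zero_deriv (\<lambda>x. lincomb N hs c x - f x) z \<and> (\<forall>w\<in>Z. zero_deriv (lincomb N hs c) w)"
proof -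
  obtain Q where Q: "finite Q" "Q \<subseteq> Cr_functions r A" "(\<lambda>_. 1) \<in> Q"
    and sep: "\<forall>x y. x \<noteq> y \<longrightarrow> (\<exists>q\<in>Q. q x \<noteq> q y)"
    and loc: "\<forall>x. \<exists>V \<psi>. (V, \<psi>) \<in> A \<and> x \<in> V \<and> (\<forall>b\<in>B. \<exists>c.
      (((\<lambda>y. \<Sum>q\<in>Q. c q * q y) \<circ> inv_into V \<psi>) has_derivative coord b) (at (\<psi> x)))"
    using coordinate_functions by (elim exE conjE) (rule that)
  define sp where "sp s \<longleftrightarrow> (\<exists>a. s = (\<lambda>y. \<Sum>q\<in>Q. a q * q y))" for s :: "'m \<Rightarrow> real"
  have sp_add: "sp (\<lambda>y. s y + t y)" if st: "sp s" "sp t" for s t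
  proof -
    obtain a b where "s = (\<lambda>y. \<Sum>q\<in>Q. a q * q y)" "t = (\<lambda>y. \<Sum>q\<in>Q. b q * q y)" using st unfolding sp_def by blast
    then have "(\<lambda>y. s y + t y) = (\<lambda>y. \<Sum>q\<in>Q. (a q + b q) * q y)" by (simp add: sum.distrib algebra_simps)
    then show ?thesis unfolding sp_def by (rule exI[of _ "\<lambda>q. a q + b q"])
  qed
  have sp_cmult: "sp (\<lambda>y. k * s y)" if st: "sp s" for s k
  proof -
    obtain a where "s = (\<lambda>y. \<Sum>q\<in>Q. a q * q y)" using st unfolding sp_def by blast
    then have "(\<lambda>y. k * s y) = (\<lambda>y. \<Sum>q\<in>Q. (k * a q) * q y)" by (simp add: sum_distrib_left mult.assoc)
    then show ?thesis unfolding sp_def by (rule exI[of _ "\<lambda>q. k * a q"])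
  qed
  have sp_Q: "sp q" if "q \<in> Q" for q
  proof -
    have "q = (\<lambda>y. \<Sum>q'\<in>Q. (if q' = q then 1 else 0) * q' y)"
      using that Q(1) by (simp add: if_distrib[of "\<lambda>x. x * _"] cong: if_cong)
    then show ?thesis unfolding sp_def by (rule exI[of _ "\<lambda>q'. if q' = q then 1 else 0"])
  qed
  have sp_const: "sp (\<lambda>y. k)" for k using sp_cmult[OF sp_Q[OF Q(3)], of k] by simp
  have sp_sum: "sp (\<lambda>y. \<Sum>i\<in>I. s i y)" if "finite I" "\<And>i. i \<in> I \<Longrightarrow> sp (s i)" for I :: "'e set" and s
    using that by (induction I rule: finite_induct) (auto intro: sp_add sp_const)
  have sp_Cr: "s \<in> Cr_functions r A" if "sp s" for s
    using that Q(2) unfolding sp_def by (auto intro!: Cr_functions_sum Cr_functions_cmult)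
  define Pr where "Pr D p \<longleftrightarrow> (\<exists>fs. length fs = D \<and> (\<forall>s\<in>set fs. sp s) \<and> p = (\<lambda>y. \<Prod>s\<leftarrow>fs. s y))"
    for D :: nat and p :: "'m \<Rightarrow> real"
  have Pr_mult: "Pr (D + E) (\<lambda>y. p y * q y)" if pq: "Pr D p" "Pr E q" for D E p q
  proof -
    obtain fs gs where "length fs = D" "\<forall>s\<in>set fs. sp s" "p = (\<lambda>y. \<Prod>s\<leftarrow>fs. s y)"
      "length gs = E" "\<forall>s\<in>set gs. sp s" "q = (\<lambda>y. \<Prod>s\<leftarrow>gs. s y)" using pq unfolding Pr_def by blast
    then show ?thesis unfolding Pr_def by (intro exI[of _ "fs @ gs"]) auto
  qed
  have Pr_sp: "Pr 1 s" if "sp s" for s unfolding Pr_def by (intro exI[of _ "[s]"]) (use that in auto)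
  \<comment> \<open>The constant function pads products with fewer factors to a common number of
    factors.\<close>
  have Pr_1: "Pr D (\<lambda>y. 1)" for D unfolding Pr_def
    by (intro exI[of _ "replicate D (\<lambda>y. 1)"]) (use sp_const in \<open>auto simp: map_replicate_const\<close>)
  have Pr_pad: "Pr E p" if "Pr D p" "D \<le> E" for D E p
    using Pr_mult[OF that(1) Pr_1[of "E - D"]] that(2) by simp
  have Pr_Cr: "p \<in> Cr_functions r A" if "Pr D p" for D p
  proof -
    have "(\<lambda>y. \<Prod>s\<leftarrow>fs. s y) \<in> Cr_functions r A" if "\<forall>s\<in>set fs. sp s" for fs
      using that by (induction fs) (simp_all add: Cr_functions_const Cr_functions_mult sp_Cr)
    then show ?thesis using that unfolding Pr_def by auto
  qed
  \<comment> \<open>The largest degree that occurs: two interpolating products with at most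
    \<open>L\<close> factors each, and one further factor prescribing the derivative.\<close>
  define D where "D = 2 * L + 1"
  define I where "I = ({..<D} \<rightarrow>\<^sub>E Q)"
  have fI: "finite I" unfolding I_def using Q(1) by (intro finite_PiE) auto
  define N where "N = card I"
  obtain e where e: "bij_betw e {..<N} I" using ex_bij_betw_nat_finite[OF fI] unfolding N_def lessThan_atLeast0 by blast
  \<comment> \<open>The value 1 beyond \<open>N\<close> is a filler that keeps every
    \<open>hs n\<close> of class C^r.\<close>
  define hs where "hs n y = (\<Prod>l<D. (if n < N then e n l y else 1))" for n y
  have hsC: "hs n \<in> Cr_functions r A" for n
  proof -
    have "(\<lambda>y. if n < N then e n l y else 1) \<in> Cr_functions r A" if "l < D" for l
    proof (cases "n < N")
      case True
      then have "e n \<in> I" using e bij_betwE by blast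
      then have "e n l \<in> Q" using that unfolding I_def by auto
      then show ?thesis using Q(2) True by auto
    qed (simp add: Cr_functions_const)
    then show ?thesis unfolding hs_def[abs_def] by (intro Cr_functions_prod) auto
  qed
  \<comment> \<open>Multiplying out a product of \<open>D\<close> combinations of \<open>Q\<close>
    leaves a combination of products of \<open>D\<close> elements of \<open>Q\<close>, which are
    indexed by \<open>I\<close>.\<close>
  have Pr_lincomb: "\<exists>c. lincomb N hs c = p" if Prp: "Pr D p" for p
  proof -
    obtain fs where fs: "length fs = D" "\<forall>s\<in>set fs. sp s" "p = (\<lambda>y. \<Prod>s\<leftarrow>fs. s y)"
      using Prp unfolding Pr_def by blast
    then have "\<forall>l\<in>{..<D}. \<exists>a. fs ! l = (\<lambda>y. \<Sum>q\<in>Q. a q * q y)" unfolding sp_def by auto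
    from bchoice[OF this] obtain a where a: "\<forall>l\<in>{..<D}. fs ! l = (\<lambda>y. \<Sum>q\<in>Q. a l q * q y)" by blast
    define c where "c n = (\<Prod>l<D. a l (e n l))" for n
    have "p y = lincomb N hs c y" for y
    proof -
      have "p y = (\<Prod>l<D. (fs ! l) y)"
        using fs(1) by (simp add: fs(3) prod.list_conv_set_nth lessThan_atLeast0)
      also have "\<dots> = (\<Prod>l<D. \<Sum>q\<in>Q. a l q * q y)" using a by (intro prod.cong) auto
      also have "\<dots> = (\<Sum>t\<in>I. \<Prod>l<D. a l (t l) * t l y)"
        unfolding I_def by (rule prod_sum_PiE) (use Q(1) in auto)
      also have "\<dots> = (\<Sum>n<N. \<Prod>l<D. a l (e n l) * e n l y)"
        by (rule sum.reindex_bij_betw[OF e, symmetric])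
      also have "\<dots> = lincomb N hs c y" by (simp add: lincomb_def c_def hs_def prod.distrib)
      finally show ?thesis .
    qed
    then show ?thesis by (intro exI[of _ c] ext) simp
  qed
  \<comment> \<open>Lagrange interpolation, with one factor for each point of \<open>Z\<close>,
    built from a function of \<open>Q\<close> separating that point from \<open>z\<close>.\<close>
  have van: "\<exists>q. Pr (card Z) q \<and> q z = 1 \<and> (\<forall>w\<in>Z. q w = 0)" if "finite Z" "z \<notin> Z" for z Z
    using that
  proof (induction Z rule: finite_induct)
    case empty
    then show ?case using Pr_1[of 0] by auto
  next
    case (insert w Z)
    then obtain q where q: "Pr (card Z) q" "q z = 1" "\<forall>w\<in>Z. q w = 0" by auto
    obtain f where f: "f \<in> Q" "f z \<noteq> f w" using sep insert by blast
    define s where "s y = (1 / (f z - f w)) * (f y + (- f w))" for y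
    have "sp s" unfolding s_def[abs_def] by (intro sp_cmult sp_add sp_const sp_Q f(1))
    from Pr_mult[OF q(1) Pr_sp[OF this]]
    have "Pr (card (insert w Z)) (\<lambda>y. q y * s y)" using insert by simp
    moreover have "q z * s z = 1" using f q by (simp add: s_def)
    moreover have "q w' * s w' = 0" if "w' \<in> insert w Z" for w' using that q(3) by (auto simp: s_def)
    ultimately show ?case by blast
  qed
  show ?thesis
  proof (rule that[OF hsC])
    fix z :: 'm and Z :: "'m set" assume Z: "finite Z" "card Z \<le> L" "z \<notin> Z"
    obtain q where q: "Pr (card Z) q" "q z = 1" "\<forall>w\<in>Z. q w = 0" using van[OF Z(1,3)] by blast
    have "Pr D q" by (rule Pr_pad[OF q(1)]) (use Z(2) D_def in simp)
    from Pr_lincomb[OF this] obtain c where "lincomb N hs c = q" by blast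
    with q show "\<exists>c. lincomb N hs c z = 1 \<and> (\<forall>w\<in>Z. lincomb N hs c w = 0)" by auto
  next
    fix z :: 'm and Z :: "'m set" and f :: "'m \<Rightarrow> real"
    assume Z: "finite Z" "card Z \<le> L" "z \<notin> Z" and f: "f \<in> Cr_functions 1 A"
    obtain q where q: "Pr (card Z) q" "q z = 1" "\<forall>w\<in>Z. q w = 0" using van[OF Z(1,3)] by blast
    obtain V \<psi> where V: "(V, \<psi>) \<in> A" "z \<in> V"
      "\<forall>b\<in>B. \<exists>c. (((\<lambda>y. \<Sum>q\<in>Q. c q * q y) \<circ> inv_into V \<psi>) has_derivative coord b) (at (\<psi> z))"
      using loc by blast
    from bchoice[OF V(3)] obtain c where
      c: "\<And>b. b \<in> B \<Longrightarrow> (((\<lambda>y. \<Sum>q\<in>Q. c b q * q y) \<circ> inv_into V \<psi>) has_derivative coord b) (at (\<psi> z))" by blast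
    let ?F = "f \<circ> inv_into V \<psi>"
    have F: "(?F has_derivative frechet_derivative ?F (at (\<psi> z))) (at (\<psi> z))"
      using Cr_functions_differentiable[OF f V(1,2)] by (rule iffD1[OF frechet_derivative_works])
    \<comment> \<open>Matches the derivative of \<open>f\<close> at \<open>z\<close> in terms of the
      coordinate functionals; the constant subtracted next makes \<open>p0\<close> vanish at
      \<open>z\<close>.\<close>
    define s where "s y = (\<Sum>b\<in>B. frechet_derivative ?F (at (\<psi> z)) b * (\<Sum>q\<in>Q. c b q * q y))" for y
    define p0 where "p0 y = s y + (- s z)" for y
    have "sp s" unfolding s_def[abs_def]
      by (intro sp_sum finite_B sp_cmult) (auto simp: sp_def)
    then have sp0: "sp p0" unfolding p0_def[abs_def] by (intro sp_add sp_const)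
    have "((\<lambda>y. s y - f y) \<circ> inv_into V \<psi> has_derivative
       (\<lambda>v. (\<Sum>b\<in>B. frechet_derivative ?F (at (\<psi> z)) b * coord b v) - frechet_derivative ?F (at (\<psi> z)) v)) (at (\<psi> z))"
      unfolding s_def comp_def
      by (intro has_derivative_diff has_derivative_sum has_derivative_mult_right)
        (use c F in \<open>auto simp: comp_def\<close>)
    moreover have "(\<Sum>b\<in>B. frechet_derivative ?F (at (\<psi> z)) b * coord b v) = frechet_derivative ?F (at (\<psi> z)) v" for v
      using linear_expand[OF has_derivative_linear[OF F], of v] by (simp add: mult.commute)
    ultimately have "((\<lambda>y. s y - f y) \<circ> inv_into V \<psi> has_derivative (\<lambda>v. 0)) (at (\<psi> z))" by simp
    from has_derivative_add[OF this has_derivative_const[of "- s z"]]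
    have "((\<lambda>y. p0 y - f y) \<circ> inv_into V \<psi> has_derivative (\<lambda>v. 0)) (at (\<psi> z))"
      by (simp add: comp_def p0_def algebra_simps)
    then have z0: "zero_deriv (\<lambda>y. p0 y - f y) z" by (rule zero_deriv_if_chart[OF V(1,2)])
    have C: "q \<in> Cr_functions 1 A" "p0 \<in> Cr_functions 1 A"
      using Pr_Cr[OF q(1)] sp_Cr[OF sp0] Cr_functions_1 by auto
    \<comment> \<open>The square of \<open>q\<close> makes \<open>p\<close> vanish to second order
      on \<open>Z\<close>.\<close>
    define p where "p y = q y * (q y * p0 y)" for y
    have "Pr (card Z + (card Z + 1)) p" unfolding p_def[abs_def] by (intro Pr_mult q(1) Pr_sp sp0)
    then have "Pr D p" by (rule Pr_pad) (use Z(2) D_def in simp)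
    from Pr_lincomb[OF this] obtain c where c: "lincomb N hs c = p" by blast
    have "zero_deriv p w" if "w \<in> Z" for w unfolding p_def[abs_def]
      by (rule zero_deriv_mult) (use C Cr_functions_mult q that in auto)
    moreover have "zero_deriv (\<lambda>y. p y - f y) z"
    proof -
      \<comment> \<open>Since q(z) = 1 and p0(z) = 0, the difference (q^2 - 1) p0 between
        \<open>p\<close> and \<open>p0\<close> is a product of two functions vanishing at
        \<open>z\<close>.\<close>
      have "zero_deriv (\<lambda>y. (p0 y - f y) + (q y * q y - 1) * p0 y) z"
        by (intro zero_deriv_add z0 zero_deriv_mult Cr_functions_diff Cr_functions_mult Cr_functions_const C)
          (use q in \<open>auto simp: p0_def\<close>)
      then show ?thesis by (simp add: p_def algebra_simps)
    qed
    ultimately show "\<exists>c. zero_deriv (\<lambda>x. lincomb N hs c x - f x) z \<and> (\<forall>w\<in>Z. zero_deriv (lincomb N hs c) w)"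
      using c by auto
  qed
qed

text \<open>The coordinates of a chart, realised to first order at \<open>x\<close> by functions on
  all of M. Being global, these can be transported to the other points of the orbit of
  \<open>x\<close>.\<close>

lemma coordinate_chart:
  obtains V \<psi> f where "(V, \<psi>) \<in> A" "x \<in> V" "\<And>b. b \<in> B \<Longrightarrow> f b \<in> Cr_functions 1 A"
    "\<And>b. b \<in> B \<Longrightarrow> ((f b \<circ> inv_into V \<psi>) has_derivative coord b) (at (\<psi> x))"
proof -
  obtain Q where Q: "Q \<subseteq> Cr_functions r A"
    and loc: "\<forall>x. \<exists>V \<psi>. (V, \<psi>) \<in> A \<and> x \<in> V \<and> (\<forall>b\<in>B. \<exists>c.
      (((\<lambda>y. \<Sum>q\<in>Q. c q * q y) \<circ> inv_into V \<psi>) has_derivative coord b) (at (\<psi> x)))"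
    using coordinate_functions by (elim exE conjE) (rule that)
  obtain V \<psi> where V: "(V, \<psi>) \<in> A" "x \<in> V"
    "\<forall>b\<in>B. \<exists>c. (((\<lambda>y. \<Sum>q\<in>Q. c q * q y) \<circ> inv_into V \<psi>) has_derivative coord b) (at (\<psi> x))"
    using loc by blast
  from bchoice[OF V(3)] obtain c where
    c: "\<And>b. b \<in> B \<Longrightarrow> (((\<lambda>y. \<Sum>q\<in>Q. c b q * q y) \<circ> inv_into V \<psi>) has_derivative coord b) (at (\<psi> x))" by blast
  have "(\<lambda>y. \<Sum>q\<in>Q. c b q * q y) \<in> Cr_functions 1 A" for b
    using Q Cr_functions_1 by (intro Cr_functions_sum Cr_functions_cmult) auto
  then show ?thesis using that[OF V(1,2), of "\<lambda>b y. \<Sum>q\<in>Q. c b q * q y"] c by blast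
qed

end

section \<open>Lipschitz continuity with respect to the Riemannian distance\<close>

text \<open>No measurability of \<open>s\<close> is assumed; the derivative \<open>f'\<close> is measurable as a limit of difference quotients.\<close>

lemma increment_le_nn_integral:
  fixes f :: "real \<Rightarrow> real"
  assumes "finite S" "continuous_on {0..1} f"
    and f': "\<And>t. t \<in> {0<..<1} - S \<Longrightarrow> (f has_real_derivative f' t) (at t)"
    and bound: "\<And>t. t \<in> {0<..<1} - S \<Longrightarrow> \<bar>f' t\<bar> \<le> s t"
  shows "ennreal \<bar>f 1 - f 0\<bar> \<le> (\<integral>\<^sup>+ t\<in>{0..1}. ennreal (s t) \<partial>lborel)"
proof (cases "(\<integral>\<^sup>+ t\<in>{0..1}. ennreal (s t) \<partial>lborel) = \<infinity>")
  case False
  define E where "E = {0<..<1::real} - S"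
  define G where "G t = indicator E t * f' t" for t
  \<comment> \<open>The constant continuation beyond [0,1] is continuous on the whole line, so that
    its difference quotients are Borel measurable.\<close>
  define fe where "fe t = f (min 1 (max 0 t))" for t
  have Em: "E \<in> sets borel" unfolding E_def using finite_imp_closed[OF assms(1)] by auto
  have "continuous_on UNIV fe" unfolding fe_def
    by (rule continuous_on_compose2[OF assms(2)]) (auto intro!: continuous_intros)
  then have fem: "fe \<in> borel_measurable borel" by (rule borel_measurable_continuous_onI)
  have lim: "(\<lambda>n. indicator E t * (real (Suc n) * (fe (t + inverse (real (Suc n))) - fe t))) \<longlonglongrightarrow> G t" for t
  proof (cases "t \<in> E")
    case True
    then have t: "t \<in> {0<..<1}" "t \<in> {0<..<1} - S" by (auto simp: E_def)
    have "(fe has_real_derivative f' t) (at t)"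
      by (rule has_field_derivative_transform_within_open[OF f'[OF t(2)] open_greaterThanLessThan t(1)])
        (auto simp: fe_def)
    then have "(\<lambda>h. (fe (t + h) - fe t) / h) \<midarrow>0\<rightarrow> f' t" by (simp add: DERIV_def)
    moreover have "filterlim (\<lambda>n. inverse (real (Suc n))) (at 0) sequentially"
      using LIMSEQ_inverse_real_of_nat by (auto simp: filterlim_at)
    ultimately have "(\<lambda>n. (fe (t + inverse (real (Suc n))) - fe t) / inverse (real (Suc n))) \<longlonglongrightarrow> f' t"
      by (rule filterlim_compose)
    then show ?thesis using True by (simp add: G_def field_simps)
  qed (simp add: G_def)
  have Gm: "G \<in> borel_measurable borel"
    by (rule borel_measurable_LIMSEQ_real[OF lim]) (use fem Em in measurable)
  have "(\<integral>\<^sup>+ t. ennreal (norm (G t)) \<partial>lborel) \<le> (\<integral>\<^sup>+ t\<in>{0..1}. ennreal (s t) \<partial>lborel)"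
    using bound by (intro nn_integral_mono) (auto simp: G_def E_def indicator_def intro!: ennreal_leI)
  moreover have "\<dots> < \<infinity>" using False by (simp add: less_top)
  ultimately have int: "integrable lborel G" "(\<integral>\<^sup>+ t. ennreal (norm (G t)) \<partial>lborel) \<le> (\<integral>\<^sup>+ t\<in>{0..1}. ennreal (s t) \<partial>lborel)"
    using Gm by (auto intro!: integrableI_bounded)
  \<comment> \<open>For the gauge integral the fundamental theorem presupposes no integrability. The
    result is then identified with the Lebesgue integral of \<open>G\<close>, whose integrability
    comes from the bound by \<open>s\<close>.\<close>
  have "(f' has_integral (f 1 - f 0)) {0..1}"
    using f' by (intro fundamental_theorem_of_calculus_interior_strong[OF assms(1) _ _ assms(2)])
      (auto simp flip: has_real_derivative_iff_has_vector_derivative)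
  then have "(G has_integral (f 1 - f 0)) {0..1}"
    by (rule has_integral_spike_finite[of "S \<union> {0, 1}", rotated 2]) (use assms(1) in \<open>auto simp: G_def E_def\<close>)
  then have "(G has_integral (f 1 - f 0)) UNIV"
    by (rule has_integral_on_superset) (auto simp: G_def E_def)
  then have eq: "integral\<^sup>L lborel G = f 1 - f 0"
    using has_integral_integral_lborel[OF int(1)] has_integral_unique by blast
  have "ennreal \<bar>f 1 - f 0\<bar> \<le> ennreal (\<integral>t. norm (G t) \<partial>lborel)"
    unfolding eq[symmetric] using integral_norm_bound[of lborel G] by (intro ennreal_leI) simp
  also have "\<dots> = (\<integral>\<^sup>+ t. ennreal (norm (G t)) \<partial>lborel)"
    using int(1) by (intro nn_integral_eq_integral[symmetric]) auto
  finally show ?thesis using int(2) by (rule order_trans)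
qed simp

locale riemannian_manifold = compact_Cr_manifold B r A
  for B :: "'e::real_normed_vector set" and r :: enat and A :: "('m::t2_space, 'e) chart set" +
  fixes g :: "('m, 'e) chart \<Rightarrow> 'm \<Rightarrow> 'e \<Rightarrow> 'e \<Rightarrow> real"
  assumes metric: "riemannian_metric A g"
begin

lemma metric_chart:
  assumes "(U, \<phi>) \<in> A"
  shows "x \<in> U \<Longrightarrow> bilinear (g (U, \<phi>) x)" "x \<in> U \<Longrightarrow> v \<noteq> 0 \<Longrightarrow> 0 < g (U, \<phi>) x v v"
    "continuous_on U (\<lambda>x. g (U, \<phi>) x v w)"
  using metric assms unfolding riemannian_metric_def by blast+

lemma metric_transform:
  assumes "(U, \<phi>) \<in> A" "(V, \<psi>) \<in> A" "x \<in> U" "x \<in> V"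
  shows "g (U, \<phi>) x v w = g (V, \<psi>) x (frechet_derivative (\<psi> \<circ> inv_into U \<phi>) (at (\<phi> x)) v)
                   (frechet_derivative (\<psi> \<circ> inv_into U \<phi>) (at (\<phi> x)) w)"
proof -
  note t = metric[unfolded riemannian_metric_def, THEN conjunct2]
  show ?thesis
    using bspec[OF t assms(1), unfolded split_conv, THEN bspec, OF assms(2), unfolded split_conv] assms(3,4)
    by blast
qed

lemma bilinear_expand:
  assumes "bilinear h"
  shows "h v w = (\<Sum>b\<in>B. \<Sum>b'\<in>B. coord b v * (coord b' w * (h b b' :: real)))"
proof -
  have lin: "linear (\<lambda>v. h v w)" "\<And>v. linear (h v)" for w using assms by (simp_all add: bilinear_def)
  have "h v w = (\<Sum>b\<in>B. coord b v *\<^sub>R h b w)"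
    by (rule linear_expand[OF lin(1)])
  also have "\<dots> = (\<Sum>b\<in>B. coord b v *\<^sub>R (\<Sum>b'\<in>B. coord b' w *\<^sub>R h b b'))"
    by (rule sum.cong[OF refl], rule arg_cong2[where f="(*\<^sub>R)", OF refl], rule linear_expand[OF lin(2)])
  finally show ?thesis by (simp add: sum_distrib_left)
qed

lemma open_neighbourhood:
  fixes h :: "'i \<Rightarrow> 'm \<Rightarrow> real"
  assumes "open U" "x0 \<in> U" "finite I" "\<And>i. i \<in> I \<Longrightarrow> continuous_on U (h i)" "0 < d"
  obtains O' where "open O'" "x0 \<in> O'" "O' \<subseteq> U" "\<And>i x. i \<in> I \<Longrightarrow> x \<in> O' \<Longrightarrow> \<bar>h i x - h i x0\<bar> < d"
proof (rule that[of "U \<inter> (\<Inter>i\<in>I. h i -` ball (h i x0) d \<inter> U)"])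
  show "open (U \<inter> (\<Inter>i\<in>I. h i -` ball (h i x0) d \<inter> U))"
    using assms continuous_on_open_vimage[OF assms(1)] by (intro open_Int open_INT) auto
  fix i x assume "i \<in> I" "x \<in> U \<inter> (\<Inter>i\<in>I. h i -` ball (h i x0) d \<inter> U)"
  then have "h i x \<in> ball (h i x0) d" by blast
  then show "\<bar>h i x - h i x0\<bar> < d" by (simp add: dist_real_def abs_minus_commute)
qed (use assms in auto)

text \<open>At \<open>x0\<close> the quadratic form has a positive minimum \<open>m\<close> on the
  compact unit sphere. Only finitely many coefficients have to be kept close to those at
  \<open>x0\<close> for half of this bound to persist.\<close>

lemma metric_lower_bound:
  assumes "(U, \<phi>) \<in> A" "x0 \<in> U"
  obtains O' m where "open O'" "x0 \<in> O'" "O' \<subseteq> U" "m > 0"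
    "\<And>x v. x \<in> O' \<Longrightarrow> m * (norm v)\<^sup>2 \<le> g (U, \<phi>) x v v"
proof -
  let ?g = "g (U, \<phi>)"
  have "\<exists>m>0. \<forall>v. norm v = 1 \<longrightarrow> m \<le> ?g x0 v v"
  proof (cases "{v::'e. norm v = 1} = {}")
    case False
    have "(\<lambda>v. ?g x0 v v) = (\<lambda>v. \<Sum>b\<in>B. \<Sum>b'\<in>B. coord b v * (coord b' v * ?g x0 b b'))"
      by (rule ext) (rule bilinear_expand[OF metric_chart(1)[OF assms]])
    then have "continuous_on {v. norm v = 1} (\<lambda>v. ?g x0 v v)"
      by (rule ssubst) (intro continuous_intros linear_continuous_on bounded_linear_coord)
    then obtain v0 where v0: "norm v0 = 1" "\<And>v. norm v = 1 \<Longrightarrow> ?g x0 v0 v0 \<le> ?g x0 v v"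
      using continuous_attains_inf[OF compact_unit_sphere False] by auto
    have "?g x0 v0 v0 > 0" using metric_chart(2)[OF assms, of v0] v0(1) by force
    then show ?thesis using v0(2) by blast
  qed (auto intro: exI[of _ 1])
  then obtain m where m: "m > 0" "\<And>v. norm v = 1 \<Longrightarrow> m \<le> ?g x0 v v" by blast
  have mv: "m * (norm v)\<^sup>2 \<le> ?g x0 v v" for v
  proof (cases "v = 0")
    case True
    then show ?thesis using bilinear_lzero[OF metric_chart(1)[OF assms]] by simp
  next
    case False
    then have "m \<le> ?g x0 ((1 / norm v) *\<^sub>R v) ((1 / norm v) *\<^sub>R v)" by (intro m(2)) simp
    also have "\<dots> = ?g x0 v v / (norm v)\<^sup>2"
      using bilinear_lmul[OF metric_chart(1)[OF assms]] bilinear_rmul[OF metric_chart(1)[OF assms]]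
      by (simp add: power2_eq_square)
    finally show ?thesis using False by (simp add: field_simps)
  qed
  obtain K where K: "K > 0" "\<And>z b. b \<in> B \<Longrightarrow> \<bar>coord b z\<bar> \<le> K * norm z" using coord_bounded by blast
  define n where "n = real (card B) + 1"
  have n: "n > 0" by (simp add: n_def)
  \<comment> \<open>At most n^2 terms, each bounded by K^2 d |v|^2, then add up to at most (m/2)
    |v|^2.\<close>
  define d where "d = m / (2 * K\<^sup>2 * n\<^sup>2)"
  have d: "d > 0" using m(1) K(1) n by (simp add: d_def)
  obtain O' where O': "open O'" "x0 \<in> O'" "O' \<subseteq> U"
    "\<And>i x. i \<in> B \<times> B \<Longrightarrow> x \<in> O' \<Longrightarrow> \<bar>?g x (fst i) (snd i) - ?g x0 (fst i) (snd i)\<bar> < d"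
    by (rule open_neighbourhood[OF open_chart[OF assms(1)] assms(2), of "B \<times> B" "\<lambda>i x. ?g x (fst i) (snd i)" d])
      (use finite_B d metric_chart(3)[OF assms(1)] in auto)
  have "(m / 2) * (norm v)\<^sup>2 \<le> ?g x v v" if x: "x \<in> O'" for x v
  proof -
    have "?g x0 v v - ?g x v v = (\<Sum>b\<in>B. \<Sum>b'\<in>B. coord b v * (coord b' v * ?g x0 b b')) -
        (\<Sum>b\<in>B. \<Sum>b'\<in>B. coord b v * (coord b' v * ?g x b b'))"
      by (rule arg_cong2[where f="(-)"])
        (rule bilinear_expand[OF metric_chart(1)] assms subsetD[OF O'(3) x])+
    also have "\<dots> = (\<Sum>b\<in>B. \<Sum>b'\<in>B. coord b v * (coord b' v * (?g x0 b b' - ?g x b b')))"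
      by (simp add: sum_subtractf right_diff_distrib)
    also have "\<dots> \<le> (\<Sum>b\<in>B. \<Sum>b'\<in>B. (K * norm v) * ((K * norm v) * d))"
    proof (intro sum_mono)
      fix b b' assume b: "b \<in> B" "b' \<in> B"
      have "\<bar>?g x0 b b' - ?g x b b'\<bar> \<le> d" using O'(4)[of "(b, b')" x] b x by (simp add: abs_minus_commute)
      then have "\<bar>coord b v * (coord b' v * (?g x0 b b' - ?g x b b'))\<bar> \<le> (K * norm v) * ((K * norm v) * d)"
        unfolding abs_mult using K b by (intro mult_mono) auto
      then show "coord b v * (coord b' v * (?g x0 b b' - ?g x b b')) \<le> (K * norm v) * ((K * norm v) * d)" by simp
    qed
    also have "\<dots> = (real (card B))\<^sup>2 * (K\<^sup>2 * d * (norm v)\<^sup>2)" by (simp add: power2_eq_square)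
    also have "\<dots> \<le> n\<^sup>2 * (K\<^sup>2 * d * (norm v)\<^sup>2)"
      using d by (intro mult_right_mono power_mono) (auto simp: n_def)
    also have "\<dots> = (m / 2) * (norm v)\<^sup>2" using K n by (simp add: d_def)
    finally show ?thesis using mv[of v] by simp
  qed
  then show ?thesis using that[OF O'(1-3), of "m / 2"] m(1) by simp
qed

text \<open>In one chart around \<open>x0\<close> the derivative is bounded nearby and the metric is
  bounded below. Under a change of chart both sides are evaluated at the transformed vector, so the
  same constant serves every chart containing the point.\<close>

lemma derivative_bound_local:
  assumes f: "f \<in> Cr_functions 1 A"
  shows "\<exists>O' L. open O' \<and> x0 \<in> O' \<and> L > 0 \<and> (\<forall>x\<in>O'. \<forall>U \<phi> v. (U, \<phi>) \<in> A \<longrightarrow> x \<in> U \<longrightarrow>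
     \<bar>frechet_derivative (f \<circ> inv_into U \<phi>) (at (\<phi> x)) v\<bar> \<le> L * sqrt (g (U, \<phi>) x v v))"
proof -
  obtain V \<psi> where V: "(V, \<psi>) \<in> A" "x0 \<in> V" by (rule chart_exists)
  let ?F = "f \<circ> inv_into V \<psi>"
  define D where "D x = frechet_derivative ?F (at (\<psi> x))" for x
  have DF: "(?F has_derivative D x) (at (\<psi> x))" if "x \<in> V" for x
    unfolding D_def using Cr_functions_differentiable[OF f V(1) that] by (rule iffD1[OF frechet_derivative_works])
  have "Cr_on 1 (\<psi> ` V) ?F" using f V(1) by (simp add: Cr_functions_iff comp_def)
  then have "continuous_on (\<psi> ` V) (\<lambda>z. frechet_derivative ?F (at z) b)" for b by (simp add: Cr_on_1)
  then have Dc: "continuous_on V (\<lambda>x. D x b)" for b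
    unfolding D_def by (rule continuous_on_compose2[OF _ continuous_on_chart[OF V(1)]]) auto
  obtain K where K: "K > 0" "\<And>z b. b \<in> B \<Longrightarrow> \<bar>coord b z\<bar> \<le> K * norm z" using coord_bounded by blast
  obtain O1 where O1: "open O1" "x0 \<in> O1" "O1 \<subseteq> V" "\<And>b x. b \<in> B \<Longrightarrow> x \<in> O1 \<Longrightarrow> \<bar>D x b - D x0 b\<bar> < 1"
    by (rule open_neighbourhood[OF open_chart[OF V(1)] V(2) finite_B, of "\<lambda>b x. D x b" 1]) (use Dc in auto)
  obtain O2 m where O2: "open O2" "x0 \<in> O2" "O2 \<subseteq> V" "m > 0"
    "\<And>x v. x \<in> O2 \<Longrightarrow> m * (norm v)\<^sup>2 \<le> g (V, \<psi>) x v v"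
    using metric_lower_bound[OF V] by metis
  define M where "M = (\<Sum>b\<in>B. K * (\<bar>D x0 b\<bar> + 1)) + 1"
  have M: "M > 0" unfolding M_def using K by (intro add_nonneg_pos sum_nonneg) auto
  define L where "L = M / sqrt m"
  have L: "L > 0" using M O2(4) by (simp add: L_def)
  have Dle: "\<bar>D x v\<bar> \<le> L * sqrt (g (V, \<psi>) x v v)" if x: "x \<in> O1 \<inter> O2" for x v
  proof -
    have "D x v = (\<Sum>b\<in>B. coord b v *\<^sub>R D x b)"
      using linear_expand[OF has_derivative_linear[OF DF]] x O1(3) by blast
    then have "\<bar>D x v\<bar> \<le> (\<Sum>b\<in>B. \<bar>coord b v\<bar> * \<bar>D x b\<bar>)"
      by (simp add: sum_abs[THEN order_trans] abs_mult)
    also have "\<dots> \<le> (\<Sum>b\<in>B. (K * norm v) * (\<bar>D x0 b\<bar> + 1))"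
    proof (intro sum_mono mult_mono)
      fix b assume "b \<in> B"
      then show "\<bar>D x b\<bar> \<le> \<bar>D x0 b\<bar> + 1" using O1(4)[of b x] x by auto
    qed (use K in auto)
    also have "\<dots> = (M - 1) * norm v" by (simp add: M_def sum_distrib_left mult_ac)
    also have "\<dots> \<le> M * norm v" by (intro mult_right_mono) auto
    also have "\<dots> = L * sqrt (m * (norm v)\<^sup>2)" using O2(4) by (simp add: L_def real_sqrt_mult)
    also have "\<dots> \<le> L * sqrt (g (V, \<psi>) x v v)" using L O2(5) x by (intro mult_left_mono) auto
    finally show ?thesis .
  qed
  have "\<bar>frechet_derivative (f \<circ> inv_into U \<phi>) (at (\<phi> x)) v\<bar> \<le> L * sqrt (g (U, \<phi>) x v v)"
    if x: "x \<in> O1 \<inter> O2" and U: "(U, \<phi>) \<in> A" "x \<in> U" for x U \<phi> v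
  proof -
    have xV: "x \<in> V" using x O1(3) by blast
    show ?thesis
      using frechet_derivative_at[OF chart_change[OF V(1) U(1) xV U(2) DF[OF xV]], symmetric]
        Dle[OF x] metric_transform[OF U(1) V(1) U(2) xV, of v v] by simp
  qed
  then show ?thesis using O1(1,2) O2(1,2) L by (intro exI[of _ "O1 \<inter> O2"] exI[of _ L]) auto
qed

lemma derivative_bound:
  assumes f: "f \<in> Cr_functions 1 A"
  obtains L where "L > 0" "\<And>x U \<phi> v. (U, \<phi>) \<in> A \<Longrightarrow> x \<in> U \<Longrightarrow>
     \<bar>frechet_derivative (f \<circ> inv_into U \<phi>) (at (\<phi> x)) v\<bar> \<le> L * sqrt (g (U, \<phi>) x v v)"
proof -
  have "\<forall>x0. \<exists>O' L. open O' \<and> x0 \<in> O' \<and> L > 0 \<and> (\<forall>x\<in>O'. \<forall>U \<phi> v. (U, \<phi>) \<in> A \<longrightarrow> x \<in> U \<longrightarrow>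
     \<bar>frechet_derivative (f \<circ> inv_into U \<phi>) (at (\<phi> x)) v\<bar> \<le> L * sqrt (g (U, \<phi>) x v v))"
    using derivative_bound_local[OF f] by blast
  then obtain O' where "\<forall>x0. \<exists>L. open (O' x0) \<and> x0 \<in> O' x0 \<and> L > 0 \<and> (\<forall>x\<in>O' x0. \<forall>U \<phi> v. (U, \<phi>) \<in> A \<longrightarrow> x \<in> U \<longrightarrow>
     \<bar>frechet_derivative (f \<circ> inv_into U \<phi>) (at (\<phi> x)) v\<bar> \<le> L * sqrt (g (U, \<phi>) x v v))"
    by (rule choice[THEN exE])
  then obtain L where OL: "\<forall>x0. open (O' x0) \<and> x0 \<in> O' x0 \<and> L x0 > 0 \<and> (\<forall>x\<in>O' x0. \<forall>U \<phi> v. (U, \<phi>) \<in> A \<longrightarrow> x \<in> U \<longrightarrow>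
     \<bar>frechet_derivative (f \<circ> inv_into U \<phi>) (at (\<phi> x)) v\<bar> \<le> L x0 * sqrt (g (U, \<phi>) x v v))"
    by (rule choice[THEN exE])
  have op: "open (O' x0)" for x0 using OL by blast
  have cov: "UNIV \<subseteq> (\<Union>x0\<in>UNIV. O' x0)" using OL by blast
  obtain J where J: "finite J" "UNIV \<subseteq> (\<Union>x0\<in>J. O' x0)"
    using compactE_image[OF compact_M op cov] by metis
  define M where "M = Max (insert 1 (L ` J))"
  have LM: "L a \<le> M" if "a \<in> J" for a unfolding M_def using J(1) that by (intro Max_ge) auto
  have M1: "1 \<le> M" unfolding M_def using J(1) by (intro Max_ge) auto
  show ?thesis
  proof (rule that[of M])
    show "M > 0" using M1 by simp
    fix x U \<phi> v assume U: "(U, \<phi>) \<in> A" "x \<in> U"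
    obtain a where a: "a \<in> J" "x \<in> O' a" using J(2) by blast
    then have "\<bar>frechet_derivative (f \<circ> inv_into U \<phi>) (at (\<phi> x)) v\<bar> \<le> L a * sqrt (g (U, \<phi>) x v v)"
      using OL U by blast
    also have "\<dots> \<le> M * sqrt (g (U, \<phi>) x v v)"
    proof (rule mult_right_mono[OF LM[OF a(1)]])
      show "0 \<le> sqrt (g (U, \<phi>) x v v)"
        using metric_chart(2)[OF U, of v] bilinear_lzero[OF metric_chart(1)[OF U]] by (cases "v = 0") (auto simp: less_imp_le)
    qed
    finally show "\<bar>frechet_derivative (f \<circ> inv_into U \<phi>) (at (\<phi> x)) v\<bar> \<le> M * sqrt (g (U, \<phi>) x v v)" .
  qed
qed

text \<open>Along a curve the derivative of \<open>f\<close> is at most \<open>L\<close> times the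
  speed; integrating and taking the infimum over curves gives the claim. For points joined by no
  curve the infimum is infinite.\<close>

lemma increment_le_length_dist:
  assumes f: "f \<in> Cr_functions 1 A"
  obtains L where "L > 0" "\<And>x y. ennreal (\<bar>f x - f y\<bar> / L) \<le> length_dist A g x y"
proof -
  obtain L where L: "L > 0" "\<And>x U \<phi> v. (U, \<phi>) \<in> A \<Longrightarrow> x \<in> U \<Longrightarrow>
     \<bar>frechet_derivative (f \<circ> inv_into U \<phi>) (at (\<phi> x)) v\<bar> \<le> L * sqrt (g (U, \<phi>) x v v)"
    using derivative_bound[OF f] by metis
  have "ennreal (\<bar>f (\<gamma> 0) - f (\<gamma> 1)\<bar> / L) \<le> curve_length A g \<gamma>" if \<gamma>: "piecewise_C1_curve A \<gamma>" for \<gamma>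
  proof -
    have \<gamma>c: "continuous_on {0..1} \<gamma>" using \<gamma> unfolding piecewise_C1_curve_def by blast
    obtain S where S: "finite S"
      "\<And>U \<phi>. (U, \<phi>) \<in> A \<Longrightarrow> (\<phi> \<circ> \<gamma>) C1_differentiable_on (({0<..<1} - S) \<inter> \<gamma> -` U)"
      using \<gamma> unfolding piecewise_C1_curve_def by blast
    let ?F = "\<lambda>t. f (\<gamma> t) / L"
    have ex: "\<exists>d. (?F has_real_derivative d) (at t) \<and> \<bar>d\<bar> \<le> curve_speed A g \<gamma> t" if t: "t \<in> {0<..<1} - S" for t
    proof -
      \<comment> \<open>The chart that \<open>curve_speed\<close> itself selects at this
        time.\<close>
      define c where "c = (SOME c. c \<in> A \<and> \<gamma> t \<in> fst c)"
      have "\<exists>c. c \<in> A \<and> \<gamma> t \<in> fst c" by (rule chart_exists[of "\<gamma> t"]) auto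
      then have "c \<in> A \<and> \<gamma> t \<in> fst c" unfolding c_def by (rule someI_ex)
      moreover obtain U \<phi> where cU: "c = (U, \<phi>)" by (cases c)
      ultimately have U: "(U, \<phi>) \<in> A" "\<gamma> t \<in> U" by auto
      define v where "v = vector_derivative (\<phi> \<circ> \<gamma>) (at t)"
      have v: "((\<phi> \<circ> \<gamma>) has_derivative (\<lambda>h. h *\<^sub>R v)) (at t)"
        using S(2)[OF U(1)] t U(2) unfolding C1_differentiable_on_def v_def
        by (metis IntI has_vector_derivative_def vector_derivative_at vimageI2)
      let ?D = "frechet_derivative (f \<circ> inv_into U \<phi>) (at (\<phi> (\<gamma> t)))"
      have D: "((f \<circ> inv_into U \<phi>) has_derivative ?D) (at ((\<phi> \<circ> \<gamma>) t))"
        using Cr_functions_differentiable[OF f U] unfolding comp_apply by (rule iffD1[OF frechet_derivative_works])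
      have W: "open ({0<..<1} \<inter> \<gamma> -` U)"
      proof -
        have "continuous_on {0<..<1} \<gamma>" by (rule continuous_on_subset[OF \<gamma>c]) auto
        then show ?thesis using open_chart[OF U(1)]
          by (subst Int_commute) (simp add: continuous_on_open_vimage[OF open_greaterThanLessThan])
      qed
      have "((\<lambda>t. f (\<gamma> t)) has_derivative (\<lambda>h. ?D (h *\<^sub>R v))) (at t)"
        by (rule has_derivative_transform_within_open[OF has_derivative_compose[OF v D] W])
          (use t U inv_chart[OF U(1)] in auto)
      moreover have "?D (h *\<^sub>R v) = ?D v * h" for h
        using linear_scale[OF has_derivative_linear[OF D]] by simp
      ultimately have "((\<lambda>t. f (\<gamma> t)) has_real_derivative ?D v) (at t)"
        by (simp add: has_field_derivative_def)
      then have "(?F has_real_derivative ?D v / L) (at t)" by (rule DERIV_cdivide)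
      moreover have "\<bar>?D v / L\<bar> \<le> curve_speed A g \<gamma> t"
      proof -
        have "curve_speed A g \<gamma> t = sqrt (g (U, \<phi>) (\<gamma> t) v v)"
          unfolding curve_speed_def c_def[symmetric] by (simp add: cU v_def Let_def)
        then show ?thesis using L(2)[OF U, of v] L(1) by (simp add: abs_divide divide_simps mult.commute)
      qed
      ultimately show ?thesis by blast
    qed
    then have "\<forall>t\<in>{0<..<1} - S. \<exists>d. (?F has_real_derivative d) (at t) \<and> \<bar>d\<bar> \<le> curve_speed A g \<gamma> t" by blast
    from bchoice[OF this] obtain F' where
      F': "\<And>t. t \<in> {0<..<1} - S \<Longrightarrow> (?F has_real_derivative F' t) (at t)"
        "\<And>t. t \<in> {0<..<1} - S \<Longrightarrow> \<bar>F' t\<bar> \<le> curve_speed A g \<gamma> t" by blast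
    have "continuous_on {0..1} ?F"
      using continuous_on_compose2[OF Cr_functions_continuous[OF f] \<gamma>c] L(1) by (intro continuous_intros) auto
    from increment_le_nn_integral[OF S(1) this F']
    have "ennreal \<bar>f (\<gamma> 1) / L - f (\<gamma> 0) / L\<bar> \<le> curve_length A g \<gamma>" by (simp add: curve_length_def)
    moreover have "\<bar>f (\<gamma> 1) / L - f (\<gamma> 0) / L\<bar> = \<bar>f (\<gamma> 0) - f (\<gamma> 1)\<bar> / L"
      using L(1) by (simp add: abs_minus_commute flip: diff_divide_distrib)
    ultimately show ?thesis by simp
  qed
  then have "ennreal (\<bar>f x - f y\<bar> / L) \<le> length_dist A g x y" for x y
    unfolding length_dist_def by (intro INF_greatest) auto
  with L(1) show ?thesis using that by blast
qed

text \<open>A distance below 1 certifies that \<open>length_dist\<close> is finite, because the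
  conventional distance between different components is at least 1. Hausdorff null sets are tested
  with sets of small diameter, so the restriction does no harm.\<close>

lemma Lipschitz_riemannian_dist:
  assumes f: "f \<in> Cr_functions 1 A"
  obtains L where "L > 0" "\<And>x y. riemannian_dist A g x y < 1 \<Longrightarrow> \<bar>f x - f y\<bar> \<le> L * riemannian_dist A g x y"
proof -
  obtain L where L: "L > 0" "\<And>x y. ennreal (\<bar>f x - f y\<bar> / L) \<le> length_dist A g x y"
    using increment_le_length_dist[OF f] by metis
  have "\<bar>f x - f y\<bar> \<le> L * riemannian_dist A g x y" if "riemannian_dist A g x y < 1" for x y
  proof -
    have fin: "length_dist A g x y < \<infinity>"
    proof (rule ccontr)
      assume "\<not> length_dist A g x y < \<infinity>"
      then have "riemannian_dist A g x y \<ge> 1" by (simp add: riemannian_dist_def)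
      with that show False by simp
    qed
    then have "\<bar>f x - f y\<bar> / L \<le> enn2real (length_dist A g x y)"
      using L by (subst ennreal_le_iff[symmetric]) (auto simp: less_top)
    also have "\<dots> = riemannian_dist A g x y" using fin by (simp add: riemannian_dist_def)
    finally show ?thesis using L(1) by (simp add: field_simps)
  qed
  with L(1) show ?thesis using that by blast
qed

end

section \<open>Null sets\<close>

lemma hausdorff_null_cover:
  assumes "hausdorff_measure d k X = 0" "0 < \<delta>" "0 < \<eta>"
  obtains C :: "nat \<Rightarrow> 'a set" where "X \<subseteq> (\<Union>i. C i)" "\<And>i. ediam d (C i) \<le> ennreal \<delta>"
    "(\<Sum>i. if C i = {} then 0 else ediam d (C i) ^ k) < \<eta>"
proof -
  let ?S = "{C :: nat \<Rightarrow> 'a set. X \<subseteq> (\<Union>i. C i) \<and> (\<forall>i. ediam d (C i) \<le> ennreal \<delta>)}"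
  have "(INF C\<in>?S. (\<Sum>i. if C i = {} then 0 else ediam d (C i) ^ k)) \<le> hausdorff_measure d k X"
    unfolding hausdorff_measure_def by (rule SUP_upper) (use assms(2) in simp)
  then have "(INF C\<in>?S. (\<Sum>i. if C i = {} then 0 else ediam d (C i) ^ k)) < \<eta>"
    using assms(1,3) by (simp add: order.strict_trans1)
  then obtain C where "C \<in> ?S" "(\<Sum>i. if C i = {} then 0 else ediam d (C i) ^ k) < \<eta>"
    unfolding INF_less_iff by blast
  with that show ?thesis by blast
qed

lemma dist_le_ediam:
  assumes "x \<in> S" "y \<in> S" "ediam d S < \<infinity>" shows "d x y \<le> enn2real (ediam d S)"
proof -
  have "ennreal (d x y) \<le> ediam d S"
    unfolding ediam_def using assms(1,2) by (intro SUP_upper2[OF assms(1)] SUP_upper2[OF assms(2)] order_refl)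
  then have "enn2real (ennreal (d x y)) \<le> enn2real (ediam d S)" using assms(3) by (intro enn2real_mono) auto
  then show ?thesis by (cases "d x y \<ge> 0") (auto intro: order_trans[OF _ enn2real_nonneg])
qed

text \<open>A cover of \<open>X\<close> by sets of diameters \<rho> yields a cover of
  \<open>E\<close> by balls of radii K \<rho>, whose total volume is a constant times the Hausdorff
  sum. A relation is used instead of a map because a parameter may be related to several points of
  \<open>X\<close>, and a point to none.\<close>

lemma null_if_Lipschitz_relation:
  fixes E :: "'a::euclidean_space set"
  assumes H: "hausdorff_measure d DIM('a) X = 0" and E: "E \<in> sets borel" and K: "K > 0"
    and sel: "\<And>t. t \<in> E \<Longrightarrow> \<exists>y\<in>X. R t y"
    and lip: "\<And>t t' y y'. y \<in> X \<Longrightarrow> y' \<in> X \<Longrightarrow> R t y \<Longrightarrow> R t' y' \<Longrightarrow> d y y' < 1 \<Longrightarrow> norm (t - t') \<le> K * d y y'"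
  shows "emeasure lborel E = 0"
proof -
  define c where "c = unit_ball_vol (real DIM('a)) * K ^ DIM('a)"
  have c: "c \<ge> 0" using K by (simp add: c_def)
  have bound: "emeasure lborel E \<le> ennreal (c * \<eta>)" if \<eta>: "\<eta> > 0" for \<eta>
  proof -
    \<comment> \<open>Diameters of at most 1/2 keep all occurring distances below 1, where
      \<open>lip\<close> applies.\<close>
    obtain C where C: "X \<subseteq> (\<Union>i. C i)" "\<And>i. ediam d (C i) \<le> ennreal (1 / 2)"
      "(\<Sum>i. if C i = {} then 0 else ediam d (C i) ^ DIM('a)) < ennreal \<eta>"
      using hausdorff_null_cover[OF H, of "1/2" "ennreal \<eta>"] \<eta> by auto
    define \<rho> where "\<rho> i = enn2real (ediam d (C i))" for i
    have fin: "ediam d (C i) < \<infinity>" for i using le_less_trans[OF C(2) ennreal_less_top] by simp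
    have \<rho>e: "ennreal (\<rho> i) = ediam d (C i)" for i using fin[of i] by (simp add: \<rho>_def less_top)
    have \<rho>0: "\<rho> i \<ge> 0" for i by (simp add: \<rho>_def)
    have "ennreal (\<rho> i) \<le> ennreal (1 / 2)" for i unfolding \<rho>e by (rule C(2))
    then have \<rho>half: "\<rho> i \<le> 1 / 2" for i by (rule iffD1[OF ennreal_le_iff, rotated]) simp
    define E' where "E' i = {t \<in> E. \<exists>y\<in>X \<inter> C i. R t y}" for i
    \<comment> \<open>Any parameter related to a point of \<open>C i\<close> may serve as the
      centre.\<close>
    define F where "F i = (if E' i = {} then {} else cball (SOME t. t \<in> E' i) (K * \<rho> i))" for i
    have "E' i \<subseteq> F i" for i
    proof
      fix t assume t: "t \<in> E' i"
      then have s: "(SOME t. t \<in> E' i) \<in> E' i" by (rule someI)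
      from t obtain y where y: "y \<in> X" "y \<in> C i" "R t y" unfolding E'_def by blast
      from s obtain y' where y': "y' \<in> X" "y' \<in> C i" "R (SOME t. t \<in> E' i) y'" unfolding E'_def by blast
      have d: "d y' y \<le> \<rho> i" unfolding \<rho>_def by (rule dist_le_ediam[OF y'(2) y(2) fin])
      have "norm ((SOME t. t \<in> E' i) - t) \<le> K * d y' y"
        using d \<rho>half[of i] by (intro lip[OF y'(1) y(1) y'(3) y(3)]) simp
      also have "\<dots> \<le> K * \<rho> i" using d K by simp
      finally show "t \<in> F i" using t by (auto simp: F_def dist_norm)
    qed
    moreover have "E \<subseteq> (\<Union>i. E' i)"
    proof
      fix t assume t: "t \<in> E"
      then obtain y where y: "y \<in> X" "R t y" using sel by blast
      then obtain i where "y \<in> C i" using C(1) by blast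
      then show "t \<in> (\<Union>i. E' i)" using t y unfolding E'_def by blast
    qed
    ultimately have "E \<subseteq> (\<Union>i. F i)" by (meson SUP_mono' order_trans)
    moreover have Fm: "F i \<in> sets lborel" for i by (simp add: F_def)
    ultimately have "emeasure lborel E \<le> emeasure lborel (\<Union>i. F i)" by (intro emeasure_mono) auto
    also have "\<dots> \<le> (\<Sum>i. emeasure lborel (F i))" using Fm by (intro emeasure_subadditive_countably) auto
    also have "\<dots> \<le> (\<Sum>i. ennreal c * (if C i = {} then 0 else ediam d (C i) ^ DIM('a)))"
    proof (intro suminf_le)
      fix i
      show "emeasure lborel (F i) \<le> ennreal c * (if C i = {} then 0 else ediam d (C i) ^ DIM('a))"
      proof (cases "E' i = {}")
        case False
        then have "C i \<noteq> {}" unfolding E'_def by blast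
        moreover have "emeasure lborel (F i) = ennreal (c * \<rho> i ^ DIM('a))"
          using False \<rho>0[of i] K by (simp add: F_def emeasure_cball c_def power_mult_distrib mult.assoc)
        moreover have "ennreal (c * \<rho> i ^ DIM('a)) = ennreal c * ediam d (C i) ^ DIM('a)"
          using c \<rho>0[of i] by (simp add: ennreal_mult ennreal_power \<rho>e[symmetric])
        ultimately show ?thesis by simp
      qed (simp add: F_def)
    qed auto
    also have "\<dots> = ennreal c * (\<Sum>i. if C i = {} then 0 else ediam d (C i) ^ DIM('a))" by simp
    also have "\<dots> \<le> ennreal c * ennreal \<eta>" using C(3) by (intro mult_left_mono) auto
    finally show ?thesis using c \<eta> by (simp add: ennreal_mult)
  qed
  have "emeasure lborel E \<le> 0"
  proof (rule ennreal_le_epsilon)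
    fix e :: real assume e: "0 < e"
    have "emeasure lborel E \<le> ennreal (c * (e / (c + 1)))" using c e by (intro bound) auto
    also have "\<dots> \<le> ennreal e" using c e by (intro ennreal_leI) (simp add: field_simps)
    finally show "emeasure lborel E \<le> 0 + ennreal e" by simp
  qed
  then show ?thesis by simp
qed

section \<open>Translation invariance and shifts of the parameters\<close>

lemma product_lborel_translation:
  assumes "finite I"
  shows "distr (PiM I (\<lambda>_. lborel)) (PiM I (\<lambda>_. lborel)) (\<lambda>\<alpha>. \<lambda>n\<in>I. \<alpha> n + c n) =
    PiM I (\<lambda>_. lborel :: real measure)"
proof -
  interpret product_sigma_finite "\<lambda>_::'a. lborel :: real measure" by standard
  let ?M = "PiM I (\<lambda>_. lborel :: real measure)"
  let ?s = "\<lambda>\<alpha>. \<lambda>n\<in>I. \<alpha> n + c n"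
  have m: "?s \<in> measurable ?M ?M" by measurable
  show ?thesis
  proof (rule PiM_eqI[OF assms])
    fix A assume A: "\<And>i. i \<in> I \<Longrightarrow> A i \<in> sets (lborel :: real measure)"
    let ?A = "\<lambda>i. (+) (c i) -` A i"
    have Am: "?A i \<in> sets lborel" if "i \<in> I" for i
      using measurable_sets[of "(+) (c i)" borel borel "A i"] A[OF that] by simp
    have "emeasure (distr ?M ?M ?s) (Pi\<^sub>E I A) = emeasure ?M (?s -` Pi\<^sub>E I A \<inter> space ?M)"
      using m A assms by (intro emeasure_distr sets_PiM_I_finite) auto
    also have "?s -` Pi\<^sub>E I A \<inter> space ?M = Pi\<^sub>E I ?A"
      by (auto simp: space_PiM PiE_iff add.commute)
    also have "emeasure ?M (Pi\<^sub>E I ?A) = (\<Prod>i\<in>I. emeasure lborel (?A i))"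
      using Am by (rule emeasure_PiM[OF assms])
    also have "\<dots> = (\<Prod>i\<in>I. emeasure lborel (A i))"
    proof (rule prod.cong[OF refl])
      fix i assume i: "i \<in> I"
      have "emeasure lborel (A i) = emeasure (distr lborel borel ((+) (c i))) (A i)"
        by (subst lborel_distr_plus) simp
      also have "\<dots> = emeasure lborel (?A i)" using A[OF i] by (subst emeasure_distr) auto
      finally show "emeasure lborel (?A i) = emeasure lborel (A i)" by simp
    qed
    finally show "emeasure (distr ?M ?M ?s) (Pi\<^sub>E I A) = (\<Prod>i\<in>I. emeasure lborel (A i))" .
  qed simp
qed

text \<open>The indicator of \<open>P\<close> at \<alpha> + l(t) is integrated over \<alpha> and
  \<open>t\<close>. Integrating over \<open>t\<close> first gives 0; integrating over \<alpha> first
  gives, for each \<open>t\<close>, the measure of \<open>P\<close> by translation invariance. Thus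
  the measure of \<open>P\<close> times the infinite Lebesgue measure of the whole space is
  0.\<close>

lemma null_if_null_shifts:
  fixes l :: "'a::euclidean_space \<Rightarrow> nat \<Rightarrow> real"
  assumes P: "P \<in> sets (PiM {..<N} (\<lambda>_. lborel))"
    and l: "\<And>n. (\<lambda>t. l t n) \<in> borel_measurable borel"
    and null: "\<And>\<alpha>. AE t in lborel. (\<lambda>n\<in>{..<N}. \<alpha> n + l t n) \<notin> P"
  shows "P \<in> null_sets (PiM {..<N} (\<lambda>_. lborel))"
proof -
  let ?M = "PiM {..<N} (\<lambda>_. lborel :: real measure)"
  let ?s = "\<lambda>\<alpha> t. \<lambda>n\<in>{..<N}. \<alpha> n + l t n"
  interpret product_sigma_finite "\<lambda>_::nat. lborel :: real measure" by standard
  interpret finite_product_sigma_finite "\<lambda>_::nat. lborel :: real measure" "{..<N}" by standard simp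
  interpret pair_sigma_finite ?M "lborel :: 'a measure"
    by (rule pair_sigma_finite.intro[OF sigma_finite_measure_axioms sigma_finite_lborel])
  have s: "(\<lambda>(\<alpha>, t). ?s \<alpha> t) \<in> measurable (?M \<Otimes>\<^sub>M lborel) ?M"
  proof -
    have "(\<lambda>p. l (snd p) n) \<in> borel_measurable (?M \<Otimes>\<^sub>M lborel)" for n
      using measurable_compose[OF measurable_snd, of "\<lambda>t. l t n" lborel borel] l by simp
    then have "(\<lambda>p. fst p n + l (snd p) n) \<in> measurable (?M \<Otimes>\<^sub>M lborel) lborel" if "n < N" for n
    proof -
      have "(\<lambda>p. fst p n) \<in> measurable (?M \<Otimes>\<^sub>M (lborel :: 'a measure)) lborel"
        by (rule measurable_compose[OF measurable_fst measurable_component_singleton]) (use that in simp)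
      with \<open>(\<lambda>p. l (snd p) n) \<in> borel_measurable (?M \<Otimes>\<^sub>M lborel)\<close> show ?thesis
        unfolding measurable_cong_sets[OF refl sets_lborel] by (rule borel_measurable_add[rotated])
    qed
    then show ?thesis unfolding case_prod_beta by (intro measurable_restrict) (simp only: lessThan_iff)
  qed
  have s1: "?s \<alpha> \<in> measurable lborel ?M" for \<alpha>
    using l by (intro measurable_restrict) (auto intro!: borel_measurable_add)
  have s2: "(\<lambda>\<alpha>. ?s \<alpha> t) \<in> measurable ?M ?M" for t by measurable
  have "(\<lambda>(\<alpha>, t). indicator P (?s \<alpha> t) :: ennreal) \<in> borel_measurable (?M \<Otimes>\<^sub>M lborel)"
    using measurable_compose[OF s borel_measurable_indicator[OF P]] by (simp add: case_prod_beta')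
  then have "(\<integral>\<^sup>+t. (\<integral>\<^sup>+\<alpha>. indicator P (?s \<alpha> t) \<partial>?M) \<partial>lborel) =
    (\<integral>\<^sup>+\<alpha>. (\<integral>\<^sup>+t. indicator P (?s \<alpha> t) \<partial>lborel) \<partial>?M)"
    by (rule Fubini')
  also have "\<dots> = (\<integral>\<^sup>+\<alpha>. 0 \<partial>?M)"
  proof (rule nn_integral_cong)
    fix \<alpha>
    have "(\<integral>\<^sup>+t. indicator P (?s \<alpha> t) \<partial>lborel) = (\<integral>\<^sup>+t. 0 \<partial>(lborel :: 'a measure))"
    proof (rule nn_integral_cong_AE)
      show "AE t in lborel. indicator P (?s \<alpha> t) = (0::ennreal)"
        using null[of \<alpha>] by eventually_elim simp
    qed
    then show "(\<integral>\<^sup>+t. indicator P (?s \<alpha> t) \<partial>lborel) = 0" by simp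
  qed
  finally have zero: "(\<integral>\<^sup>+t. (\<integral>\<^sup>+\<alpha>. indicator P (?s \<alpha> t) \<partial>?M) \<partial>lborel) = 0" by simp
  have "(\<integral>\<^sup>+\<alpha>. indicator P (?s \<alpha> t) \<partial>?M) = emeasure ?M P" for t
  proof -
    have "(\<integral>\<^sup>+\<alpha>. indicator P (?s \<alpha> t) \<partial>?M) = (\<integral>\<^sup>+\<alpha>. indicator P \<alpha> \<partial>(distr ?M ?M (\<lambda>\<alpha>. ?s \<alpha> t)))"
      by (rule nn_integral_distr[OF s2 borel_measurable_indicator, symmetric]) (simp add: P)
    also have "\<dots> = emeasure ?M P" using P by (simp add: product_lborel_translation)
    finally show ?thesis .
  qed
  then have "emeasure ?M P * emeasure lborel (UNIV :: 'a set) = 0" using zero by simp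
  then have "emeasure ?M P = 0" by simp
  with P show ?thesis by (simp add: null_sets_def)
qed

text \<open>Test sets give the measurability of conditions that quantify over all points of a compact set.\<close>

definition test_set :: "'a::topological_space set \<Rightarrow> 'a set \<Rightarrow> bool" where
  "test_set Y X \<longleftrightarrow> countable Y \<and> Y \<subseteq> X \<and>
     (\<forall>f :: 'a \<Rightarrow> real. continuous_on UNIV f \<longrightarrow> (\<forall>y\<in>Y. 0 \<le> f y) \<longrightarrow> (\<forall>x\<in>X. 0 \<le> f x))"

lemma test_setD:
  assumes "test_set Y X"
  shows "countable Y" "Y \<subseteq> X"
    "\<And>f :: 'a::topological_space \<Rightarrow> real. continuous_on UNIV f \<Longrightarrow> (\<And>y. y \<in> Y \<Longrightarrow> 0 \<le> f y) \<Longrightarrow> x \<in> X \<Longrightarrow> 0 \<le> f x"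
  using assms unfolding test_set_def by blast+

section \<open>Countability properties of the manifold\<close>

context compact_Cr_manifold
begin

text \<open>The coordinate functions, padded by zeros. The manifold is only assumed to be compact
  and Hausdorff; an injection into a second countable space supplies the countability arguments
  below.\<close>

lemma embedding:
  obtains \<Phi> :: "'m \<Rightarrow> nat \<Rightarrow> real" where "continuous_on UNIV \<Phi>" "inj \<Phi>"
proof -
  obtain Q where Q: "finite Q" "Q \<subseteq> Cr_functions r A"
    and sep: "\<forall>x y. x \<noteq> y \<longrightarrow> (\<exists>q\<in>Q. q x \<noteq> q y)"
    using coordinate_functions by (elim exE conjE) (rule that)
  obtain e where e: "bij_betw e {..<card Q} Q"
    using ex_bij_betw_nat_finite[OF Q(1)] unfolding lessThan_atLeast0 by blast
  define \<Phi> :: "'m \<Rightarrow> nat \<Rightarrow> real" where "\<Phi> x n = (if n < card Q then e n x else 0)" for x n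
  have "continuous_on UNIV (\<lambda>x. \<Phi> x n)" for n
  proof (cases "n < card Q")
    case True
    then have "e n \<in> Q" using e bij_betwE by blast
    then show ?thesis using Q(2) Cr_functions_continuous True by (auto simp: \<Phi>_def)
  qed (simp add: \<Phi>_def)
  then have \<Phi>c: "continuous_on UNIV \<Phi>" by (rule continuous_on_coordinatewise_then_product)
  have inj: "inj \<Phi>"
  proof (rule injI, rule ccontr)
    fix x y assume xy: "\<Phi> x = \<Phi> y" "x \<noteq> y"
    then obtain q where q: "q \<in> Q" "q x \<noteq> q y" using sep by blast
    then have "q \<in> e ` {..<card Q}" using bij_betw_imp_surj_on[OF e] by simp
    then obtain n where "n < card Q" "e n = q" by auto
    then show False using fun_cong[OF xy(1), of n] q(2) by (simp add: \<Phi>_def)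
  qed
  show ?thesis by (rule that[OF \<Phi>c inj])
qed

text \<open>The image of an open set need not be open in the sequence space. The complement of the
  image of its complement is, since images of compact sets are closed, and by injectivity it pulls
  back to the original set.\<close>

lemma Lindelof_manifold:
  assumes "\<And>y. y \<in> Z \<Longrightarrow> open (W y)" "\<And>y. y \<in> Z \<Longrightarrow> y \<in> W y"
  obtains Y :: "'m set" where "countable Y" "Y \<subseteq> Z" "Z \<subseteq> (\<Union>y\<in>Y. W y)"
proof -
  obtain \<Phi> :: "'m \<Rightarrow> nat \<Rightarrow> real" where \<Phi>c: "continuous_on UNIV \<Phi>" and inj: "inj \<Phi>" by (rule embedding)
  define W' where "W' y = - (\<Phi> ` (- W y))" for y
  have op: "open (W' y)" if "y \<in> Z" for y
  proof -
    have "compact (- W y)" using compact_Int_closed[OF compact_M, of "- W y"] assms(1)[OF that] by (simp add: closed_def)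
    then have "compact (\<Phi> ` (- W y))" using continuous_on_subset[OF \<Phi>c] by (intro compact_continuous_image) auto
    then show ?thesis unfolding W'_def using compact_imp_closed by blast
  qed
  have iff: "\<Phi> x \<in> W' y \<longleftrightarrow> x \<in> W y" for x y by (simp add: W'_def inj_image_mem_iff[OF inj])
  obtain F' where F': "F' \<subseteq> W' ` Z" "countable F'" "\<Union>F' = \<Union>(W' ` Z)"
    using Lindelof[of "W' ` Z"] op by blast
  then obtain Y where Y: "countable Y" "Y \<subseteq> Z" "F' = W' ` Y" by (meson countable_subset_image)
  have "Z \<subseteq> (\<Union>y\<in>Y. W y)"
  proof
    fix x assume "x \<in> Z"
    then have "\<Phi> x \<in> W' x" using iff assms(2) by simp
    then have "\<Phi> x \<in> \<Union>(W' ` Y)" using \<open>x \<in> Z\<close> F'(3) Y(3) by blast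
    then show "x \<in> (\<Union>y\<in>Y. W y)" using iff by blast
  qed
  with Y that show ?thesis by blast
qed

text \<open>A countable dense subset of the image of \<open>X\<close> is pulled back. The points
  with \<open>f\<close> \<ge> 0 form a compact set, so its image is closed, and it contains the
  closure of the dense subset once it contains that subset.\<close>

lemma countable_test_set: "\<exists>Y. test_set Y (X :: 'm set)"
proof -
  obtain \<Phi> :: "'m \<Rightarrow> nat \<Rightarrow> real" where \<Phi>c: "continuous_on UNIV \<Phi>" and inj: "inj \<Phi>" by (rule embedding)
  obtain T where T: "countable T" "T \<subseteq> \<Phi> ` X" "\<Phi> ` X \<subseteq> closure T" using separable by metis
  have "0 \<le> f x" if f: "continuous_on UNIV f" "\<forall>y\<in>X \<inter> \<Phi> -` T. 0 \<le> f y" and x: "x \<in> X" for f :: "'m \<Rightarrow> real" and x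
  proof -
    let ?C = "{x. 0 \<le> f x}"
    have "closed ?C" using f(1) by (intro closed_Collect_le continuous_on_const)
    then have "compact ?C" using compact_Int_closed[OF compact_M, of ?C] by simp
    then have "compact (\<Phi> ` ?C)" using continuous_on_subset[OF \<Phi>c] by (intro compact_continuous_image) auto
    then have "closed (\<Phi> ` ?C)" by (rule compact_imp_closed)
    moreover have "T \<subseteq> \<Phi> ` ?C"
    proof
      fix z assume z: "z \<in> T"
      then obtain y where "y \<in> X" "z = \<Phi> y" using T(2) by blast
      with f(2) z show "z \<in> \<Phi> ` ?C" by simp
    qed
    ultimately have "closure T \<subseteq> \<Phi> ` ?C" by (rule closure_minimal[rotated])
    then have "\<Phi> x \<in> \<Phi> ` ?C" using T(3) x by blast
    then show "0 \<le> f x" by (simp add: inj_image_mem_iff[OF inj])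
  qed
  moreover have "countable (X \<inter> \<Phi> -` T)"
    by (rule countable_image_inj_Int_vimage[OF inj_on_subset[OF inj subset_UNIV] T(1)])
  ultimately have "test_set (X \<inter> \<Phi> -` T) X" unfolding test_set_def by simp
  then show ?thesis ..
qed

end

section \<open>Predictable points of delay-coordinate maps\<close>

locale delay_setting = riemannian_manifold B r A g
  for B :: "'e::real_normed_vector set" and r :: enat and A :: "('m::t2_space, 'e) chart set" and g +
  fixes T :: "'m \<Rightarrow> 'm" and X :: "'m set" and k :: nat
  assumes T: "Cr_diffeomorphism r A T" and X: "compact X"
    and hausdorff: "hausdorff_measure (riemannian_dist A g) k X = 0"
    and dim_le: "card B \<le> k" and k_pos: "0 < k"
begin

lemma bij_T: "bij T" and Cr_T: "Cr_map r A T" and Cr_inv_T: "Cr_map r A (inv T)"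
  using T unfolding Cr_diffeomorphism_def by auto

lemma bij_iter: "bij (T ^^ n)"
  using bij_T by (rule bij_fn)

lemma continuous_T: "continuous_on UNIV T"
  using Cr_T unfolding Cr_map_def by blast

lemma continuous_iter: "continuous_on UNIV (T ^^ n)"
proof (induction n)
  case (Suc n)
  then show ?case using continuous_on_compose[OF Suc, of T] continuous_on_subset[OF continuous_T] by simp
qed (simp add: continuous_on_id id_def)

lemma Cr_functions_1_iter: "f \<in> Cr_functions 1 A \<Longrightarrow> (\<lambda>x. f ((T ^^ n) x)) \<in> Cr_functions 1 A"
proof (induction n arbitrary: f)
  case (Suc n)
  from Suc.IH[OF Cr_functions_1_compose[OF Cr_T Suc.prems]] show ?case by simp
qed simp

lemma Cr_functions_1_inv_iter: "f \<in> Cr_functions 1 A \<Longrightarrow> (\<lambda>x. f ((inv T ^^ n) x)) \<in> Cr_functions 1 A"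
proof (induction n arbitrary: f)
  case (Suc n)
  from Suc.IH[OF Cr_functions_1_compose[OF Cr_inv_T Suc.prems]] show ?case by simp
qed simp

lemma inv_iter: "(inv T ^^ n) ((T ^^ n) x) = x"
  using bij_T by (induction n arbitrary: x) (simp_all add: funpow_swap1 bij_is_inj)

lemma zero_deriv_iter: "zero_deriv f ((T ^^ n) x) \<Longrightarrow> zero_deriv (\<lambda>x. f ((T ^^ n) x)) x"
proof (induction n arbitrary: f)
  case (Suc n)
  from Suc.IH[OF zero_deriv_compose[OF Cr_T]] Suc.prems show ?case by simp
qed simp

lemma orbit_inj:
  assumes "\<And>p. 1 \<le> p \<Longrightarrow> p < k \<Longrightarrow> (T ^^ p) x \<noteq> x"
  shows "inj_on (\<lambda>i. (T ^^ i) x) {..<k}"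
proof -
  have neq: "(T ^^ i) x \<noteq> (T ^^ j) x" if "i < j" "j < k" for i j
  proof
    assume e: "(T ^^ i) x = (T ^^ j) x"
    have "(T ^^ j) x = (T ^^ i) ((T ^^ (j - i)) x)"
      using that(1) funpow_add[of i "j - i" T] by (simp add: comp_def)
    then have "x = (T ^^ (j - i)) x" using e bij_is_inj[OF bij_iter[of i]] by (simp add: inj_eq)
    moreover have "(T ^^ (j - i)) x \<noteq> x" using that by (intro assms) auto
    ultimately show False by metis
  qed
  show ?thesis
  proof (rule inj_onI)
    fix i j assume "i \<in> {..<k}" "j \<in> {..<k}" "(T ^^ i) x = (T ^^ j) x"
    then show "i = j" using neq[of i j] neq[of j i] by (cases i j rule: linorder_cases) auto
  qed
qed

text \<open>The l1-distance of the delay vectors of \<open>x\<close> and \<open>y\<close>, written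
  without the index type of these vectors. Passing to the Euclidean norm only changes
  constants.\<close>

definition delay_dist :: "('m \<Rightarrow> real) \<Rightarrow> 'm \<Rightarrow> 'm \<Rightarrow> real" where
  "delay_dist h x y = (\<Sum>i<k. \<bar>h ((T ^^ i) x) - h ((T ^^ i) y)\<bar>)"

text \<open>A Lipschitz condition at the single point \<open>x\<close> for the relation between a
  delay vector and its successor. The constant is a natural number so that the quantifier is
  countable.\<close>

definition predictable :: "('m \<Rightarrow> real) \<Rightarrow> 'm \<Rightarrow> bool" where
  "predictable h x \<longleftrightarrow> (\<exists>n::nat. \<forall>y\<in>X. delay_dist h (T x) (T y) \<le> real n * delay_dist h x y)"

lemma delay_dist_nonneg: "0 \<le> delay_dist h x y"
  by (simp add: delay_dist_def sum_nonneg)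

lemma delay_dist_eq_0: "delay_dist h x y = 0 \<longleftrightarrow> (\<forall>i<k. h ((T ^^ i) x) = h ((T ^^ i) y))"
  by (auto simp: delay_dist_def sum_nonneg_eq_0_iff)

lemma continuous_delay_dist: "continuous_on UNIV h \<Longrightarrow> continuous_on UNIV (delay_dist h x)"
  unfolding delay_dist_def[abs_def]
  by (intro continuous_intros continuous_on_compose2[OF _ continuous_iter]) auto

lemma continuous_delay_dist_T:
  assumes "continuous_on UNIV h" shows "continuous_on UNIV (\<lambda>y. delay_dist h x (T y))"
  by (rule continuous_on_compose2[OF continuous_delay_dist[OF assms] continuous_T]) auto

text \<open>Near \<open>x\<close> both distances are comparable to first order with the displacement
  in the chart: the immersion bounds one from below, differentiability bounds the other from above.
  Off this neighbourhood \<open>delay_dist h x\<close> has a positive minimum on the compact set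
  \<open>X\<close>, and the other distance is bounded.\<close>

lemma predictable_if_injective_immersion:
  assumes h: "h \<in> Cr_functions 1 A"
    and inj: "\<And>y. y \<in> X \<Longrightarrow> y \<noteq> x \<Longrightarrow> delay_dist h x y \<noteq> 0"
    and V: "(V, \<psi>) \<in> A" "x \<in> V"
    and imm: "\<And>u. (\<And>i. i < k \<Longrightarrow> frechet_derivative ((\<lambda>y. h ((T ^^ i) y)) \<circ> inv_into V \<psi>) (at (\<psi> x)) u = 0) \<Longrightarrow> u = 0"
  shows "predictable h x"
proof -
  define F where "F i = (\<lambda>y. h ((T ^^ i) y)) \<circ> inv_into V \<psi>" for i
  define D where "D i = frechet_derivative (F i) (at (\<psi> x))" for i
  have FD: "(F i has_derivative D i) (at (\<psi> x))" for i
    unfolding D_def F_def using Cr_functions_differentiable[OF Cr_functions_1_iter[OF h] V]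
    by (rule iffD1[OF frechet_derivative_works])
  obtain c where c: "c > 0" "\<And>u. c * norm u \<le> (\<Sum>i<k. \<bar>D i u\<bar>)"
    by (rule family_bounded_below[of "{..<k}" D])
      (use has_derivative_linear[OF FD] imm in \<open>auto simp: D_def F_def\<close>)
  have "\<forall>i. \<exists>K. \<forall>u. norm (D i u) \<le> norm u * K"
    using bounded_linear.bounded[OF has_derivative_bounded_linear[OF FD]] by blast
  then obtain K where K: "\<And>i u. norm (D i u) \<le> norm u * K i" by metis
  \<comment> \<open>The \<open>k\<close> errors of the linear approximation together then consume
    half of the lower bound \<open>c\<close>.\<close>
  define \<epsilon> where "\<epsilon> = c / (2 * real k)"
  have \<epsilon>: "\<epsilon> > 0" using c(1) k_pos by (simp add: \<epsilon>_def)
  have "\<exists>d>0. \<forall>z. norm (z - \<psi> x) < d \<longrightarrow> norm (F i z - F i (\<psi> x) - D i (z - \<psi> x)) \<le> \<epsilon> * norm (z - \<psi> x)" for i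
    using FD[of i] \<epsilon> unfolding has_derivative_at_alt by blast
  then obtain d where d: "\<And>i. d i > 0"
    "\<And>i z. norm (z - \<psi> x) < d i \<Longrightarrow> norm (F i z - F i (\<psi> x) - D i (z - \<psi> x)) \<le> \<epsilon> * norm (z - \<psi> x)" by metis
  \<comment> \<open>The index \<open>k\<close> is included because the delay vector of
    \<open>T y\<close> involves the k-th iterate of \<open>y\<close>.\<close>
  define \<delta> where "\<delta> = Min (d ` {..k})"
  have \<delta>: "\<delta> > 0" "\<And>i. i \<le> k \<Longrightarrow> \<delta> \<le> d i" using d(1) by (auto simp: \<delta>_def Min_gr_iff)
  define C where "C = (\<Sum>i<k. \<epsilon> + \<bar>K (Suc i)\<bar>)"
  have C: "C \<ge> 0" unfolding C_def using \<epsilon> by (intro sum_nonneg) auto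
  have Fx: "F i (\<psi> y) = h ((T ^^ i) y)" if "y \<in> V" for i y
    using inv_chart[OF V(1) that] by (simp add: F_def)
  have lower: "c / 2 * norm (\<psi> y - \<psi> x) \<le> delay_dist h x y"
    and upper: "delay_dist h (T x) (T y) \<le> C * norm (\<psi> y - \<psi> x)"
    if y: "y \<in> V" "norm (\<psi> y - \<psi> x) < \<delta>" for y
  proof -
    let ?u = "\<psi> y - \<psi> x"
    have ap: "\<bar>h ((T ^^ i) y) - h ((T ^^ i) x) - D i ?u\<bar> \<le> \<epsilon> * norm ?u" if "i \<le> k" for i
      using d(2)[of "\<psi> y" i] \<delta>(2)[OF that] y Fx[OF y(1)] Fx[OF V(2)] by simp
    have "c * norm ?u \<le> (\<Sum>i<k. \<bar>D i ?u\<bar>)" by (rule c(2))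
    also have "\<dots> \<le> (\<Sum>i<k. \<bar>h ((T ^^ i) x) - h ((T ^^ i) y)\<bar> + \<epsilon> * norm ?u)"
    proof (intro sum_mono)
      fix i assume "i \<in> {..<k}"
      then have "\<bar>h ((T ^^ i) y) - h ((T ^^ i) x) - D i ?u\<bar> \<le> \<epsilon> * norm ?u" by (intro ap) auto
      then show "\<bar>D i ?u\<bar> \<le> \<bar>h ((T ^^ i) x) - h ((T ^^ i) y)\<bar> + \<epsilon> * norm ?u" by linarith
    qed
    also have "\<dots> = delay_dist h x y + c / 2 * norm ?u"
      using k_pos by (simp add: sum.distrib delay_dist_def \<epsilon>_def)
    finally show "c / 2 * norm ?u \<le> delay_dist h x y" by simp
    have "delay_dist h (T x) (T y) = (\<Sum>i<k. \<bar>h ((T ^^ Suc i) x) - h ((T ^^ Suc i) y)\<bar>)"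
      by (simp add: delay_dist_def funpow_swap1)
    also have "\<dots> \<le> (\<Sum>i<k. (\<epsilon> + \<bar>K (Suc i)\<bar>) * norm ?u)"
    proof (intro sum_mono)
      fix i assume "i \<in> {..<k}"
      then have a: "\<bar>h ((T ^^ Suc i) y) - h ((T ^^ Suc i) x) - D (Suc i) ?u\<bar> \<le> \<epsilon> * norm ?u" by (intro ap) auto
      have "\<bar>D (Suc i) ?u\<bar> \<le> norm ?u * K (Suc i)" using K[of "Suc i" ?u] by simp
      also have "\<dots> \<le> norm ?u * \<bar>K (Suc i)\<bar>" by (intro mult_left_mono) auto
      finally have "\<bar>D (Suc i) ?u\<bar> \<le> \<bar>K (Suc i)\<bar> * norm ?u" by (simp add: mult.commute)
      with a show "\<bar>h ((T ^^ Suc i) x) - h ((T ^^ Suc i) y)\<bar> \<le> (\<epsilon> + \<bar>K (Suc i)\<bar>) * norm ?u"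
        unfolding distrib_right by linarith
    qed
    finally show "delay_dist h (T x) (T y) \<le> C * norm ?u" by (simp add: C_def sum_distrib_right)
  qed
  define O' where "O' = \<psi> -` ball (\<psi> x) \<delta> \<inter> V"
  have O': "open O'" unfolding O'_def
    using continuous_on_chart[OF V(1)] by (simp add: continuous_on_open_vimage[OF open_chart[OF V(1)]])
  have hc: "continuous_on UNIV h" by (rule Cr_functions_continuous[OF h])
  have "\<exists>s>0. \<forall>y\<in>X - O'. s \<le> delay_dist h x y"
  proof (cases "X - O' = {}")
    case False
    have "compact (X - O')" using X O' by (rule compact_diff)
    then obtain y0 where y0: "y0 \<in> X - O'" "\<And>y. y \<in> X - O' \<Longrightarrow> delay_dist h x y0 \<le> delay_dist h x y"
      using continuous_attains_inf[OF _ False continuous_on_subset[OF continuous_delay_dist[OF hc, of x] subset_UNIV]]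
      by blast
    have "y0 \<noteq> x" using y0(1) V(2) \<delta>(1) by (auto simp: O'_def)
    then have "delay_dist h x y0 > 0" using inj[of y0] y0(1) delay_dist_nonneg[of h x y0] by auto
    with y0(2) show ?thesis by blast
  qed (auto intro: exI[of _ 1])
  then obtain s where s: "s > 0" "\<And>y. y \<in> X - O' \<Longrightarrow> s \<le> delay_dist h x y" by blast
  obtain Kh where Kh: "\<And>x. \<bar>h x\<bar> \<le> Kh" using Cr_functions_bounded[OF h] by blast
  have Kh0: "Kh \<ge> 0" using Kh[of x] by linarith
  define M where "M = real k * (2 * Kh)"
  have M: "delay_dist h z z' \<le> M" for z z'
  proof -
    have "delay_dist h z z' \<le> (\<Sum>i<k. 2 * Kh)" unfolding delay_dist_def
    proof (intro sum_mono)
      fix i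
      show "\<bar>h ((T ^^ i) z) - h ((T ^^ i) z')\<bar> \<le> 2 * Kh"
        using Kh[of "(T ^^ i) z"] Kh[of "(T ^^ i) z'"] by linarith
    qed
    then show ?thesis by (simp add: M_def)
  qed
  have M0: "M \<ge> 0" using Kh0 by (simp add: M_def)
  obtain n :: nat where n: "2 * C / c + M / s \<le> real n" using real_arch_simple by blast
  have nC: "2 * C / c \<le> real n" and nM: "M / s \<le> real n"
    using n C M0 c(1) s(1) by (smt (verit) divide_nonneg_pos mult_nonneg_nonneg)+
  have "delay_dist h (T x) (T y) \<le> real n * delay_dist h x y" if y: "y \<in> X" for y
  proof (cases "y \<in> O'")
    case True
    then have y': "y \<in> V" "norm (\<psi> y - \<psi> x) < \<delta>" by (auto simp: O'_def dist_norm norm_minus_commute)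
    have "delay_dist h (T x) (T y) \<le> (2 * C / c) * (c / 2 * norm (\<psi> y - \<psi> x))"
      using upper[OF y'] c(1) by simp
    also have "\<dots> \<le> real n * delay_dist h x y"
      using nC lower[OF y'] c(1) by (intro mult_mono) auto
    finally show ?thesis .
  next
    case False
    have "delay_dist h (T x) (T y) \<le> (M / s) * s" using M s(1) by simp
    also have "\<dots> \<le> real n * delay_dist h x y"
      using nM s y False by (intro mult_mono) auto
    finally show ?thesis .
  qed
  then show ?thesis unfolding predictable_def by blast
qed

lemma Lipschitz_family:
  assumes "finite I" "\<And>i. i \<in> I \<Longrightarrow> f i \<in> Cr_functions 1 A"
  obtains L where "L > 0"
    "\<And>i x y. i \<in> I \<Longrightarrow> riemannian_dist A g x y < 1 \<Longrightarrow> \<bar>f i x - f i y\<bar> \<le> L * riemannian_dist A g x y"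
proof -
  have d0: "0 \<le> riemannian_dist A g x y" for x y by (simp add: riemannian_dist_def)
  have "\<forall>i\<in>I. \<exists>L>0. \<forall>x y. riemannian_dist A g x y < 1 \<longrightarrow> \<bar>f i x - f i y\<bar> \<le> L * riemannian_dist A g x y"
  proof
    fix i assume "i \<in> I"
    obtain L where "L > 0" "\<And>x y. riemannian_dist A g x y < 1 \<Longrightarrow> \<bar>f i x - f i y\<bar> \<le> L * riemannian_dist A g x y"
      using Lipschitz_riemannian_dist[OF assms(2)[OF \<open>i \<in> I\<close>]] by metis
    then show "\<exists>L>0. \<forall>x y. riemannian_dist A g x y < 1 \<longrightarrow> \<bar>f i x - f i y\<bar> \<le> L * riemannian_dist A g x y" by blast
  qed
  from bchoice[OF this] obtain L where
    L: "\<And>i x y. i \<in> I \<Longrightarrow> riemannian_dist A g x y < 1 \<Longrightarrow> \<bar>f i x - f i y\<bar> \<le> L i * riemannian_dist A g x y"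
    by blast
  define M where "M = (\<Sum>i\<in>I. \<bar>L i\<bar>) + 1"
  have LM: "L i \<le> M" if "i \<in> I" for i
    using member_le_sum[of i I "\<lambda>i. \<bar>L i\<bar>"] assms(1) that by (simp add: M_def)
  have "M > 0" unfolding M_def by (intro add_nonneg_pos sum_nonneg) auto
  moreover have "\<bar>f i x - f i y\<bar> \<le> M * riemannian_dist A g x y" if "i \<in> I" "riemannian_dist A g x y < 1" for i x y
    using L[OF that] mult_right_mono[OF LM[OF that(1)] d0[of x y]] by linarith
  ultimately show ?thesis using that by blast
qed

text \<open>By compactness a zero on \<open>Z\<close> exists as soon as arbitrarily small values do,
  and strict inequalities can be tested on \<open>Y\<close>. It makes the set of parameters with a
  collision measurable.\<close>

lemma delay_dist_pos_countable:
  assumes Y: "test_set Y Z"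
    and Z: "compact Z" and h: "continuous_on UNIV h"
  shows "(\<exists>y\<in>Z. delay_dist h x y = 0) \<longleftrightarrow> (\<forall>m::nat. \<exists>y\<in>Y. delay_dist h x y < 1 / real (Suc m))"
proof
  assume "\<exists>y\<in>Z. delay_dist h x y = 0"
  then obtain z where z: "z \<in> Z" "delay_dist h x z = 0" by blast
  show "\<forall>m::nat. \<exists>y\<in>Y. delay_dist h x y < 1 / real (Suc m)"
  proof (rule allI, rule ccontr)
    fix m assume "\<not> (\<exists>y\<in>Y. delay_dist h x y < 1 / real (Suc m))"
    then have "0 \<le> delay_dist h x z - 1 / real (Suc m)"
      using test_setD(3)[OF Y, of "\<lambda>y. delay_dist h x y - 1 / real (Suc m)" z] z(1) continuous_delay_dist[OF h]
      by (fastforce intro!: continuous_intros)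
    then have "1 / real (Suc m) \<le> 0" using z(2) by simp
    then show False by simp
  qed
next
  assume R: "\<forall>m::nat. \<exists>y\<in>Y. delay_dist h x y < 1 / real (Suc m)"
  then have "Z \<noteq> {}" using test_setD(2)[OF Y] by blast
  then obtain z where z: "z \<in> Z" "\<And>y. y \<in> Z \<Longrightarrow> delay_dist h x z \<le> delay_dist h x y"
    using continuous_attains_inf[OF Z _ continuous_on_subset[OF continuous_delay_dist[OF h, of x] subset_UNIV]] by blast
  have "delay_dist h x z = 0"
  proof (rule ccontr)
    assume "delay_dist h x z \<noteq> 0"
    then have "delay_dist h x z > 0" using delay_dist_nonneg[of h x z] by linarith
    then obtain m where "1 / real (Suc m) < delay_dist h x z" using nat_approx_posE by blast
    moreover obtain y where "y \<in> Y" "delay_dist h x y < 1 / real (Suc m)" using R by blast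
    ultimately show False using z(2)[of y] test_setD(2)[OF Y] by auto
  qed
  with z(1) show "\<exists>y\<in>Z. delay_dist h x y = 0" by blast
qed

lemma predictable_countable:
  assumes Y: "test_set Y X"
    and h: "continuous_on UNIV h"
  shows "predictable h x \<longleftrightarrow> (\<exists>n::nat. \<forall>y\<in>Y. delay_dist h (T x) (T y) \<le> real n * delay_dist h x y)"
proof
  assume "\<exists>n::nat. \<forall>y\<in>Y. delay_dist h (T x) (T y) \<le> real n * delay_dist h x y"
  then obtain n where n: "\<And>y. y \<in> Y \<Longrightarrow> delay_dist h (T x) (T y) \<le> real n * delay_dist h x y" by blast
  have "0 \<le> real n * delay_dist h x y - delay_dist h (T x) (T y)" if "y \<in> X" for y
    by (rule test_setD(3)[OF Y _ _ that])
      (use n in \<open>auto intro!: continuous_intros continuous_delay_dist h continuous_delay_dist_T\<close>)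
  then show "predictable h x" unfolding predictable_def by fastforce
qed (use test_setD(2)[OF Y] in \<open>auto simp: predictable_def\<close>)

end

section \<open>Almost every perturbation makes a given point predictable\<close>

locale probe_setting = delay_setting B r A g T X k
  for B :: "'e::real_normed_vector set" and r :: enat and A :: "('m::t2_space, 'e) chart set" and g
    and T :: "'m \<Rightarrow> 'm" and X :: "'m set" and k :: nat +
  fixes N :: nat and hs :: "nat \<Rightarrow> 'm \<Rightarrow> real"
  assumes probe_Cr: "hs n \<in> Cr_functions r A"
    and probe_value: "finite Z \<Longrightarrow> card Z \<le> 2 * k \<Longrightarrow> z \<notin> Z \<Longrightarrow>
       \<exists>c. lincomb N hs c z = 1 \<and> (\<forall>w\<in>Z. lincomb N hs c w = 0)"
    and probe_deriv: "finite Z \<Longrightarrow> card Z \<le> 2 * k \<Longrightarrow> z \<notin> Z \<Longrightarrow> f \<in> Cr_functions 1 A \<Longrightarrow>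
       \<exists>c. zero_deriv (\<lambda>x. lincomb N hs c x - f x) z \<and> (\<forall>w\<in>Z. zero_deriv (lincomb N hs c) w)"
begin

abbreviation param :: "(nat \<Rightarrow> real) measure" where
  "param \<equiv> PiM {..<N} (\<lambda>_. lborel)"

definition perturb :: "('m \<Rightarrow> real) \<Rightarrow> (nat \<Rightarrow> real) \<Rightarrow> 'm \<Rightarrow> real" where
  "perturb v \<alpha> x = v x + lincomb N hs \<alpha> x"

lemma perturb_shift: "perturb v (\<lambda>n\<in>{..<N}. \<alpha> n + \<beta> n) x = perturb v \<alpha> x + lincomb N hs \<beta> x"
  by (simp add: perturb_def lincomb_restrict lincomb_add)

lemma perturb_Cr_functions: "v \<in> Cr_functions r A \<Longrightarrow> perturb v \<alpha> \<in> Cr_functions r A"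
  unfolding perturb_def[abs_def] by (intro Cr_functions_add lincomb_Cr_functions probe_Cr)

lemma lincomb_Cr_functions_1: "lincomb N hs c \<in> Cr_functions 1 A"
  by (intro lincomb_Cr_functions Cr_functions_1 probe_Cr)

lemma measurable_perturb: "(\<lambda>\<alpha>. perturb v \<alpha> x) \<in> borel_measurable param"
  unfolding perturb_def lincomb_def
proof (intro borel_measurable_add borel_measurable_const borel_measurable_sum borel_measurable_times)
  fix n assume "n \<in> {..<N}"
  from measurable_component_singleton[OF this, of "\<lambda>_. lborel :: real measure"]
  show "(\<lambda>\<alpha>. \<alpha> n) \<in> borel_measurable param" by simp
qed

lemma measurable_delay_dist: "(\<lambda>\<alpha>. delay_dist (perturb v \<alpha>) x y) \<in> borel_measurable param"
  unfolding delay_dist_def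
  by (intro borel_measurable_sum borel_measurable_abs borel_measurable_diff measurable_perturb)

text \<open>Along a perturbation with value 1 at \<open>x\<close> and 0 at \<open>y\<close>, exactly
  one \<open>t\<close> makes the two values equal.\<close>

lemma null_collision:
  assumes "x \<noteq> y" shows "{\<alpha> \<in> space param. perturb v \<alpha> x = perturb v \<alpha> y} \<in> null_sets param"
proof -
  obtain c where c: "lincomb N hs c x = 1" "lincomb N hs c y = 0"
    using probe_value[of "{y}" x] assms k_pos by auto
  show ?thesis
  proof (rule null_if_null_shifts[where l = "\<lambda>(t::real) n. t * c n"])
    show "{\<alpha> \<in> space param. perturb v \<alpha> x = perturb v \<alpha> y} \<in> sets param"
      by (intro borel_measurable_eq measurable_perturb)
    fix \<alpha> :: "nat \<Rightarrow> real"
    have "AE t in lborel. t \<noteq> perturb v \<alpha> y - perturb v \<alpha> x" by (rule AE_lborel_singleton)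
    then show "AE t in lborel. (\<lambda>n\<in>{..<N}. \<alpha> n + t * c n) \<notin> {\<alpha> \<in> space param. perturb v \<alpha> x = perturb v \<alpha> y}"
      by eventually_elim (auto simp: perturb_shift lincomb_cmult c)
  qed simp
qed

text \<open>Perturbing in \<open>k\<close> directions that are dual to the evaluations along the orbit of \<open>x\<close> and small along
  that of \<open>y\<close>, the colliding parameters are a Lipschitz function of the point collided with.\<close>

lemma null_collisions_near:
  assumes card: "CARD('k::finite) = k" and v: "v \<in> Cr_functions r A"
    and x: "inj_on (\<lambda>i. (T ^^ i) x) {..<k}"
    and y0: "\<And>i j. i < k \<Longrightarrow> j < k \<Longrightarrow> (T ^^ i) x \<noteq> (T ^^ j) y0"
  shows "\<exists>W. open W \<and> y0 \<in> W \<and>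
    (\<exists>P\<in>null_sets param. \<forall>\<alpha>\<in>space param. \<forall>y\<in>X \<inter> W. delay_dist (perturb v \<alpha>) x y = 0 \<longrightarrow> \<alpha> \<in> P)"
proof -
  \<comment> \<open>The number of prescribed zeros is at most (k - 1) + k, within the capacity 2k of
    the probe functions.\<close>
  have "\<exists>c. lincomb N hs c ((T ^^ l) x) = 1 \<and>
     (\<forall>w\<in>(\<lambda>i. (T ^^ i) x) ` ({..<k} - {l}) \<union> (\<lambda>j. (T ^^ j) y0) ` {..<k}. lincomb N hs c w = 0)" if l: "l < k" for l
  proof (rule probe_value)
    have "card ((\<lambda>i. (T ^^ i) x) ` ({..<k} - {l}) \<union> (\<lambda>j. (T ^^ j) y0) ` {..<k}) \<le>
        card ((\<lambda>i. (T ^^ i) x) ` ({..<k} - {l})) + card ((\<lambda>j. (T ^^ j) y0) ` {..<k})"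
      by (rule card_Un_le)
    also have "\<dots> \<le> card ({..<k} - {l}) + card {..<k}" by (intro add_mono card_image_le) auto
    also have "\<dots> \<le> 2 * k" using card_mono[of "{..<k}" "{..<k} - {l}"] by simp
    finally show "card ((\<lambda>i. (T ^^ i) x) ` ({..<k} - {l}) \<union> (\<lambda>j. (T ^^ j) y0) ` {..<k}) \<le> 2 * k" .
    show "(T ^^ l) x \<notin> (\<lambda>i. (T ^^ i) x) ` ({..<k} - {l}) \<union> (\<lambda>j. (T ^^ j) y0) ` {..<k}"
      using inj_onD[OF x, of l] l y0[OF l] by auto
  qed simp
  then have "\<forall>l\<in>{..<k}. \<exists>c. lincomb N hs c ((T ^^ l) x) = 1 \<and>
     (\<forall>w\<in>(\<lambda>i. (T ^^ i) x) ` ({..<k} - {l}) \<union> (\<lambda>j. (T ^^ j) y0) ` {..<k}. lincomb N hs c w = 0)" by blast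
  from bchoice[OF this] obtain c where c: "\<And>l. l < k \<Longrightarrow> lincomb N hs (c l) ((T ^^ l) x) = 1"
    "\<And>l w. l < k \<Longrightarrow> w \<in> (\<lambda>i. (T ^^ i) x) ` ({..<k} - {l}) \<union> (\<lambda>j. (T ^^ j) y0) ` {..<k} \<Longrightarrow> lincomb N hs (c l) w = 0"
    by (metis lessThan_iff)
  define p where "p l = lincomb N hs (c l)" for l
  have pC: "p l \<in> Cr_functions 1 A" for l unfolding p_def by (rule lincomb_Cr_functions_1)
  have px: "p l ((T ^^ i) x) = (if i = l then 1 else 0)" if "l < k" "i < k" for l i
    using c(1)[OF that(1)] c(2)[OF that(1), of "(T ^^ i) x"] that(2) by (auto simp: p_def)
  have py: "p l ((T ^^ j) y0) = 0" if "l < k" "j < k" for l j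
    using c(2)[OF that(1), of "(T ^^ j) y0"] that(2) by (auto simp: p_def)
  have pc: "continuous_on UNIV (\<lambda>y. p l ((T ^^ j) y))" for l j
    by (rule Cr_functions_continuous[OF Cr_functions_1_iter[OF pC]])
  \<comment> \<open>Summed over \<open>k\<close> coordinates, terms of relative size \<eta>
    contribute a factor 1/2, which can be absorbed.\<close>
  define \<eta> where "\<eta> = 1 / (2 * real k)"
  have \<eta>: "\<eta> > 0" using k_pos by (simp add: \<eta>_def)
  define W where "W = (\<Inter>(l, j)\<in>{..<k} \<times> {..<k}. {y. \<bar>p l ((T ^^ j) y)\<bar> < \<eta>})"
  \<comment> \<open>The closed variant of \<open>W\<close>: its compactness gives the measurability
    of \<open>P\<close>.\<close>
  define Z where "Z = X \<inter> (\<Inter>(l, j)\<in>{..<k} \<times> {..<k}. {y. \<bar>p l ((T ^^ j) y)\<bar> \<le> \<eta>})"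
  have W: "open W" unfolding W_def
    by (intro open_INT) (auto intro!: open_Collect_less continuous_intros pc)
  have yW: "y0 \<in> W" using py \<eta> by (auto simp: W_def)
  have "closed (\<Inter>(l, j)\<in>{..<k} \<times> {..<k}. {y. \<bar>p l ((T ^^ j) y)\<bar> \<le> \<eta>})"
    by (intro closed_INT) (auto intro!: closed_Collect_le continuous_intros pc)
  then have Z: "compact Z" unfolding Z_def by (rule compact_Int_closed[OF X])
  have WZ: "X \<inter> W \<subseteq> Z" unfolding W_def Z_def by (auto simp: less_imp_le)
  have pZ: "\<bar>p l ((T ^^ j) y)\<bar> \<le> \<eta>" if "y \<in> Z" "l < k" "j < k" for y l j
    using that by (auto simp: Z_def)
  have hc: "continuous_on UNIV (perturb v \<alpha>)" for \<alpha>
    by (rule Cr_functions_continuous[OF perturb_Cr_functions[OF v]])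
  obtain Y where Y: "test_set Y Z" using countable_test_set by blast
  define P where "P = {\<alpha> \<in> space param. \<exists>y\<in>Z. delay_dist (perturb v \<alpha>) x y = 0}"
  have "P \<in> null_sets param"
  proof -
    obtain e :: "'k \<Rightarrow> nat" where e: "bij_betw e UNIV {..<k}"
      using ex_bij_betw_finite_nat[of "UNIV :: 'k set"] card by (auto simp: lessThan_atLeast0)
    have ek: "e j < k" for j using bij_betwE[OF e] by auto
    have e_inj: "e i = e j \<longleftrightarrow> i = j" for i j using bij_betw_imp_inj_on[OF e] by (simp add: inj_eq)
    define l where "l t n = (\<Sum>j\<in>UNIV. t $ j * c (e j) n)" for t :: "real ^ 'k" and n
    have l: "lincomb N hs (l t) z = (\<Sum>j\<in>UNIV. t $ j * p (e j) z)" for t z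
      unfolding l_def p_def by (simp add: lincomb_sum lincomb_cmult)
    show ?thesis
    proof (rule null_if_null_shifts[where l = l])
      have "P = {\<alpha> \<in> space param. \<forall>m::nat. \<exists>y\<in>Y. delay_dist (perturb v \<alpha>) x y < 1 / real (Suc m)}"
        unfolding P_def using delay_dist_pos_countable[OF Y Z hc] by blast
      also have "\<dots> \<in> sets param"
        by (intro sets.sets_Collect_countable_All sets.sets_Collect_countable_Ex'[OF _ test_setD(1)[OF Y]]
            borel_measurable_less measurable_delay_dist borel_measurable_const)
      finally show Pm: "P \<in> sets param" .
      show lm: "(\<lambda>t. l t n) \<in> borel_measurable borel" for n
        unfolding l_def by (intro borel_measurable_continuous_onI continuous_intros)
      fix \<alpha> :: "nat \<Rightarrow> real"
      let ?s = "\<lambda>t. \<lambda>n\<in>{..<N}. \<alpha> n + l t n"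
      let ?h = "perturb v \<alpha>"
      define E where "E = {t. ?s t \<in> P}"
      have "?s \<in> measurable borel param"
        using lm by (intro measurable_restrict) (auto intro!: borel_measurable_add)
      then have Em: "E \<in> sets borel" using measurable_sets[of ?s borel param P] Pm by (simp add: E_def vimage_def)
      define R where "R t y \<longleftrightarrow> y \<in> Z \<and> (\<forall>i<k. perturb v (?s t) ((T ^^ i) x) = perturb v (?s t) ((T ^^ i) y))" for t y
      \<comment> \<open>The collision equations solved for \<open>t\<close>. By duality the sum at
        the iterate of \<open>x\<close> is the single coordinate of \<open>t\<close>, which leaves a
        fixed point equation with contraction factor 1/2 in the l1-norm.\<close>
      have R_eq: "t $ j = ?h ((T ^^ e j) y) - ?h ((T ^^ e j) x) + (\<Sum>i\<in>UNIV. t $ i * p (e i) ((T ^^ e j) y))"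
        if "R t y" for t y j
      proof -
        have "(\<Sum>i\<in>UNIV. t $ i * p (e i) ((T ^^ e j) x)) = (\<Sum>i\<in>UNIV. if i = j then t $ j else 0)"
          using px[OF ek ek] by (intro sum.cong) (auto simp: e_inj)
        also have "\<dots> = t $ j" by simp
        finally have "(\<Sum>i\<in>UNIV. t $ i * p (e i) ((T ^^ e j) x)) = t $ j" .
        moreover have "perturb v (?s t) ((T ^^ e j) x) = perturb v (?s t) ((T ^^ e j) y)"
          using that ek[of j] unfolding R_def by blast
        ultimately show ?thesis unfolding perturb_shift l by linarith
      qed
      obtain K where K: "\<And>z. \<bar>?h z\<bar> \<le> K" using Cr_functions_bounded[OF perturb_Cr_functions[OF v]] by blast
      obtain L1 where L1: "L1 > 0" "\<And>i y y'. i \<in> {..<k} \<Longrightarrow> riemannian_dist A g y y' < 1 \<Longrightarrow>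
          \<bar>?h ((T ^^ i) y) - ?h ((T ^^ i) y')\<bar> \<le> L1 * riemannian_dist A g y y'"
        by (rule Lipschitz_family[of "{..<k}" "\<lambda>i y. ?h ((T ^^ i) y)"])
          (use Cr_functions_1_iter[OF Cr_functions_1[OF perturb_Cr_functions[OF v]]] in auto)
      obtain L2 where L2: "L2 > 0" "\<And>i y y'. i \<in> {..<k} \<times> {..<k} \<Longrightarrow> riemannian_dist A g y y' < 1 \<Longrightarrow>
          \<bar>p (fst i) ((T ^^ snd i) y) - p (fst i) ((T ^^ snd i) y')\<bar> \<le> L2 * riemannian_dist A g y y'"
        by (rule Lipschitz_family[of "{..<k} \<times> {..<k}" "\<lambda>i y. p (fst i) ((T ^^ snd i) y)"])
          (auto intro!: Cr_functions_1_iter pC)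
      let ?n1 = "\<lambda>t::real^'k. \<Sum>j\<in>UNIV. \<bar>t $ j\<bar>"
      have half: "(\<Sum>j\<in>(UNIV :: 'k set). u + ?n1 t * \<eta>) = real k * u + ?n1 t / 2" for u and t :: "real^'k"
        using k_pos card by (simp add: \<eta>_def distrib_left)
      \<comment> \<open>An a priori bound from the fixed point equation: |t| is at most 2kK +
        |t|/2.\<close>
      have n1_le: "?n1 t \<le> 4 * real k * K" if "R t y" for t y
      proof -
        have "\<bar>t $ j\<bar> \<le> 2 * K + ?n1 t * \<eta>" for j
        proof -
          have "\<bar>\<Sum>i\<in>UNIV. t $ i * p (e i) ((T ^^ e j) y)\<bar> \<le> (\<Sum>i\<in>UNIV. \<bar>t $ i\<bar> * \<eta>)"
            using pZ[of y, OF _ ek ek] that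
            by (intro order_trans[OF sum_abs] sum_mono) (auto simp: abs_mult R_def intro!: mult_left_mono)
          then show ?thesis
            using R_eq[OF that, of j] K[of "(T ^^ e j) x"] K[of "(T ^^ e j) y"]
            by (simp add: sum_distrib_right)
        qed
        then have "?n1 t \<le> (\<Sum>j\<in>(UNIV :: 'k set). 2 * K + ?n1 t * \<eta>)" by (intro sum_mono) auto
        then show ?thesis unfolding half by simp
      qed
      \<comment> \<open>Absorbing half of |t - t'| doubles the remaining terms; 4kK is the a priori
        bound on |t'|.\<close>
      define C where "C = 2 * real k * (L1 + (4 * real k * K) * L2)"
      have K0: "K \<ge> 0" using K[of x] by linarith
      have C: "C > 0" unfolding C_def using L1(1) L2(1) K0 k_pos by (intro mult_pos_pos add_pos_nonneg) auto
      have "emeasure lborel E = 0"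
      proof (rule null_if_Lipschitz_relation[OF _ Em C, where X = X and d = "riemannian_dist A g" and R = R])
        show "hausdorff_measure (riemannian_dist A g) DIM(real ^ 'k) X = 0" using hausdorff card by simp
        show "\<exists>y\<in>X. R t y" if tE: "t \<in> E" for t
        proof -
          obtain y where "y \<in> Z" "delay_dist (perturb v (?s t)) x y = 0" using tE by (auto simp: E_def P_def)
          then have "R t y" by (simp add: R_def delay_dist_eq_0)
          then show ?thesis using \<open>y \<in> Z\<close> Z_def by blast
        qed
        fix t t' y y' assume R: "R t y" "R t' y'" and d1: "riemannian_dist A g y y' < 1"
        let ?d = "riemannian_dist A g y y'"
        have d0: "0 \<le> ?d" by (simp add: riemannian_dist_def)
        let ?u = "L1 * ?d + (4 * real k * K) * (L2 * ?d)"
        have "\<bar>(t - t') $ j\<bar> \<le> ?u + ?n1 (t - t') * \<eta>" for j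
        proof -
          let ?z = "(T ^^ e j) y" and ?z' = "(T ^^ e j) y'"
          \<comment> \<open>Difference of the two fixed point equations, arranged so that t - t'
            meets the small values at \<open>y\<close>, and \<open>t'\<close> meets a Lipschitz
            increment.\<close>
          have "(t - t') $ j = (?h ?z - ?h ?z') + (\<Sum>i\<in>UNIV. (t - t') $ i * p (e i) ?z) +
              (\<Sum>i\<in>UNIV. t' $ i * (p (e i) ?z - p (e i) ?z'))"
            using R_eq[OF R(1), of j] R_eq[OF R(2), of j]
            by (simp add: left_diff_distrib right_diff_distrib sum_subtractf)
          moreover have "\<bar>?h ?z - ?h ?z'\<bar> \<le> L1 * ?d" using L1(2)[OF _ d1] ek by simp
          moreover have "\<bar>\<Sum>i\<in>UNIV. (t - t') $ i * p (e i) ?z\<bar> \<le> ?n1 (t - t') * \<eta>"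
          proof -
            have "\<bar>\<Sum>i\<in>UNIV. (t - t') $ i * p (e i) ?z\<bar> \<le> (\<Sum>i\<in>UNIV. \<bar>(t - t') $ i\<bar> * \<eta>)"
              using pZ[of y, OF _ ek ek] R(1)
              by (intro order_trans[OF sum_abs] sum_mono) (auto simp: abs_mult R_def intro!: mult_left_mono)
            then show ?thesis by (simp only: sum_distrib_right)
          qed
          moreover have "\<bar>\<Sum>i\<in>UNIV. t' $ i * (p (e i) ?z - p (e i) ?z')\<bar> \<le> (4 * real k * K) * (L2 * ?d)"
          proof -
            have "\<bar>\<Sum>i\<in>UNIV. t' $ i * (p (e i) ?z - p (e i) ?z')\<bar> \<le> (\<Sum>i\<in>UNIV. \<bar>t' $ i\<bar> * (L2 * ?d))"
            proof (intro order_trans[OF sum_abs] sum_mono)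
              fix i
              have "\<bar>p (e i) ?z - p (e i) ?z'\<bar> \<le> L2 * ?d" using L2(2)[of "(e i, e j)", OF _ d1] ek by simp
              then show "\<bar>t' $ i * (p (e i) ?z - p (e i) ?z')\<bar> \<le> \<bar>t' $ i\<bar> * (L2 * ?d)"
                by (simp add: abs_mult mult_left_mono)
            qed
            also have "\<dots> = ?n1 t' * (L2 * ?d)" by (simp only: sum_distrib_right)
            also have "\<dots> \<le> (4 * real k * K) * (L2 * ?d)"
              using n1_le[OF R(2)] L2(1) d0 by (intro mult_right_mono) auto
            finally show ?thesis .
          qed
          ultimately show ?thesis by linarith
        qed
        then have "?n1 (t - t') \<le> (\<Sum>j\<in>(UNIV::'k set). ?u + ?n1 (t - t') * \<eta>)" by (intro sum_mono) auto
        then have "?n1 (t - t') \<le> real k * ?u + ?n1 (t - t') / 2" unfolding half .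
        then have "?n1 (t - t') \<le> C * ?d" by (simp add: C_def algebra_simps)
        then show "norm (t - t') \<le> C * ?d" using norm_le_l1_cart[of "t - t'"] by linarith
      qed
      then have "E \<in> null_sets lborel" using Em by (simp add: null_sets_def)
      then have "AE t in lborel. t \<notin> E" by (rule AE_not_in)
      then show "AE t in lborel. ?s t \<notin> P" by (simp add: E_def)
    qed
  qed
  then show ?thesis using W yW WZ by (intro exI[of _ W] conjI bexI[of _ P]) (auto simp: P_def)
qed

text \<open>The null sets of \<open>null_collisions_near\<close> depend on \<open>y0\<close>, so the
  set \<open>Z\<close> of points whose iterates avoid those of \<open>x\<close> is covered by
  countably many of the neighbourhoods. The complement of \<open>Z\<close> is finite because the
  iterates of \<open>T\<close> are injective; there it suffices to separate the values of the
  observable itself.\<close>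

lemma null_collisions:
  assumes card: "CARD('k::finite) = k" and v: "v \<in> Cr_functions r A"
    and x: "inj_on (\<lambda>i. (T ^^ i) x) {..<k}"
  shows "\<exists>P\<in>null_sets param. \<forall>\<alpha>\<in>space param - P. \<forall>y\<in>X. y \<noteq> x \<longrightarrow> delay_dist (perturb v \<alpha>) x y \<noteq> 0"
proof -
  define Z where "Z = {y. \<forall>i<k. \<forall>j<k. (T ^^ i) x \<noteq> (T ^^ j) y}"
  have fin: "finite (- Z)"
  proof -
    have "- Z \<subseteq> (\<Union>(i, j)\<in>{..<k} \<times> {..<k}. (T ^^ j) -` {(T ^^ i) x})"
    proof
      fix y assume "y \<in> - Z"
      then obtain i j where "i < k" "j < k" "(T ^^ i) x = (T ^^ j) y" unfolding Z_def by auto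
      then show "y \<in> (\<Union>(i, j)\<in>{..<k} \<times> {..<k}. (T ^^ j) -` {(T ^^ i) x})"
        by (intro UN_I[of "(i, j)"]) auto
    qed
    moreover have "finite (\<Union>(i, j)\<in>{..<k} \<times> {..<k}. (T ^^ j) -` {(T ^^ i) x})"
      by (auto intro!: finite_vimageI[OF _ bij_is_inj[OF bij_iter]])
    ultimately show ?thesis by (rule finite_subset)
  qed
  have "\<forall>y0\<in>Z. \<exists>W. open W \<and> y0 \<in> W \<and>
    (\<exists>P\<in>null_sets param. \<forall>\<alpha>\<in>space param. \<forall>y\<in>X \<inter> W. delay_dist (perturb v \<alpha>) x y = 0 \<longrightarrow> \<alpha> \<in> P)"
    using null_collisions_near[OF card v x] by (auto simp: Z_def)
  from bchoice[OF this] obtain W where W: "\<And>y0. y0 \<in> Z \<Longrightarrow> open (W y0)" "\<And>y0. y0 \<in> Z \<Longrightarrow> y0 \<in> W y0"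
    and WP: "\<forall>y0\<in>Z. \<exists>P\<in>null_sets param. \<forall>\<alpha>\<in>space param. \<forall>y\<in>X \<inter> W y0.
      delay_dist (perturb v \<alpha>) x y = 0 \<longrightarrow> \<alpha> \<in> P"
    by blast
  from WP obtain P where P: "\<And>y0. y0 \<in> Z \<Longrightarrow> P y0 \<in> null_sets param"
    "\<And>y0 \<alpha> y. y0 \<in> Z \<Longrightarrow> \<alpha> \<in> space param \<Longrightarrow> y \<in> X \<inter> W y0 \<Longrightarrow> delay_dist (perturb v \<alpha>) x y = 0 \<Longrightarrow> \<alpha> \<in> P y0"
    unfolding bchoice_iff Bex_def by blast
  obtain Y where Y: "countable Y" "Y \<subseteq> Z" "Z \<subseteq> (\<Union>y\<in>Y. W y)"
    by (rule Lindelof_manifold[of Z W]) (use W in auto)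
  define Q where "Q y = {\<alpha> \<in> space param. perturb v \<alpha> x = perturb v \<alpha> y}" for y
  define N0 where "N0 = (\<Union>y\<in>Y. P y) \<union> (\<Union>y\<in>- Z - {x}. Q y)"
  have "N0 \<in> null_sets param" unfolding N0_def
  proof (intro null_sets.Un null_sets_UN')
    show "countable (- Z - {x})" using fin by (intro countable_finite) simp
    show "Q y \<in> null_sets param" if "y \<in> - Z - {x}" for y
      unfolding Q_def using that by (intro null_collision) auto
  qed (use Y P in auto)
  moreover have "delay_dist (perturb v \<alpha>) x y \<noteq> 0" if \<alpha>: "\<alpha> \<in> space param - N0" and y: "y \<in> X" "y \<noteq> x" for \<alpha> y
  proof
    assume 0: "delay_dist (perturb v \<alpha>) x y = 0"
    show False
    proof (cases "y \<in> Z")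
      case True
      then obtain y0 where "y0 \<in> Y" "y \<in> W y0" using Y(3) by blast
      then have "\<alpha> \<in> P y0" using P(2)[of y0 \<alpha> y] Y(2) y(1) \<alpha> 0 by auto
      then show False using \<alpha> \<open>y0 \<in> Y\<close> by (auto simp: N0_def)
    next
      case False
      have "perturb v \<alpha> x = perturb v \<alpha> y" using 0 k_pos unfolding delay_dist_eq_0 by (metis funpow_0)
      then have "\<alpha> \<in> Q y" using \<alpha> by (simp add: Q_def)
      then show False using False y(2) \<alpha> by (auto simp: N0_def)
    qed
  qed
  ultimately show ?thesis by blast
qed

lemma predictable_measurable:
  assumes v: "v \<in> Cr_functions r A"
  shows "{\<alpha> \<in> space param. predictable (perturb v \<alpha>) x} \<in> sets param"
proof -
  obtain Y where Y: "test_set Y X"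
    using countable_test_set by blast
  have hc: "continuous_on UNIV (perturb v \<alpha>)" for \<alpha>
    by (rule Cr_functions_continuous[OF perturb_Cr_functions[OF v]])
  have "{\<alpha> \<in> space param. predictable (perturb v \<alpha>) x} = {\<alpha> \<in> space param. \<exists>n::nat. \<forall>y\<in>Y.
      delay_dist (perturb v \<alpha>) (T x) (T y) \<le> real n * delay_dist (perturb v \<alpha>) x y}"
    using predictable_countable[OF Y hc] by blast
  also have "\<dots> \<in> sets param"
    by (intro sets.sets_Collect_countable_Ex sets.sets_Collect_countable_All'[OF _ test_setD(1)[OF Y]]
        borel_measurable_le measurable_delay_dist borel_measurable_times borel_measurable_const)
  finally show ?thesis .
qed

text \<open>Perturbing along a function whose delay map has the coordinates among its derivatives, the
  parameters for which the delay map fails to be an immersion are eigenvalues of a fixed operator.\<close>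

lemma AE_predictable:
  assumes card: "CARD('k::finite) = k" and v: "v \<in> Cr_functions r A"
    and x: "inj_on (\<lambda>i. (T ^^ i) x) {..<k}"
  shows "AE \<alpha> in param. predictable (perturb v \<alpha>) x"
proof -
  obtain P where P: "P \<in> null_sets param"
    "\<And>\<alpha> y. \<alpha> \<in> space param - P \<Longrightarrow> y \<in> X \<Longrightarrow> y \<noteq> x \<Longrightarrow> delay_dist (perturb v \<alpha>) x y \<noteq> 0"
    using null_collisions[OF card v x] by blast
  obtain V \<psi> f where V: "(V, \<psi>) \<in> A" "x \<in> V" and f: "\<And>b. b \<in> B \<Longrightarrow> f b \<in> Cr_functions 1 A"
    "\<And>b. b \<in> B \<Longrightarrow> ((f b \<circ> inv_into V \<psi>) has_derivative coord b) (at (\<psi> x))"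
    using coordinate_chart[of x] by blast
  \<comment> \<open>Each basis vector receives its own iterate of \<open>x\<close>; here the
    dimension must not exceed \<open>k\<close>.\<close>
  obtain \<beta> where \<beta>: "\<beta> ` B \<subseteq> {..<k}" "inj_on \<beta> B"
    using card_le_inj[OF finite_B, of "{..<k}"] dim_le by auto
  \<comment> \<open>Composed with the iterate \<beta>(b), this perturbation has the derivative of
    \<open>f b\<close> at \<open>x\<close>; composed with any other iterate it has derivative
    0.\<close>
  have "\<forall>b\<in>B. \<exists>c. zero_deriv (\<lambda>z. lincomb N hs c z - f b ((inv T ^^ \<beta> b) z)) ((T ^^ \<beta> b) x) \<and>
      (\<forall>w\<in>(\<lambda>i. (T ^^ i) x) ` ({..<k} - {\<beta> b}). zero_deriv (lincomb N hs c) w)"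
  proof
    fix b assume b: "b \<in> B"
    then have bk: "\<beta> b < k" using \<beta>(1) by auto
    have "card ((\<lambda>i. (T ^^ i) x) ` ({..<k} - {\<beta> b})) \<le> card ({..<k} - {\<beta> b})" by (rule card_image_le) simp
    also have "\<dots> \<le> 2 * k" using card_mono[of "{..<k}" "{..<k} - {\<beta> b}"] by simp
    finally show "\<exists>c. zero_deriv (\<lambda>z. lincomb N hs c z - f b ((inv T ^^ \<beta> b) z)) ((T ^^ \<beta> b) x) \<and>
      (\<forall>w\<in>(\<lambda>i. (T ^^ i) x) ` ({..<k} - {\<beta> b}). zero_deriv (lincomb N hs c) w)"
      using inj_onD[OF x, of "\<beta> b"] bk by (intro probe_deriv Cr_functions_1_inv_iter f b) auto
  qed
  from bchoice[OF this] obtain c where c_all: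
    "\<forall>b\<in>B. zero_deriv (\<lambda>z. lincomb N hs (c b) z - f b ((inv T ^^ \<beta> b) z)) ((T ^^ \<beta> b) x) \<and>
      (\<forall>w\<in>(\<lambda>i. (T ^^ i) x) ` ({..<k} - {\<beta> b}). zero_deriv (lincomb N hs (c b)) w)" by blast
  have c: "\<And>b. b \<in> B \<Longrightarrow> zero_deriv (\<lambda>z. lincomb N hs (c b) z - f b ((inv T ^^ \<beta> b) z)) ((T ^^ \<beta> b) x)"
      "\<And>b i. b \<in> B \<Longrightarrow> i < k \<Longrightarrow> i \<noteq> \<beta> b \<Longrightarrow> zero_deriv (lincomb N hs (c b)) ((T ^^ i) x)"
    using c_all by auto
  define c' where "c' n = (\<Sum>b\<in>B. c b n)" for n
  have c': "lincomb N hs c' z = (\<Sum>b\<in>B. lincomb N hs (c b) z)" for z unfolding c'_def by (rule lincomb_sum)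
  have deriv_p: "((\<lambda>y. lincomb N hs c' ((T ^^ \<beta> b) y)) \<circ> inv_into V \<psi> has_derivative coord b) (at (\<psi> x))"
    if b: "b \<in> B" for b
  proof -
    have "((\<lambda>y. lincomb N hs (c a) ((T ^^ \<beta> b) y)) \<circ> inv_into V \<psi> has_derivative (\<lambda>u. if a = b then coord b u else 0)) (at (\<psi> x))"
      if a: "a \<in> B" for a
    proof (cases "a = b")
      case True
      have "zero_deriv (\<lambda>y. lincomb N hs (c b) ((T ^^ \<beta> b) y) - f b y) x"
        using zero_deriv_iter[OF c(1)[OF b]] by (simp add: inv_iter)
      then have "((\<lambda>y. lincomb N hs (c b) ((T ^^ \<beta> b) y) - f b y) \<circ> inv_into V \<psi> has_derivative (\<lambda>_. 0)) (at (\<psi> x))"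
        using V unfolding zero_deriv_def by blast
      from has_derivative_add[OF this f(2)[OF b]] show ?thesis using True by (simp add: comp_def)
    next
      case False
      then have "\<beta> b \<noteq> \<beta> a" using \<beta>(2) a b by (auto dest: inj_onD)
      then have "zero_deriv (\<lambda>y. lincomb N hs (c a) ((T ^^ \<beta> b) y)) x"
        using \<beta>(1) a b by (intro zero_deriv_iter c(2)) auto
      then show ?thesis using V False unfolding zero_deriv_def by simp
    qed
    then have "((\<lambda>z. \<Sum>a\<in>B. ((\<lambda>y. lincomb N hs (c a) ((T ^^ \<beta> b) y)) \<circ> inv_into V \<psi>) z) has_derivative
        (\<lambda>u. \<Sum>a\<in>B. if a = b then coord b u else 0)) (at (\<psi> x))"
      by (intro has_derivative_sum)
    then show ?thesis using b finite_B by (simp add: comp_def c')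
  qed
  let ?good = "{\<alpha> \<in> space param. predictable (perturb v \<alpha>) x}"
  \<comment> \<open>The collision parameters \<open>P\<close> are already null. Outside of them
    unpredictability can only come from a degenerate derivative.\<close>
  define Bad where "Bad = space param - ?good - P"
  have "Bad \<in> null_sets param"
  proof (rule null_if_null_shifts[where l = "\<lambda>(t::real) n. t * c' n"])
    show "Bad \<in> sets param" unfolding Bad_def using predictable_measurable[OF v] P(1) by auto
    fix \<alpha> :: "nat \<Rightarrow> real"
    let ?s = "\<lambda>t. \<lambda>n\<in>{..<N}. \<alpha> n + t * c' n"
    let ?h = "perturb v \<alpha>"
    define D where "D i = frechet_derivative ((\<lambda>y. ?h ((T ^^ i) y)) \<circ> inv_into V \<psi>) (at (\<psi> x))" for i
    have D: "((\<lambda>y. ?h ((T ^^ i) y)) \<circ> inv_into V \<psi> has_derivative D i) (at (\<psi> x))" for i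
      unfolding D_def
      using Cr_functions_differentiable[OF Cr_functions_1_iter[OF Cr_functions_1[OF perturb_Cr_functions[OF v]]] V]
      by (rule iffD1[OF frechet_derivative_works])
    \<comment> \<open>The rows \<beta>(b) of the derivative of the delay map, read as an
      endomorphism of the model space. A shift by \<open>t\<close> adds \<open>t\<close> times the
      identity to it.\<close>
    define S where "S u = (\<Sum>b\<in>B. D (\<beta> b) u *\<^sub>R b)" for u
    have S: "linear S" unfolding S_def[abs_def]
      by (intro linear_compose_sum ballI bounded_linear.linear[OF bounded_linear_scaleR_const]
          has_derivative_bounded_linear[OF D])
    let ?E = "{t::real. \<exists>u. u \<noteq> 0 \<and> S u = t *\<^sub>R u}"
    have "- t \<in> ?E" if t: "?s t \<in> Bad" for t
    proof -
      have st: "?s t \<in> space param - P" "\<not> predictable (perturb v (?s t)) x" using t by (auto simp: Bad_def)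
      have "\<exists>u. u \<noteq> 0 \<and> (\<forall>i<k. frechet_derivative ((\<lambda>y. perturb v (?s t) ((T ^^ i) y)) \<circ> inv_into V \<psi>) (at (\<psi> x)) u = 0)"
      proof (rule ccontr)
        assume "\<not> ?thesis"
        then have "predictable (perturb v (?s t)) x"
          by (intro predictable_if_injective_immersion[OF Cr_functions_1[OF perturb_Cr_functions[OF v]] P(2)[OF st(1)] V]) auto
        with st(2) show False by simp
      qed
      then obtain u where u: "u \<noteq> 0"
        "\<And>i. i < k \<Longrightarrow> frechet_derivative ((\<lambda>y. perturb v (?s t) ((T ^^ i) y)) \<circ> inv_into V \<psi>) (at (\<psi> x)) u = 0" by blast
      have "D (\<beta> b) u = - t * coord b u" if b: "b \<in> B" for b
      proof -
        have "((\<lambda>y. perturb v (?s t) ((T ^^ \<beta> b) y)) \<circ> inv_into V \<psi> has_derivative (\<lambda>u. D (\<beta> b) u + t * coord b u)) (at (\<psi> x))"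
          using has_derivative_add[OF D[of "\<beta> b"] has_derivative_mult_right[OF deriv_p[OF b], of t]]
          by (simp add: comp_def perturb_shift lincomb_cmult)
        from frechet_derivative_at[OF this] u(2)[of "\<beta> b"] \<beta>(1) b show ?thesis
          by (simp add: fun_eq_iff) (metis add.commute add_eq_0_iff image_subset_iff lessThan_iff)
      qed
      then have "S u = (\<Sum>b\<in>B. (- t) *\<^sub>R (coord b u *\<^sub>R b))" unfolding S_def by (intro sum.cong) auto
      also have "\<dots> = (- t) *\<^sub>R u" unfolding scaleR_right.sum[symmetric] sum_coord ..
      finally show ?thesis using u(1) by blast
    qed
    then have "{t. ?s t \<in> Bad} \<subseteq> uminus ` ?E" by (force intro: image_eqI[of _ uminus "- _"])
    then have "countable {t. ?s t \<in> Bad}"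
      using finite_eigenvalues[OF S] by (meson countable_finite countable_subset finite_imageI)
    then have "{t. ?s t \<in> Bad} \<in> null_sets lborel" by (rule countable_imp_null_set_lborel)
    then show "AE t in lborel. ?s t \<notin> Bad" by (drule_tac AE_not_in) simp
  qed simp
  then have "Bad \<union> P \<in> null_sets param" using P(1) by (rule null_sets.Un)
  then show ?thesis by (rule AE_I') (auto simp: Bad_def)
qed

end

section \<open>The topology of \<open>C\<^sup>r(M, \<real>)\<close>\<close>

lemma dir_derivs_lincomb:
  fixes f :: "nat \<Rightarrow> 'e::real_normed_vector \<Rightarrow> real"
  assumes S: "open S" and "\<And>n. Cr_on (enat (length vs)) S (f n)" and "z \<in> S"
  shows "dir_derivs vs (\<lambda>z. \<Sum>n<N. a n * f n z) z = (\<Sum>n<N. a n * dir_derivs vs (f n) z)"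
  using assms(2,3)
proof (induction vs arbitrary: f z)
  case (Cons v vs)
  have f: "Cr_on (enat (Suc (length vs))) S (f n)" for n using Cons.prems(1)[of n] by simp
  have D: "frechet_derivative (\<lambda>z. \<Sum>n<N. a n * f n z) (at y) v = (\<Sum>n<N. a n * frechet_derivative (f n) (at y) v)"
    if y: "y \<in> S" for y
  proof -
    have "((\<lambda>z. \<Sum>n<N. a n * f n z) has_derivative (\<lambda>v. \<Sum>n<N. a n * frechet_derivative (f n) (at y) v)) (at y)"
      using f y by (intro has_derivative_sum has_derivative_mult_right iffD1[OF frechet_derivative_works])
        (simp add: Cr_on_Suc)
    from fun_cong[OF frechet_derivative_at[OF this], of v] show ?thesis by (rule sym)
  qed
  have "dir_derivs (v # vs) (\<lambda>z. \<Sum>n<N. a n * f n z) z =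
      dir_derivs vs (\<lambda>z. \<Sum>n<N. a n * frechet_derivative (f n) (at z) v) z"
    unfolding dir_derivs.simps by (rule dir_derivs_cong[OF S Cons.prems(2)]) (rule D)
  also have "\<dots> = (\<Sum>n<N. a n * dir_derivs vs (\<lambda>z. frechet_derivative (f n) (at z) v) z)"
    by (rule Cons.IH[OF _ Cons.prems(2)]) (use f in \<open>simp add: Cr_on_Suc\<close>)
  finally show ?case by simp
qed simp

context compact_Cr_manifold
begin

abbreviation Cr_space :: "('m \<Rightarrow> real) topology" where
  "Cr_space \<equiv> Cr_topology r A"

definition Cr_nhd :: "('m \<Rightarrow> real) \<Rightarrow> 'm set \<Rightarrow> ('m \<Rightarrow> 'e) \<Rightarrow> 'm set \<Rightarrow> 'e list \<Rightarrow> real \<Rightarrow> ('m \<Rightarrow> real) set" where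
  "Cr_nhd h U \<phi> K vs \<epsilon> = {f \<in> Cr_functions r A. \<forall>x\<in>K.
     \<bar>dir_derivs vs (f \<circ> inv_into U \<phi>) (\<phi> x) - dir_derivs vs (h \<circ> inv_into U \<phi>) (\<phi> x)\<bar> < \<epsilon>}"

definition Cr_subbase :: "('m \<Rightarrow> real) set set" where
  "Cr_subbase = {Cr_nhd h U \<phi> K vs \<epsilon> | h U \<phi> K vs \<epsilon>. h \<in> Cr_functions r A \<and> (U, \<phi>) \<in> A \<and> compact K \<and> K \<subseteq> U \<and>
          enat (length vs) \<le> r \<and> 0 < \<epsilon>}"

lemma Cr_space_eq: "Cr_space = topology_generated_by Cr_subbase"
  unfolding Cr_topology_def Cr_subbase_def Cr_nhd_def ..

lemma topspace_Cr_space: "topspace Cr_space = Cr_functions r A"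
proof -
  obtain U \<phi> where U: "(U, \<phi>) \<in> A" by (rule chart_exists)
  \<comment> \<open>With \<open>K\<close> empty the condition is vacuous, so the whole function
    space belongs to the subbase.\<close>
  have "Cr_nhd (\<lambda>_. 0) U \<phi> {} [] 1 = Cr_functions r A" by (simp add: Cr_nhd_def)
  moreover have "Cr_nhd (\<lambda>_. 0) U \<phi> {} [] 1 \<in> Cr_subbase"
  proof -
    have "enat (length ([] :: 'e list)) \<le> r" "compact ({} :: 'm set)" "{} \<subseteq> U" "0 < (1::real)"
      by (simp_all add: zero_enat_def[symmetric])
    then show ?thesis unfolding Cr_subbase_def using U Cr_functions_const[of 0 r] by blast
  qed
  ultimately have "Cr_functions r A \<subseteq> \<Union>Cr_subbase" by blast
  moreover have "\<Union>Cr_subbase \<subseteq> Cr_functions r A" by (auto simp: Cr_subbase_def Cr_nhd_def)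
  ultimately show ?thesis unfolding Cr_space_eq topology_generated_by_topspace by blast
qed

lemma compact_chart_neighbourhood:
  "\<exists>U \<psi> K O'. (U, \<psi>) \<in> A \<and> compact K \<and> K \<subseteq> U \<and> open O' \<and> x0 \<in> O' \<and> O' \<subseteq> K"
proof -
  obtain U \<psi> where U: "(U, \<psi>) \<in> A" "x0 \<in> U" by (rule chart_exists)
  define z0 where "z0 = \<psi> x0"
  obtain \<rho> where \<rho>: "\<rho> > 0" "{z. \<forall>b\<in>B. \<bar>coord b (z - z0)\<bar> \<le> \<rho>} \<subseteq> \<psi> ` U"
    using box_subset_open[OF open_chart_image[OF U(1)], of z0] U(2) z0_def by blast
  define K where "K = inv_into U \<psi> ` {z. \<forall>b\<in>B. \<bar>coord b (z - z0)\<bar> \<le> \<rho>}"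
  define V where "V = {z. \<forall>b\<in>B. \<bar>coord b (z - z0)\<bar> < \<rho>}"
  have K: "compact K" unfolding K_def
    using continuous_on_subset[OF continuous_on_inv_chart[OF U(1)] \<rho>(2)] compact_box compact_continuous_image by blast
  have KU: "K \<subseteq> U" unfolding K_def using \<rho>(2) inv_chart[OF U(1)] by fastforce
  have "V = (\<Inter>b\<in>B. {z. \<bar>coord b (z - z0)\<bar> < \<rho>})" by (auto simp: V_def)
  also have "open \<dots>"
    by (intro open_INT finite_B ballI open_Collect_less continuous_intros
        bounded_linear.continuous_on[OF bounded_linear_coord])
  finally have "open (\<psi> -` V \<inter> U)"
    using continuous_on_chart[OF U(1)] by (simp add: continuous_on_open_vimage[OF open_chart[OF U(1)]])
  moreover have "x0 \<in> \<psi> -` V \<inter> U" using U(2) \<rho>(1) by (simp add: V_def z0_def linear_0[OF linear_coord])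
  moreover have "\<psi> -` V \<inter> U \<subseteq> K"
  proof
    fix y assume y: "y \<in> \<psi> -` V \<inter> U"
    then show "y \<in> K" unfolding K_def
      by (intro image_eqI[of _ _ "\<psi> y"]) (auto simp: V_def inv_chart[OF U(1)] intro: less_imp_le)
  qed
  ultimately show ?thesis using U(1) K KU by blast
qed

text \<open>Finitely many compact chart neighbourhoods cover M, and the empty list of directions
  controls values. The topology is thus finer than that of uniform convergence.\<close>

lemma openin_if_uniformly_open:
  assumes sub: "S \<subseteq> Cr_functions r A"
    and op: "\<And>h. h \<in> S \<Longrightarrow> \<exists>\<eta>>0. \<forall>f\<in>Cr_functions r A. (\<forall>x. \<bar>f x - h x\<bar> < \<eta>) \<longrightarrow> f \<in> S"
  shows "openin Cr_space S"
proof (subst openin_subopen, rule ballI)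
  fix h assume h: "h \<in> S"
  then obtain \<eta> where \<eta>: "\<eta> > 0" "\<And>f. f \<in> Cr_functions r A \<Longrightarrow> (\<forall>x. \<bar>f x - h x\<bar> < \<eta>) \<Longrightarrow> f \<in> S"
    using op[OF h] by blast
  have "\<forall>x0. \<exists>U \<psi> K O'. (U, \<psi>) \<in> A \<and> compact K \<and> K \<subseteq> U \<and> open O' \<and> x0 \<in> O' \<and> O' \<subseteq> K"
    by (intro allI compact_chart_neighbourhood)
  then obtain U \<psi> K O' where p: "\<forall>x0. (U x0, \<psi> x0) \<in> A \<and> compact (K x0) \<and> K x0 \<subseteq> U x0 \<and>
      open (O' x0) \<and> x0 \<in> O' x0 \<and> O' x0 \<subseteq> K x0"
    unfolding choice_iff by (elim exE) (rule that)
  have op': "open (O' x0)" for x0 using p by blast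
  have cov: "UNIV \<subseteq> (\<Union>x0\<in>UNIV. O' x0)" using p by blast
  obtain J where J: "finite J" "UNIV \<subseteq> (\<Union>x0\<in>J. O' x0)"
    using compactE_image[OF compact_M op' cov] by metis
  have hC: "h \<in> Cr_functions r A" using h sub by blast
  define V where "V = Cr_functions r A \<inter> (\<Inter>a\<in>J. Cr_nhd h (U a) (\<psi> a) (K a) [] \<eta>)"
  have "openin Cr_space (Cr_nhd h (U a) (\<psi> a) (K a) [] \<eta>)" for a
    unfolding Cr_space_eq
  proof (rule topology_generated_by_Basis)
    have "enat (length ([] :: 'e list)) \<le> r" by (simp add: zero_enat_def[symmetric])
    then show "Cr_nhd h (U a) (\<psi> a) (K a) [] \<eta> \<in> Cr_subbase"
      unfolding Cr_subbase_def using hC p \<eta>(1) by blast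
  qed
  then have "openin Cr_space V" unfolding V_def
    using J(1) by (intro openin_Int_Inter) (auto simp: topspace_Cr_space[symmetric])
  moreover have "h \<in> V" unfolding V_def Cr_nhd_def using hC \<eta>(1) by simp
  moreover have "V \<subseteq> S"
  proof
    fix f assume f: "f \<in> V"
    have "\<bar>f x - h x\<bar> < \<eta>" for x
    proof -
      obtain a where a: "a \<in> J" "x \<in> O' a" using J(2) by blast
      then have xK: "x \<in> K a" "x \<in> U a" using p by blast+
      have Ua: "(U a, \<psi> a) \<in> A" using p by blast
      have "f \<in> Cr_nhd h (U a) (\<psi> a) (K a) [] \<eta>" using f a(1) by (simp add: V_def)
      then have "\<bar>(f \<circ> inv_into (U a) (\<psi> a)) (\<psi> a x) - (h \<circ> inv_into (U a) (\<psi> a)) (\<psi> a x)\<bar> < \<eta>"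
        using xK(1) unfolding Cr_nhd_def by simp
      then show ?thesis by (simp add: inv_chart[OF Ua xK(2)])
    qed
    moreover have "f \<in> Cr_functions r A" using f by (simp add: V_def)
    ultimately show "f \<in> S" using \<eta>(2) by blast
  qed
  ultimately show "\<exists>V. openin Cr_space V \<and> h \<in> V \<and> V \<subseteq> S" by blast
qed

text \<open>Evaluations at points separate functions. This makes the compact image of a cube closed,
  hence a Borel set.\<close>

lemma Hausdorff_Cr_space: "Hausdorff_space Cr_space"
  unfolding Hausdorff_space_def topspace_Cr_space
proof (intro allI impI)
  fix f g assume "f \<in> Cr_functions r A \<and> g \<in> Cr_functions r A \<and> f \<noteq> g"
  then have fg: "f \<in> Cr_functions r A" "g \<in> Cr_functions r A" "f \<noteq> g" by auto
  then obtain x where x: "f x \<noteq> g x" by blast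
  define d where "d = \<bar>f x - g x\<bar> / 2"
  have d: "d > 0" using x by (simp add: d_def)
  have op: "openin Cr_space {h \<in> Cr_functions r A. \<bar>h x - k\<bar> < d}" for k
  proof (rule openin_if_uniformly_open)
    fix h assume "h \<in> {h \<in> Cr_functions r A. \<bar>h x - k\<bar> < d}"
    then have h: "\<bar>h x - k\<bar> < d" by simp
    show "\<exists>\<eta>>0. \<forall>f\<in>Cr_functions r A. (\<forall>x. \<bar>f x - h x\<bar> < \<eta>) \<longrightarrow> f \<in> {h \<in> Cr_functions r A. \<bar>h x - k\<bar> < d}"
    proof (intro exI[of _ "d - \<bar>h x - k\<bar>"] conjI ballI impI)
      fix f' assume f': "f' \<in> Cr_functions r A" "\<forall>y. \<bar>f' y - h y\<bar> < d - \<bar>h x - k\<bar>"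
      then have "\<bar>f' x - h x\<bar> < d - \<bar>h x - k\<bar>" by blast
      then show "f' \<in> {h \<in> Cr_functions r A. \<bar>h x - k\<bar> < d}" using f'(1) by simp
    qed (use h in simp)
  qed simp
  have "disjnt {h \<in> Cr_functions r A. \<bar>h x - f x\<bar> < d} {h \<in> Cr_functions r A. \<bar>h x - g x\<bar> < d}"
    unfolding disjnt_iff
  proof (intro allI notI)
    fix h assume "h \<in> {h \<in> Cr_functions r A. \<bar>h x - f x\<bar> < d} \<and> h \<in> {h \<in> Cr_functions r A. \<bar>h x - g x\<bar> < d}"
    then have "\<bar>h x - f x\<bar> < d" "\<bar>h x - g x\<bar> < d" by simp_all
    then show False unfolding d_def by argo
  qed
  then show "\<exists>U V. openin Cr_space U \<and> openin Cr_space V \<and> f \<in> U \<and> g \<in> V \<and> disjnt U V"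
    using op[of "f x"] op[of "g x"] fg d by (intro exI conjI) auto
qed

text \<open>It suffices to consider subbasic sets. On the compact \<open>K\<close> the derivatives
  of the finitely many probe functions are bounded, and the strict inequality defining the set holds
  with a uniform margin.\<close>

lemma continuous_map_lincomb:
  assumes hs: "\<And>n. hs n \<in> Cr_functions r A"
  shows "continuous_map euclidean Cr_space (lincomb N hs)"
  unfolding Cr_space_eq continuous_on_generated_topo_iff
proof (intro conjI allI impI)
  have eC: "lincomb N hs \<alpha> \<in> Cr_functions r A" for \<alpha> by (intro lincomb_Cr_functions hs)
  then show "lincomb N hs ` topspace euclidean \<subseteq> \<Union>Cr_subbase"
    using topspace_Cr_space unfolding Cr_space_eq topology_generated_by_topspace by blast
  fix S assume "S \<in> Cr_subbase"
  then obtain h U \<phi> K vs \<epsilon> where S: "S = Cr_nhd h U \<phi> K vs \<epsilon>" and h: "h \<in> Cr_functions r A" and U: "(U, \<phi>) \<in> A"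
    and K: "compact K" "K \<subseteq> U" and vs: "enat (length vs) \<le> r" and \<epsilon>: "0 < \<epsilon>"
    unfolding Cr_subbase_def by blast
  define D where "D f x = dir_derivs vs (f \<circ> inv_into U \<phi>) (\<phi> x)" for f :: "'m \<Rightarrow> real" and x
  have Cr: "Cr_on r (\<phi> ` U) (f \<circ> inv_into U \<phi>)" if "f \<in> Cr_functions r A" for f
    using that U by (simp add: Cr_functions_iff comp_def)
  have Dc: "continuous_on K (D f)" if "f \<in> Cr_functions r A" for f
  proof -
    have "continuous_on (\<phi> ` U) (dir_derivs vs (f \<circ> inv_into U \<phi>))"
      using Cr[OF that] vs unfolding Cr_on_def by blast
    then show ?thesis unfolding D_def[abs_def]
      by (rule continuous_on_compose2[OF _ continuous_on_subset[OF continuous_on_chart[OF U] K(2)]]) (use K(2) in auto)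
  qed
  have Dlin: "D (lincomb N hs \<alpha>) x = (\<Sum>n<N. \<alpha> n * D (hs n) x)" if "x \<in> K" for \<alpha> x
  proof -
    have "lincomb N hs \<alpha> \<circ> inv_into U \<phi> = (\<lambda>z. \<Sum>n<N. \<alpha> n * (hs n \<circ> inv_into U \<phi>) z)"
      by (auto simp: lincomb_def)
    moreover have "Cr_on (enat (length vs)) (\<phi> ` U) (hs n \<circ> inv_into U \<phi>)" for n
      using Cr_on_mono[OF Cr[OF hs] vs] by simp
    moreover have "\<phi> x \<in> \<phi> ` U" using that K(2) by blast
    ultimately show ?thesis unfolding D_def
      using dir_derivs_lincomb[OF open_chart_image[OF U], of vs "\<lambda>n. hs n \<circ> inv_into U \<phi>"] by (simp only:)
  qed
  have "\<forall>n. \<exists>M. \<forall>x\<in>K. \<bar>D (hs n) x\<bar> \<le> M"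
  proof
    fix n
    have "bounded (D (hs n) ` K)" using compact_continuous_image[OF Dc[OF hs] K(1)] by (rule compact_imp_bounded)
    then show "\<exists>M. \<forall>x\<in>K. \<bar>D (hs n) x\<bar> \<le> M" by (auto simp: bounded_iff)
  qed
  then obtain M where M: "\<And>n x. x \<in> K \<Longrightarrow> \<bar>D (hs n) x\<bar> \<le> M n" by metis
  have "open (lincomb N hs -` S)"
  proof (subst open_subopen, rule ballI)
    fix \<alpha> assume \<alpha>: "\<alpha> \<in> lincomb N hs -` S"
    have lt: "\<bar>D (lincomb N hs \<alpha>) x - D h x\<bar> < \<epsilon>" if "x \<in> K" for x
      using \<alpha> that by (auto simp: S Cr_nhd_def D_def)
    have "\<exists>\<eta>>0. \<forall>x\<in>K. \<bar>D (lincomb N hs \<alpha>) x - D h x\<bar> + \<eta> \<le> \<epsilon>"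
    proof (cases "K = {}")
      case False
      have "continuous_on K (\<lambda>x. \<bar>D (lincomb N hs \<alpha>) x - D h x\<bar>)"
        by (intro continuous_intros Dc eC h)
      then obtain x0 where x0: "x0 \<in> K"
        "\<And>x. x \<in> K \<Longrightarrow> \<bar>D (lincomb N hs \<alpha>) x - D h x\<bar> \<le> \<bar>D (lincomb N hs \<alpha>) x0 - D h x0\<bar>"
        using continuous_attains_sup[OF K(1) False] by blast
      then show ?thesis using lt[OF x0(1)]
        by (intro exI[of _ "\<epsilon> - \<bar>D (lincomb N hs \<alpha>) x0 - D h x0\<bar>"]) fastforce
    qed (auto intro: exI[of _ 1])
    then obtain \<eta> where \<eta>: "\<eta> > 0" "\<And>x. x \<in> K \<Longrightarrow> \<bar>D (lincomb N hs \<alpha>) x - D h x\<bar> + \<eta> \<le> \<epsilon>" by blast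
    define O' where "O' = {\<beta> :: nat \<Rightarrow> real. (\<Sum>n<N. \<bar>\<beta> n - \<alpha> n\<bar> * M n) < \<eta>}"
    have "open O'" unfolding O'_def
      by (intro open_Collect_less continuous_intros continuous_on_product_coordinates)
    moreover have "\<alpha> \<in> O'" using \<eta>(1) by (simp add: O'_def)
    moreover have "O' \<subseteq> lincomb N hs -` S"
    proof
      fix \<beta> assume \<beta>: "\<beta> \<in> O'"
      have "\<bar>D (lincomb N hs \<beta>) x - D h x\<bar> < \<epsilon>" if x: "x \<in> K" for x
      proof -
        have "\<bar>D (lincomb N hs \<beta>) x - D (lincomb N hs \<alpha>) x\<bar> = \<bar>\<Sum>n<N. (\<beta> n - \<alpha> n) * D (hs n) x\<bar>"
          by (simp add: Dlin[OF x] sum_subtractf left_diff_distrib)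
        also have "\<dots> \<le> (\<Sum>n<N. \<bar>\<beta> n - \<alpha> n\<bar> * M n)"
          using M[OF x] by (intro order_trans[OF sum_abs] sum_mono) (simp add: abs_mult mult_left_mono)
        also have "\<dots> < \<eta>" using \<beta> by (simp add: O'_def)
        finally show ?thesis using \<eta>(2)[OF x] by linarith
      qed
      then show "\<beta> \<in> lincomb N hs -` S" using eC by (simp add: S Cr_nhd_def D_def)
    qed
    ultimately show "\<exists>T. open T \<and> \<alpha> \<in> T \<and> T \<subseteq> lincomb N hs -` S" by blast
  qed
  then show "openin euclidean (lincomb N hs -` S \<inter> topspace euclidean)" by simp
qed

end

section \<open>The prediction error\<close>

text \<open>All values lie within \<open>c\<close> of \<open>w\<close>, hence so does their mean,
  and therefore every value lies within 2c of the mean.\<close>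

lemma prediction_error_le:
  fixes T :: "'m::topological_space \<Rightarrow> 'm" and h :: "'m \<Rightarrow> real"
    and y w :: "real ^ ('k::{finite,linorder})"
  assumes \<mu>: "prob_space \<mu>" "sets \<mu> = sets (restrict_space borel X)"
    and cont: "continuous_on UNIV h" "continuous_on UNIV T"
    and bounded: "\<And>x. \<bar>h x\<bar> \<le> K"
    and c: "0 \<le> c" "\<And>z. z \<in> delay_preimage \<mu> T h \<epsilon> y \<Longrightarrow> norm (delay_map T h (T z) - w) \<le> c"
  shows "prediction_error \<mu> T h \<epsilon> y \<le> 2 * c"
proof -
  interpret prob_space \<mu> by (rule \<mu>(1))
  let ?F = "\<lambda>z. delay_map T h (T z) :: real ^ ('k::{finite,linorder})"
  define S where "S = delay_preimage \<mu> T h \<epsilon> y"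
  have iter: "continuous_on UNIV (T ^^ n)" for n
  proof (induction n)
    case (Suc n)
    then show ?case using continuous_on_compose[OF Suc, of T] continuous_on_subset[OF cont(2)] by simp
  qed (simp add: continuous_on_id id_def)
  have dc: "continuous_on UNIV (delay_map T h :: 'm \<Rightarrow> real ^ ('k::{finite,linorder}))"
    unfolding delay_map_def[abs_def]
    by (intro continuous_on_vec_lambda continuous_on_compose2[OF cont(1)] iter) auto
  have meas: "f \<in> borel_measurable \<mu>" if "continuous_on UNIV f" for f :: "'m \<Rightarrow> real ^ ('k::{finite,linorder})"
    using measurable_restrict_space1[OF borel_measurable_continuous_onI[OF that]]
    by (simp add: measurable_cong_sets[OF \<mu>(2) refl])
  have Fm: "?F \<in> borel_measurable \<mu>"
    by (rule meas) (rule continuous_on_compose2[OF dc cont(2)], auto)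
  have S: "S \<in> sets \<mu>" unfolding S_def delay_preimage_def
    by (rule measurable_sets[OF meas[OF dc]]) simp
  define m where "m = measure \<mu> S"
  define \<chi>0 where "\<chi>0 = prediction_mean \<mu> T h \<epsilon> y"
  show ?thesis
  proof (cases "m = 0")
    \<comment> \<open>Division by zero yields 0, so the error is 0 for a preimage of measure
      zero.\<close>
    case True
    then show ?thesis using c(1) by (simp add: prediction_error_def S_def m_def)
  next
    case False
    then have m: "m > 0" by (simp add: m_def zero_less_measure_iff)
    have "norm (?F z) \<le> real CARD('k) * K" for z
    proof -
      have "norm (?F z) \<le> (\<Sum>i\<in>UNIV. \<bar>?F z $ i\<bar>)" by (rule norm_le_l1_cart)
      also have "\<dots> \<le> (\<Sum>i\<in>(UNIV::'k set). K)" using bounded by (intro sum_mono) (simp add: delay_map_def)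
      finally show ?thesis by simp
    qed
    then have Fi: "integrable \<mu> ?F"
      using Fm by (intro integrable_const_bound[of _ "real CARD('k) * K"]) auto
    have Fi': "set_integrable \<mu> S (\<lambda>z. ?F z - w)"
      unfolding set_integrable_def using S Fi by (intro integrable_mult_indicator) auto
    have const: "(LINT z:S|\<mu>. a) = m *\<^sub>R a" for a :: "real ^ ('k::{finite,linorder})"
    proof -
      have "integrable \<mu> (indicat_real S)" using S by (intro integrable_real_indicator) (auto simp: less_top[symmetric])
      then show ?thesis using S by (simp add: set_lebesgue_integral_def m_def integral_scaleR_left)
    qed
    have avg: "\<chi>0 - w = (1 / m) *\<^sub>R (LINT z:S|\<mu>. ?F z - w)"
    proof -
      have "set_integrable \<mu> S ?F" "set_integrable \<mu> S (\<lambda>z. w)"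
        unfolding set_integrable_def using S Fi by (auto intro!: integrable_mult_indicator)
      then have "(LINT z:S|\<mu>. ?F z - w) = (LINT z:S|\<mu>. ?F z) - m *\<^sub>R w"
        by (simp add: set_integral_diff const)
      then show ?thesis using m by (simp add: \<chi>0_def prediction_mean_def S_def[symmetric] m_def[symmetric] scaleR_diff_right)
    qed
    have "norm (LINT z:S|\<mu>. ?F z - w) \<le> (LINT z:S|\<mu>. norm (?F z - w))"
      using set_integral_norm_bound[OF Fi'] .
    also have "\<dots> \<le> (LINT z:S|\<mu>. c)"
    proof (rule set_integral_mono)
      show "set_integrable \<mu> S (\<lambda>z. norm (?F z - w))" using Fi' by (rule set_integrable_norm)
      show "set_integrable \<mu> S (\<lambda>z. c)" unfolding set_integrable_def using S by (intro integrable_mult_indicator) auto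
    qed (use c(2) in \<open>simp add: S_def\<close>)
    also have "\<dots> = m * c" using S by (simp add: set_lebesgue_integral_def m_def)
    finally have "norm (\<chi>0 - w) \<le> c" unfolding avg using m by (simp add: field_simps)
    then have le: "norm (?F z - \<chi>0) \<le> 2 * c" if "z \<in> S" for z
      using c(2)[of z] that norm_triangle_ineq[of "?F z - w" "w - \<chi>0"]
      by (simp add: S_def norm_minus_commute)
    have "(LINT z:S|\<mu>. (norm (?F z - \<chi>0))\<^sup>2) \<le> (LINT z:S|\<mu>. (2 * c)\<^sup>2)"
    proof (rule set_integral_mono)
      show i: "set_integrable \<mu> S (\<lambda>z. (2 * c)\<^sup>2)"
        unfolding set_integrable_def using S by (intro integrable_mult_indicator) auto
      show "set_integrable \<mu> S (\<lambda>z. (norm (?F z - \<chi>0))\<^sup>2)"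
        unfolding set_integrable_def
      proof (rule Bochner_Integration.integrable_bound[OF i[unfolded set_integrable_def]])
        show "(\<lambda>z. indicat_real S z *\<^sub>R (norm (?F z - \<chi>0))\<^sup>2) \<in> borel_measurable \<mu>"
          using S Fm by measurable
        have "norm (indicat_real S z *\<^sub>R (norm (?F z - \<chi>0))\<^sup>2) \<le> norm (indicat_real S z *\<^sub>R (2 * c)\<^sup>2)" for z
          using power_mono[OF le, of z 2] by (cases "z \<in> S") auto
        then show "AE z in \<mu>. norm (indicat_real S z *\<^sub>R (norm (?F z - \<chi>0))\<^sup>2) \<le> norm (indicat_real S z *\<^sub>R (2 * c)\<^sup>2)"
          by simp
      qed
    qed (use le in \<open>intro power_mono, auto\<close>)
    also have "\<dots> = m * (2 * c)\<^sup>2" using S by (simp add: set_lebesgue_integral_def m_def)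
    finally have "(1 / m) * (LINT z:S|\<mu>. (norm (?F z - \<chi>0))\<^sup>2) \<le> (2 * c)\<^sup>2" using m by (simp add: field_simps)
    then have "sqrt ((1 / m) * (LINT z:S|\<mu>. (norm (?F z - \<chi>0))\<^sup>2)) \<le> 2 * c"
      using c(1) by (intro real_le_lsqrt) auto
    then show ?thesis unfolding prediction_error_def S_def m_def \<chi>0_def .
  qed
qed

lemma bij_betw_card_less: "bij_betw (\<lambda>i::'k::{finite,linorder}. card {j. j < i}) UNIV {..<CARD('k)}"
proof -
  have lt: "card {j. j < i} < card {j. j < i'}" if "i < i'" for i i' :: 'k
    using that by (intro psubset_card_mono) auto
  have inj: "inj (\<lambda>i::'k. card {j. j < i})"
  proof (rule injI)
    fix i i' :: 'k assume "card {j. j < i} = card {j. j < i'}"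
    then show "i = i'" using lt[of i i'] lt[of i' i] by (cases i i' rule: linorder_cases) auto
  qed
  have "card {j. j < i} < CARD('k)" for i :: 'k by (intro psubset_card_mono) auto
  then have "range (\<lambda>i::'k. card {j. j < i}) \<subseteq> {..<CARD('k)}" by auto
  moreover have "card (range (\<lambda>i::'k. card {j. j < i})) = card {..<CARD('k)}" using card_image[OF inj] by simp
  ultimately have "range (\<lambda>i::'k. card {j. j < i}) = {..<CARD('k)}" by (intro card_subset_eq) auto
  with inj show ?thesis by (simp add: bij_betw_def)
qed

section \<open>Prevalence\<close>

locale prediction_setting = probe_setting B r A g T X k N hs
  for B :: "'e::real_normed_vector set" and r :: enat and A :: "('m::t2_space, 'e) chart set" and g
    and T :: "'m \<Rightarrow> 'm" and X :: "'m set" and k N :: nat and hs :: "nat \<Rightarrow> 'm \<Rightarrow> real" +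
  fixes \<mu> :: "'m measure"
  assumes prob_\<mu>: "prob_space \<mu>" and sets_\<mu>: "sets \<mu> = sets (restrict_space borel X)"
begin

sublocale prob_space \<mu> by (rule prob_\<mu>)

lemma space_\<mu>: "space \<mu> = X"
  using sets_eq_imp_space_eq[OF sets_\<mu>] by (simp add: space_restrict_space)

lemma measurable_\<mu>: "continuous_on UNIV f \<Longrightarrow> f \<in> borel_measurable \<mu>" for f :: "'m \<Rightarrow> real"
  using measurable_restrict_space1[OF borel_measurable_continuous_onI]
  by (simp add: measurable_cong_sets[OF sets_\<mu> refl])

lemma closed_Int_sets: "closed C \<Longrightarrow> X \<inter> C \<in> sets \<mu>"
  unfolding sets_\<mu> by (simp add: sets_restrict_space)

lemma prediction_error_if_predictable:
  assumes card: "CARD('k::{finite,linorder}) = k" and h: "h \<in> Cr_functions r A"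
    and pred: "predictable h x"
  shows "\<exists>C::real. \<forall>\<epsilon>>0. prediction_error \<mu> T h \<epsilon> (delay_map T h x :: real ^ ('k::{finite,linorder})) \<le> C * \<epsilon>"
proof -
  obtain n :: nat where n: "\<And>y. y \<in> X \<Longrightarrow> delay_dist h (T x) (T y) \<le> real n * delay_dist h x y"
    using pred unfolding predictable_def by blast
  have bij: "bij_betw (\<lambda>i::'k. card {j. j < i}) UNIV {..<k}" using bij_betw_card_less card by metis
  have dd: "delay_dist h a b = (\<Sum>i\<in>UNIV. \<bar>(delay_map T h a - delay_map T h b :: real ^ ('k::{finite,linorder})) $ i\<bar>)" for a b
    unfolding delay_dist_def delay_map_def using sum.reindex_bij_betw[OF bij, of "\<lambda>i. \<bar>h ((T ^^ i) a) - h ((T ^^ i) b)\<bar>"]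
    by simp
  have lower: "norm (delay_map T h a - delay_map T h b :: real ^ ('k::{finite,linorder})) \<le> delay_dist h a b" for a b
    unfolding dd by (rule norm_le_l1_cart)
  have upper: "delay_dist h a b \<le> real k * norm (delay_map T h a - delay_map T h b :: real ^ ('k::{finite,linorder}))" for a b
  proof -
    have "delay_dist h a b \<le> (\<Sum>i\<in>(UNIV::'k set). norm (delay_map T h a - delay_map T h b :: real ^ ('k::{finite,linorder})))"
      unfolding dd by (intro sum_mono component_le_norm_cart)
    then show ?thesis using card by simp
  qed
  obtain K where K: "\<And>z. \<bar>h z\<bar> \<le> K" using Cr_functions_bounded[OF h] by blast
  have "prediction_error \<mu> T h \<epsilon> (delay_map T h x :: real ^ ('k::{finite,linorder})) \<le> (2 * (real n * real k)) * \<epsilon>" if \<epsilon>: "\<epsilon> > 0" for \<epsilon>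
  proof -
    have "prediction_error \<mu> T h \<epsilon> (delay_map T h x :: real ^ ('k::{finite,linorder})) \<le> 2 * (real n * (real k * \<epsilon>))"
    proof (rule prediction_error_le[OF prob_\<mu> sets_\<mu> Cr_functions_continuous[OF h] continuous_T K])
      show "0 \<le> real n * (real k * \<epsilon>)" using \<epsilon> by simp
      fix z assume "z \<in> delay_preimage \<mu> T h \<epsilon> (delay_map T h x :: real ^ ('k::{finite,linorder}))"
      then have z: "z \<in> X" "norm (delay_map T h x - delay_map T h z :: real ^ ('k::{finite,linorder})) < \<epsilon>"
        by (auto simp: delay_preimage_def space_\<mu> dist_norm)
      have "norm (delay_map T h (T z) - delay_map T h (T x) :: real ^ ('k::{finite,linorder})) \<le> delay_dist h (T x) (T z)"
        using lower[of "T x" "T z"] by (simp add: norm_minus_commute)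
      also have "\<dots> \<le> real n * delay_dist h x z" by (rule n[OF z(1)])
      also have "\<dots> \<le> real n * (real k * \<epsilon>)"
        using z(2) by (intro mult_left_mono order_trans[OF upper]) auto
      finally show "norm (delay_map T h (T z) - delay_map T h (T x) :: real ^ ('k::{finite,linorder})) \<le> real n * (real k * \<epsilon>)" .
    qed
    then show ?thesis by (simp add: mult.assoc)
  qed
  then show ?thesis by blast
qed

section \<open>Borel measurability of the set of good observables\<close>

definition pred_level :: "('m \<Rightarrow> real) \<Rightarrow> nat \<Rightarrow> real \<Rightarrow> 'm set" where
  "pred_level h n s = X \<inter> {x. \<forall>y\<in>X. delay_dist h (T x) (T y) \<le> real n * delay_dist h x y + s}"

lemma delay_dist_commute: "delay_dist h x y = delay_dist h y x"
  by (simp add: delay_dist_def abs_minus_commute)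

lemma pred_level_sets:
  assumes h: "continuous_on UNIV h" shows "pred_level h n s \<in> sets \<mu>"
proof -
  have 1: "continuous_on UNIV (\<lambda>x. delay_dist h x y)" for y
    using continuous_delay_dist[OF h, of y] by (simp add: delay_dist_commute)
  have "continuous_on UNIV (\<lambda>x. delay_dist h (T x) (T y))" for y
    by (rule continuous_on_compose2[OF 1 continuous_T]) auto
  with 1 have "closed {x. delay_dist h (T x) (T y) \<le> real n * delay_dist h x y + s}" for y
    by (intro closed_Collect_le continuous_intros)
  then have "closed (\<Inter>y\<in>X. {x. delay_dist h (T x) (T y) \<le> real n * delay_dist h x y + s})" by (intro closed_INT) auto
  moreover have "{x. \<forall>y\<in>X. delay_dist h (T x) (T y) \<le> real n * delay_dist h x y + s} =
      (\<Inter>y\<in>X. {x. delay_dist h (T x) (T y) \<le> real n * delay_dist h x y + s})" by auto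
  ultimately show ?thesis unfolding pred_level_def by (simp add: closed_Int_sets)
qed

text \<open>The level sets increase with \<open>n\<close> to the set of predictable points of
  \<open>X\<close>, so continuity of the measure expresses the condition by countably many
  inequalities.\<close>

lemma AE_predictable_iff:
  assumes h: "continuous_on UNIV h"
  shows "(AE x in \<mu>. predictable h x) \<longleftrightarrow> (\<forall>m::nat. \<exists>n::nat. 1 - 1 / real (Suc m) \<le> prob (pred_level h n 0))"
proof -
  let ?U = "\<Union>n. pred_level h n 0"
  have U: "?U \<in> events" using pred_level_sets[OF h] by blast
  have "incseq (\<lambda>n. pred_level h n 0)"
  proof (rule incseq_SucI, rule subsetI)
    fix n x assume x: "x \<in> pred_level h n 0"
    have "delay_dist h (T x) (T y) \<le> real (Suc n) * delay_dist h x y + 0" if "y \<in> X" for y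
      using x that delay_dist_nonneg[of h x y] unfolding pred_level_def by (fastforce simp: algebra_simps)
    then show "x \<in> pred_level h (Suc n) 0" using x unfolding pred_level_def by blast
  qed
  then have lim: "(\<lambda>n. prob (pred_level h n 0)) \<longlonglongrightarrow> prob ?U"
    using pred_level_sets[OF h] by (intro finite_Lim_measure_incseq) auto
  have "(AE x in \<mu>. predictable h x) \<longleftrightarrow> (AE x in \<mu>. x \<in> ?U)"
    by (intro AE_cong) (auto simp: predictable_def pred_level_def space_\<mu>)
  also have "\<dots> \<longleftrightarrow> prob ?U = 1" using U by (rule AE_in_set_eq_1)
  also have "\<dots> \<longleftrightarrow> (\<forall>m::nat. \<exists>n::nat. 1 - 1 / real (Suc m) \<le> prob (pred_level h n 0))"
  proof
    assume "prob ?U = 1"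
    then have "eventually (\<lambda>n. 1 - 1 / real (Suc m) < prob (pred_level h n 0)) sequentially" for m
      using lim by (intro order_tendstoD(1)) auto
    then show "\<forall>m::nat. \<exists>n::nat. 1 - 1 / real (Suc m) \<le> prob (pred_level h n 0)"
      by (meson eventually_happens less_imp_le sequentially_bot)
  next
    assume R: "\<forall>m::nat. \<exists>n::nat. 1 - 1 / real (Suc m) \<le> prob (pred_level h n 0)"
    have le: "1 - 1 / real (Suc m) \<le> prob ?U" for m
    proof -
      obtain n where "1 - 1 / real (Suc m) \<le> prob (pred_level h n 0)" using R by blast
      also have "\<dots> \<le> prob ?U" using U by (intro finite_measure_mono) auto
      finally show ?thesis .
    qed
    have "1 \<le> prob ?U"
    proof (rule ccontr)
      assume "\<not> 1 \<le> prob ?U"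
      then obtain m where "1 / real (Suc m) < 1 - prob ?U" using nat_approx_posE[of "1 - prob ?U"] by auto
      with le[of m] show False by linarith
    qed
    then show "prob ?U = 1" using prob_le_1[of ?U] by linarith
  qed
  finally show ?thesis .
qed

lemma delay_dist_perturbation:
  assumes "\<And>x. \<bar>f x - h x\<bar> < \<eta>"
  shows "\<bar>delay_dist f x y - delay_dist h x y\<bar> \<le> 2 * real k * \<eta>"
proof -
  have "\<bar>delay_dist f x y - delay_dist h x y\<bar> \<le>
      (\<Sum>i<k. \<bar>\<bar>f ((T ^^ i) x) - f ((T ^^ i) y)\<bar> - \<bar>h ((T ^^ i) x) - h ((T ^^ i) y)\<bar>\<bar>)"
    unfolding delay_dist_def sum_subtractf[symmetric] by (rule sum_abs)
  also have "\<dots> \<le> (\<Sum>i<k. 2 * \<eta>)"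
  proof (rule sum_mono)
    fix i
    show "\<bar>\<bar>f ((T ^^ i) x) - f ((T ^^ i) y)\<bar> - \<bar>h ((T ^^ i) x) - h ((T ^^ i) y)\<bar>\<bar> \<le> 2 * \<eta>"
      using assms[of "(T ^^ i) x"] assms[of "(T ^^ i) y"] by linarith
  qed
  finally show ?thesis by simp
qed

text \<open>Upper semicontinuity: as the slack tends to 0 the level sets decrease to the one without
  slack, so a small positive slack keeps the measure below \<open>c\<close>, and it absorbs every
  uniformly small change of the observable. The translation by \<open>v\<close> prepares for
  statements about \<open>v + e\<close>.\<close>

lemma openin_prob_pred_level_less:
  assumes v: "v \<in> Cr_functions r A"
  shows "openin Cr_space {h \<in> Cr_functions r A. prob (pred_level (\<lambda>x. v x + h x) n 0) < c}"
proof (rule openin_if_uniformly_open)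
  fix h assume "h \<in> {h \<in> Cr_functions r A. prob (pred_level (\<lambda>x. v x + h x) n 0) < c}"
  then have h: "h \<in> Cr_functions r A" "prob (pred_level (\<lambda>x. v x + h x) n 0) < c" by auto
  let ?h = "\<lambda>x. v x + h x"
  have hc: "continuous_on UNIV (\<lambda>x. v x + f x)" if "f \<in> Cr_functions r A" for f
    by (rule Cr_functions_continuous[OF Cr_functions_add[OF v that]])
  let ?s = "\<lambda>j. 1 / real (Suc j)"
  have "(\<Inter>j. pred_level ?h n (?s j)) = pred_level ?h n 0"
  proof (intro equalityI subsetI)
    fix x assume x: "x \<in> (\<Inter>j. pred_level ?h n (?s j))"
    have "delay_dist ?h (T x) (T y) \<le> real n * delay_dist ?h x y + 0" if y: "y \<in> X" for y
    proof (rule ccontr)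
      assume "\<not> ?thesis"
      then obtain j where "?s j < delay_dist ?h (T x) (T y) - real n * delay_dist ?h x y"
        using nat_approx_posE[of "delay_dist ?h (T x) (T y) - real n * delay_dist ?h x y"] by auto
      moreover have "x \<in> pred_level ?h n (?s j)" using x by blast
      ultimately show False using y unfolding pred_level_def by fastforce
    qed
    then show "x \<in> pred_level ?h n 0" using x unfolding pred_level_def by blast
  next
    fix x assume x: "x \<in> pred_level ?h n 0"
    have "delay_dist ?h (T x) (T y) \<le> real n * delay_dist ?h x y + ?s j" if "y \<in> X" for y j
    proof -
      have "delay_dist ?h (T x) (T y) \<le> real n * delay_dist ?h x y + 0"
        using x that unfolding pred_level_def by blast
      also have "\<dots> \<le> real n * delay_dist ?h x y + ?s j" by simp
      finally show ?thesis .
    qed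
    then show "x \<in> (\<Inter>j. pred_level ?h n (?s j))" using x unfolding pred_level_def by blast
  qed
  moreover have "(\<lambda>j. prob (pred_level ?h n (?s j))) \<longlonglongrightarrow> prob (\<Inter>j. pred_level ?h n (?s j))"
  proof (rule finite_Lim_measure_decseq)
    show "range (\<lambda>j. pred_level ?h n (?s j)) \<subseteq> events" using pred_level_sets[OF hc[OF h(1)]] by blast
    show "decseq (\<lambda>j. pred_level ?h n (?s j))"
    proof (rule decseq_SucI, rule subsetI)
      fix j x assume x: "x \<in> pred_level ?h n (?s (Suc j))"
      have s: "?s (Suc j) \<le> ?s j" by (simp add: frac_le)
      have "delay_dist ?h (T x) (T y) \<le> real n * delay_dist ?h x y + ?s j" if "y \<in> X" for y
      proof -
        have "delay_dist ?h (T x) (T y) \<le> real n * delay_dist ?h x y + ?s (Suc j)"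
          using x that unfolding pred_level_def by blast
        then show ?thesis using s by linarith
      qed
      then show "x \<in> pred_level ?h n (?s j)" using x unfolding pred_level_def by blast
    qed
  qed
  ultimately have "(\<lambda>j. prob (pred_level ?h n (?s j))) \<longlonglongrightarrow> prob (pred_level ?h n 0)" by simp
  then have "eventually (\<lambda>j. prob (pred_level ?h n (?s j)) < c) sequentially"
    using h(2) by (rule order_tendstoD(2))
  then obtain j where j: "prob (pred_level ?h n (?s j)) < c" by (auto simp: eventually_sequentially)
  \<comment> \<open>A change of the observable by \<eta> alters \<open>delay_dist\<close> by at most
    2k\<eta>, once on the left of the inequality and \<open>n\<close> times on the right.\<close>
  define \<eta> where "\<eta> = ?s j / (2 * real k * (real n + 1))"
  have \<eta>: "\<eta> > 0" using k_pos by (simp add: \<eta>_def)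
  have \<eta>s: "(real n + 1) * (2 * real k * \<eta>) = ?s j"
    using k_pos by (simp add: \<eta>_def divide_simps)
  show "\<exists>\<eta>>0. \<forall>f\<in>Cr_functions r A. (\<forall>x. \<bar>f x - h x\<bar> < \<eta>) \<longrightarrow>
      f \<in> {h \<in> Cr_functions r A. prob (pred_level (\<lambda>x. v x + h x) n 0) < c}"
  proof (intro exI[of _ \<eta>] conjI ballI impI \<eta>)
    fix f assume f: "f \<in> Cr_functions r A" "\<forall>x. \<bar>f x - h x\<bar> < \<eta>"
    let ?f = "\<lambda>x. v x + f x"
    have dd: "\<bar>delay_dist ?f a b - delay_dist ?h a b\<bar> \<le> 2 * real k * \<eta>" for a b
      by (rule delay_dist_perturbation) (use f(2) in simp)
    have "pred_level ?f n 0 \<subseteq> pred_level ?h n (?s j)"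
    proof
      fix x assume x: "x \<in> pred_level ?f n 0"
      have "delay_dist ?h (T x) (T y) \<le> real n * delay_dist ?h x y + ?s j" if "y \<in> X" for y
      proof -
        have 1: "delay_dist ?f (T x) (T y) \<le> real n * delay_dist ?f x y + 0"
          using x that unfolding pred_level_def by blast
        have "delay_dist ?f x y \<le> delay_dist ?h x y + 2 * real k * \<eta>" using dd[of x y] by linarith
        then have "real n * delay_dist ?f x y \<le> real n * (delay_dist ?h x y + 2 * real k * \<eta>)"
          by (rule mult_left_mono) simp
        then have "delay_dist ?h (T x) (T y) \<le> real n * (delay_dist ?h x y + 2 * real k * \<eta>) + 2 * real k * \<eta>"
          using 1 dd[of "T x" "T y"] by linarith
        also have "\<dots> = real n * delay_dist ?h x y + (real n + 1) * (2 * real k * \<eta>)" by (simp add: algebra_simps)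
        finally show ?thesis unfolding \<eta>s .
      qed
      then show "x \<in> pred_level ?h n (?s j)" using x unfolding pred_level_def by blast
    qed
    then have "prob (pred_level ?f n 0) \<le> prob (pred_level ?h n (?s j))"
      by (rule finite_measure_mono) (rule pred_level_sets[OF hc[OF h(1)]])
    then show "f \<in> {h \<in> Cr_functions r A. prob (pred_level (\<lambda>x. v x + h x) n 0) < c}" using f(1) j by simp
  qed
qed simp

abbreviation Cr_borel :: "('m \<Rightarrow> real) measure" where
  "Cr_borel \<equiv> sigma (topspace Cr_space) {U. openin Cr_space U}"

lemma open_subset_Pow: "{U. openin Cr_space U} \<subseteq> Pow (topspace Cr_space)"
  by (auto dest: openin_subset)

lemma space_Cr_borel: "space Cr_borel = Cr_functions r A"
  by (simp add: space_measure_of_conv topspace_Cr_space)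

lemma openin_sets: "openin Cr_space U \<Longrightarrow> U \<in> sets Cr_borel"
  by (simp add: sets_measure_of[OF open_subset_Pow])

lemma AE_predictable_sets:
  assumes v: "v \<in> Cr_functions r A"
  shows "{h \<in> space Cr_borel. AE x in \<mu>. predictable (\<lambda>x. v x + h x) x} \<in> sets Cr_borel"
proof -
  have "{h \<in> space Cr_borel. AE x in \<mu>. predictable (\<lambda>x. v x + h x) x} =
      {h \<in> space Cr_borel. \<forall>m::nat. \<exists>n::nat. \<not> prob (pred_level (\<lambda>x. v x + h x) n 0) < 1 - 1 / real (Suc m)}"
    unfolding space_Cr_borel
    using AE_predictable_iff[OF Cr_functions_continuous[OF Cr_functions_add[OF v]]] by (auto simp: not_less)
  also have "\<dots> \<in> sets Cr_borel"
    using openin_sets[OF openin_prob_pred_level_less[OF v]]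
    by (intro sets.sets_Collect) (simp add: space_Cr_borel)
  finally show ?thesis .
qed

section \<open>The probe measure\<close>

definition cube :: "(nat \<Rightarrow> real) set" where
  "cube = ({..<N} \<rightarrow>\<^sub>E {-1..1})"

lemma cube_sets: "cube \<in> sets param"
  unfolding cube_def by (intro sets_PiM_I_finite) auto

lemma emeasure_cube: "emeasure param cube = 2 ^ N"
proof -
  interpret product_sigma_finite "\<lambda>_::nat. lborel :: real measure" by standard
  show ?thesis unfolding cube_def by (subst emeasure_PiM) auto
qed

text \<open>Points of \<open>param\<close> are \<open>undefined\<close> beyond \<open>N\<close>. The
  value 0 instead places the cube inside the compact cube of all sequences, on which
  \<open>lincomb\<close> is continuous.\<close>

definition extend :: "(nat \<Rightarrow> real) \<Rightarrow> nat \<Rightarrow> real" where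
  "extend \<alpha> n = (if n < N then \<alpha> n else 0)"

lemma lincomb_extend: "lincomb N hs (extend \<alpha>) = lincomb N hs \<alpha>"
  by (auto simp: lincomb_def extend_def)

lemma measurable_lincomb: "lincomb N hs \<in> measurable param Cr_borel"
proof -
  have "extend \<in> borel_measurable param"
  proof (rule measurable_coordinatewise_then_product)
    fix n
    show "(\<lambda>\<alpha>. extend \<alpha> n) \<in> borel_measurable param"
    proof (cases "n < N")
      case True
      then show ?thesis
        using measurable_component_singleton[of n "{..<N}" "\<lambda>_. lborel :: real measure"] by (simp add: extend_def)
    qed (simp add: extend_def)
  qed
  moreover have "lincomb N hs \<in> measurable borel Cr_borel"
  proof (rule measurable_measure_of[OF open_subset_Pow])
    have cm: "continuous_map euclidean Cr_space (lincomb N hs)" by (rule continuous_map_lincomb[OF probe_Cr])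
    show "lincomb N hs \<in> space borel \<rightarrow> topspace Cr_space"
      using lincomb_Cr_functions[OF probe_Cr] by (auto simp: topspace_Cr_space)
    fix U assume "U \<in> {U. openin Cr_space U}"
    then have "open (lincomb N hs -` U)"
      using openin_continuous_map_preimage[OF cm, of U] by (simp add: vimage_def)
    then show "lincomb N hs -` U \<inter> space borel \<in> sets borel" by simp
  qed
  ultimately have "(\<lambda>\<alpha>. lincomb N hs (extend \<alpha>)) \<in> measurable param Cr_borel" by (rule measurable_compose)
  then show ?thesis by (simp add: lincomb_extend)
qed

definition probe_measure :: "('m \<Rightarrow> real) measure" where
  "probe_measure = distr (density param (indicator cube)) Cr_borel (lincomb N hs)"

lemma probe_measure_compact:
  "\<exists>K. compactin Cr_space K \<and> 0 < emeasure probe_measure K \<and> emeasure probe_measure K < \<infinity>"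
proof -
  define K where "K = lincomb N hs ` {c. \<forall>b. c b \<in> {-1..1}}"
  have K: "compactin Cr_space K" unfolding K_def
    using compact_coordinate_cube by (intro image_compactin[OF _ continuous_map_lincomb[OF probe_Cr]]) simp
  have "closedin Cr_space K" using compactin_imp_closedin[OF Hausdorff_Cr_space K] .
  then have "topspace Cr_space - K \<in> sets Cr_borel" by (intro openin_sets) (simp add: closedin_def)
  then have "space Cr_borel - (topspace Cr_space - K) \<in> sets Cr_borel" by (rule sets.compl_sets)
  moreover have "space Cr_borel - (topspace Cr_space - K) = K"
    unfolding space_Cr_borel using compactin_subset_topspace[OF K] by (auto simp: topspace_Cr_space)
  ultimately have Km: "K \<in> sets Cr_borel" by simp
  let ?P = "lincomb N hs -` K \<inter> space param"
  have Pm: "?P \<in> sets param" by (rule measurable_sets[OF measurable_lincomb Km])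
  have sub: "cube \<subseteq> ?P"
  proof
    fix \<alpha> assume \<alpha>: "\<alpha> \<in> cube"
    then have "extend \<alpha> \<in> {c. \<forall>b. c b \<in> {-1..1}}" by (auto simp: cube_def extend_def PiE_iff)
    then have "lincomb N hs (extend \<alpha>) \<in> K" unfolding K_def by blast
    then show "\<alpha> \<in> ?P" using \<alpha> by (auto simp: lincomb_extend cube_def space_PiM PiE_iff)
  qed
  have "emeasure probe_measure K = emeasure (density param (indicator cube)) ?P"
    unfolding probe_measure_def by (subst emeasure_distr) (use measurable_lincomb Km in auto)
  also have "\<dots> = (\<integral>\<^sup>+ \<alpha>. indicator cube \<alpha> * indicator ?P \<alpha> \<partial>param)"
    using cube_sets Pm by (intro emeasure_density) auto
  also have "\<dots> = (\<integral>\<^sup>+ \<alpha>. indicator cube \<alpha> \<partial>param)"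
    using sub by (intro nn_integral_cong) (auto simp: indicator_def)
  also have "\<dots> = 2 ^ N" using cube_sets by (simp add: emeasure_cube)
  finally have eK: "emeasure probe_measure K = 2 ^ N" .
  have "(2::ennreal) ^ N = ennreal (2 ^ N)" by (metis ennreal_numeral ennreal_power zero_le_numeral)
  then have "(0::ennreal) < 2 ^ N" "(2::ennreal) ^ N < \<infinity>" by simp_all
  with K eK show ?thesis by metis
qed

lemma measurable_perturb_pair:
  assumes v: "v \<in> Cr_functions r A" and S: "continuous_on UNIV S"
  shows "(\<lambda>p. perturb v (snd p) (S (fst p))) \<in> borel_measurable (\<mu> \<Otimes>\<^sub>M param)"
  unfolding perturb_def lincomb_def
proof (intro borel_measurable_add borel_measurable_sum borel_measurable_times)
  have fm: "(\<lambda>p. f (S (fst p))) \<in> borel_measurable (\<mu> \<Otimes>\<^sub>M param)" if "f \<in> Cr_functions r A" for f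
  proof -
    have "continuous_on UNIV (\<lambda>x. f (S x))"
      by (rule continuous_on_compose2[OF Cr_functions_continuous[OF that] S]) auto
    from measurable_compose[OF measurable_fst measurable_\<mu>[OF this]] show ?thesis .
  qed
  show "(\<lambda>p. v (S (fst p))) \<in> borel_measurable (\<mu> \<Otimes>\<^sub>M param)" by (rule fm[OF v])
  show "(\<lambda>p. hs n (S (fst p))) \<in> borel_measurable (\<mu> \<Otimes>\<^sub>M param)" for n by (rule fm[OF probe_Cr])
  fix n assume "n \<in> {..<N}"
  from measurable_component_singleton[OF this, of "\<lambda>_. lborel :: real measure"]
  have "(\<lambda>\<alpha>. \<alpha> n) \<in> borel_measurable param" by simp
  from measurable_compose[OF measurable_snd this]
  show "(\<lambda>p. snd p n) \<in> borel_measurable (\<mu> \<Otimes>\<^sub>M param)" .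
qed

text \<open>Joint measurability in the point and the parameter, which allows the two
  almost-everywhere quantifiers to be exchanged.\<close>

lemma predictable_pair_sets:
  assumes v: "v \<in> Cr_functions r A"
  shows "{p \<in> space (\<mu> \<Otimes>\<^sub>M param). predictable (perturb v (snd p)) (fst p)} \<in> sets (\<mu> \<Otimes>\<^sub>M param)"
proof -
  obtain Y where Y: "test_set Y X" using countable_test_set by blast
  have hc: "continuous_on UNIV (perturb v \<alpha>)" for \<alpha>
    by (rule Cr_functions_continuous[OF perturb_Cr_functions[OF v]])
  have m1: "(\<lambda>p. delay_dist (perturb v (snd p)) (S (fst p)) y) \<in> borel_measurable (\<mu> \<Otimes>\<^sub>M param)"
    if S: "continuous_on UNIV S" for S y
    unfolding delay_dist_def
  proof (intro borel_measurable_sum borel_measurable_abs borel_measurable_diff)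
    fix i
    have "continuous_on UNIV (\<lambda>x. (T ^^ i) (S x))" by (rule continuous_on_compose2[OF continuous_iter S]) auto
    from measurable_perturb_pair[OF v this]
    show "(\<lambda>p. perturb v (snd p) ((T ^^ i) (S (fst p)))) \<in> borel_measurable (\<mu> \<Otimes>\<^sub>M param)" .
    from measurable_perturb_pair[OF v, of "\<lambda>_. (T ^^ i) y"]
    show "(\<lambda>p. perturb v (snd p) ((T ^^ i) y)) \<in> borel_measurable (\<mu> \<Otimes>\<^sub>M param)" by simp
  qed
  have "{p \<in> space (\<mu> \<Otimes>\<^sub>M param). predictable (perturb v (snd p)) (fst p)} =
      {p \<in> space (\<mu> \<Otimes>\<^sub>M param). \<exists>n::nat. \<forall>y\<in>Y. delay_dist (perturb v (snd p)) (T (fst p)) (T y) \<le>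
        real n * delay_dist (perturb v (snd p)) (fst p) y}"
    using predictable_countable[OF Y hc] by blast
  also have "\<dots> \<in> sets (\<mu> \<Otimes>\<^sub>M param)"
    using m1[OF continuous_T] m1[OF continuous_on_id]
    by (intro sets.sets_Collect_countable_Ex sets.sets_Collect_countable_All'[OF _ test_setD(1)[OF Y]]
        borel_measurable_le borel_measurable_times borel_measurable_const) auto
  finally show ?thesis .
qed

lemma AE_probe_predictable:
  assumes card: "CARD('k::finite) = k" and v: "v \<in> Cr_functions r A"
    and orbit: "AE x in \<mu>. inj_on (\<lambda>i. (T ^^ i) x) {..<k}"
  shows "AE e in probe_measure. AE x in \<mu>. predictable (\<lambda>x. v x + e x) x"
proof -
  interpret product_sigma_finite "\<lambda>_::nat. lborel :: real measure" by standard
  interpret P: finite_product_sigma_finite "\<lambda>_::nat. lborel :: real measure" "{..<N}" by standard simp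
  interpret pair_sigma_finite \<mu> param
    by (rule pair_sigma_finite.intro[OF sigma_finite_measure_axioms P.sigma_finite_measure_axioms])
  have "AE x in \<mu>. AE \<alpha> in param. predictable (perturb v \<alpha>) x"
    using orbit by eventually_elim (rule AE_predictable[OF card v])
  then have "AE \<alpha> in param. AE x in \<mu>. predictable (perturb v \<alpha>) x"
    by (subst (asm) AE_commute) (use predictable_pair_sets[OF v] in simp)
  then have "AE \<alpha> in density param (indicator cube). AE x in \<mu>. predictable (perturb v \<alpha>) x"
    using cube_sets by (subst AE_density) (auto elim: eventually_mono)
  then have "AE \<alpha> in density param (indicator cube). AE x in \<mu>. predictable (\<lambda>x. v x + lincomb N hs \<alpha> x) x"
    by (simp add: perturb_def[abs_def])
  then show ?thesis unfolding probe_measure_def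
    by (subst AE_distr_iff) (use measurable_lincomb AE_predictable_sets[OF v] in auto)
qed

text \<open>The prevalent Borel subset is the set of observables for which almost every point is
  predictable; only this smaller set is shown to be Borel.\<close>

lemma prevalent_prediction:
  assumes card: "CARD('k::{finite,linorder}) = k"
    and orbit: "AE x in \<mu>. inj_on (\<lambda>i. (T ^^ i) x) {..<k}"
  shows "prevalent Cr_space {h \<in> Cr_functions r A.
    AE x in \<mu>. \<exists>C::real. \<forall>\<epsilon>>0. prediction_error \<mu> T h \<epsilon> (delay_map T h x :: real ^ ('k::{finite,linorder})) \<le> C * \<epsilon>}"
proof -
  let ?S' = "{h \<in> Cr_functions r A. AE x in \<mu>. predictable h x}"
  have "?S' = {h \<in> space Cr_borel. AE x in \<mu>. predictable (\<lambda>x. 0 + h x) x}" by (simp add: space_Cr_borel)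
  also have "\<dots> \<in> sets Cr_borel" by (rule AE_predictable_sets[OF Cr_functions_const])
  finally have S': "?S' \<in> sets Cr_borel" .
  have "AE e in probe_measure. v + e \<in> ?S'" if v: "v \<in> topspace Cr_space" for v
  proof -
    have vC: "v \<in> Cr_functions r A" using v by (simp add: topspace_Cr_space)
    have "AE e in probe_measure. e \<in> space probe_measure" by (rule AE_space)
    then show ?thesis using AE_probe_predictable[OF card vC orbit]
    proof eventually_elim
      case (elim e)
      then have "e \<in> Cr_functions r A" by (simp add: probe_measure_def space_Cr_borel[simplified])
      then have "v + e \<in> Cr_functions r A" using Cr_functions_add[OF vC] by (simp add: plus_fun_def)
      then show ?case using elim(2) by (simp add: plus_fun_def)
    qed
  qed
  moreover have "sets probe_measure = sets Cr_borel" by (simp add: probe_measure_def)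
  ultimately have "prevalent_borel Cr_space ?S'"
    unfolding prevalent_borel_def using S' probe_measure_compact by blast
  moreover have "?S' \<subseteq> {h \<in> Cr_functions r A.
    AE x in \<mu>. \<exists>C::real. \<forall>\<epsilon>>0. prediction_error \<mu> T h \<epsilon> (delay_map T h x :: real ^ ('k::{finite,linorder})) \<le> C * \<epsilon>}"
    using prediction_error_if_predictable[OF card] by (auto elim!: eventually_mono)
  ultimately show ?thesis unfolding prevalent_def topspace_Cr_space by blast
qed

end

theorem theorem5p1:
  fixes r :: enat
    and A :: "('m::t2_space, 'e::real_normed_vector) chart set"
    and g :: "('m, 'e) chart \<Rightarrow> 'm \<Rightarrow> 'e \<Rightarrow> 'e \<Rightarrow> real"
    and T :: "'m \<Rightarrow> 'm"
    and X :: "'m set"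
    and \<mu> :: "'m measure"
  assumes "1 \<le> r"
    and "compact (UNIV :: 'm set)"
    and "Cr_manifold r A"
    and "riemannian_metric A g"
    and "Cr_diffeomorphism r A T"
    and "compact X"
    and "prob_space \<mu>"
    and "sets \<mu> = sets (restrict_space borel X)"
    and "hausdorff_measure (riemannian_dist A g) CARD('k::{finite,linorder}) X = 0"
    and "dim (UNIV :: 'e set) \<le> CARD('k)"
    and "emeasure \<mu> (X \<inter> (\<Union>p\<in>{1..CARD('k) - 1}. Per p T)) = 0"
  shows "prevalent (Cr_topology r A)
    {h \<in> Cr_functions r A.
       AE x in \<mu>. \<exists>C::real. \<forall>\<epsilon>>0. prediction_error \<mu> T h \<epsilon> (delay_map T h x :: real ^ ('k::{finite,linorder})) \<le> C * \<epsilon>}"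
proof -
  obtain B0 :: "'e set" where B0: "finite B0" "span B0 = UNIV" using assms(3) unfolding Cr_manifold_def by blast
  \<comment> \<open>The manifold provides a finite spanning set; a basis is extracted from it, so
    that \<open>dim\<close> becomes a cardinality.\<close>
  obtain B where B: "B \<subseteq> B0" "independent B" "B0 \<subseteq> span B"
    using real_vector.maximal_independent_subset[of B0] by metis
  have fB: "finite B" using B(1) B0(1) by (rule finite_subset)
  have sB: "span B = UNIV" using B(3) B0(2) by (metis real_vector.span_mono real_vector.span_span top.extremum_uniqueI)
  have "dim (UNIV :: 'e set) = card B" using B(2) sB by (metis real_vector.dim_eq_card real_vector.span_UNIV)
  then interpret delay_setting B r A g T X "CARD('k)"
    using assms fB B(2) sB by unfold_locales auto
  have "\<exists>N hs. probe_setting B r A g T X CARD('k) N hs"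
  proof (rule probe_functions[of "2 * CARD('k)"])
    fix N :: nat and hs :: "nat \<Rightarrow> 'm \<Rightarrow> real"
    assume a: "\<And>n. hs n \<in> Cr_functions r A"
      "\<And>z Z. finite Z \<Longrightarrow> card Z \<le> 2 * CARD('k) \<Longrightarrow> z \<notin> Z \<Longrightarrow>
         \<exists>c. lincomb N hs c z = 1 \<and> (\<forall>w\<in>Z. lincomb N hs c w = 0)"
      "\<And>z Z f. finite Z \<Longrightarrow> card Z \<le> 2 * CARD('k) \<Longrightarrow> z \<notin> Z \<Longrightarrow> f \<in> Cr_functions 1 A \<Longrightarrow>
         \<exists>c. zero_deriv (\<lambda>x. lincomb N hs c x - f x) z \<and> (\<forall>w\<in>Z. zero_deriv (lincomb N hs c) w)"
    have "probe_setting B r A g T X CARD('k) N hs"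
      by unfold_locales (rule a; assumption)+
    then show ?thesis by blast
  qed
  then obtain N hs where "probe_setting B r A g T X CARD('k) N hs" by blast
  then interpret prediction_setting B r A g T X "CARD('k)" N hs \<mu>
    using assms(7,8) by (intro prediction_setting.intro prediction_setting_axioms.intro)
  have closed_Per: "closed (Per p T)" for p
    unfolding Per_def by (intro closed_Collect_eq continuous_iter continuous_on_id)
  have "X \<inter> (\<Union>p\<in>{1..CARD('k) - 1}. Per p T) \<in> sets \<mu>"
    by (rule closed_Int_sets, rule closed_UN) (use closed_Per in auto)
  then have "X \<inter> (\<Union>p\<in>{1..CARD('k) - 1}. Per p T) \<in> null_sets \<mu>" using assms(11) by (simp add: null_sets_def)
  then have "AE x in \<mu>. x \<notin> X \<inter> (\<Union>p\<in>{1..CARD('k) - 1}. Per p T)" by (rule AE_not_in)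
  then have "AE x in \<mu>. inj_on (\<lambda>i. (T ^^ i) x) {..<CARD('k)}"
    using AE_space
  proof eventually_elim
    case (elim x)
    show ?case
    \<comment> \<open>Periods from 1 to k - 1 are exactly those that could make two of the first
      \<open>k\<close> iterates coincide.\<close>
    proof (rule orbit_inj)
      fix p assume "1 \<le> p" "p < CARD('k)"
      then have "p \<in> {1..CARD('k) - 1}" by simp
      then show "(T ^^ p) x \<noteq> x" using elim by (auto simp: space_\<mu> Per_def)
    qed
  qed
  then show ?thesis by (rule prevalent_prediction[OF refl])
qed

end
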